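(* Let $\alpha\ge 1/2$, $\lambda>0$, $r>0$, and let $X$ be a positive random variable with finite mean. Let $X_r$, $Y_r$ and $\mathcal V_r(X)=Y_r/\sqrt{X_r}$ be defined from $X$ by the quadratic gamma channel (see context), and let $\rho_r^\gamma$ denote the $\gamma$-score of $X_r$. Then, almost surely, $$\rho_r^{\gamma}(X_r)+\lambda\sqrt{X_r}-\frac{\alpha-1/2}{\sqrt{X_r}}=E\Big[\lambda\sqrt{rX}\;\mathcal V_r(X)\,\Big|\,X_r\Big],$$ and $$J_{\mathrm{st},\gamma(\alpha,\lambda)}(X_r)=\lambda\,E\Big[E\big[\sqrt{rX}\;\mathcal V_r(X)\,\big|\,X_r\big]^2\Big].$$
   Context: For $a,b>0$, $\gamma(a,b)$ denotes (a random variable with) the gamma distribution with density $\frac{b^{a}}{\Gamma(a)}x^{a-1}e^{-bx}$ on $(0,\infty)$; $\gamma(0,b)$ is understood as the constant $0$. Quadratic gamma channel: with $X$, $\gamma(\alpha-\tfrac12,\lambda)$ and a standard Gaussian $N$ mutually independent, $$Y_r=\sqrt{rX}+\frac{N}{\sqrt{2\lambda}},\qquad X_r=\gamma(\alpha-\tfrac12,\lambda)+Y_r^2 .$$ $\gamma$-score: for a positive random variable $W$, the $\gamma$-score $\rho_W^{\gamma}(W)$ is the ($W$-measurable, a.e. defined) random variable such that $$E\big[\sqrt W\,\rho_W^\gamma(W)\,\phi(W)\big]=-E\big[\sqrt W\,\partial_x^\sigma\phi(W)\big],\qquad \partial^\sigma_x\phi(x)=(\sqrt x\,\phi(x))',$$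 for all absolutely continuous test functions $\phi$ such that $x\mapsto\sqrt x\,\partial_x^\sigma\phi(x)$ is in $L^1(W)$. If $W$ has a differentiable density $p_W$ on $(0,\infty)$, then $\sqrt W\,\rho^\gamma_W(W)=W\rho_W(W)+\tfrac12$ with $\rho_W=(\log p_W)'$. Here $\rho_r^\gamma:=\rho_{X_r}^\gamma$. Standardized gamma Fisher information of a positive random variable $W$ with finite mean and a density: $$J_{\mathrm{st},\gamma(\alpha,\lambda)}(W)=\frac1\lambda E\left[\left(\rho_W^\gamma(W)+\lambda\sqrt W-\frac{\alpha-1/2}{\sqrt W}\right)^2\right].$$ *)

theory Defs
  imports "HOL-Probability.Probability"
begin

definition gamma_density :: "real \<Rightarrow> real \<Rightarrow> real \<Rightarrow> real" where
  "gamma_density a b x =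
     (if x > 0 then b powr a / Gamma a * x powr (a - 1) * exp (- b * x) else 0)"

text \<open>The gamma law with shape \<open>a\<close> and rate \<open>b\<close>; for \<open>a = 0\<close> it is the point mass at \<open>0\<close>.\<close>

definition gamma_law :: "real \<Rightarrow> real \<Rightarrow> real measure" where
  "gamma_law a b =
     (if a = 0 then return borel 0 else density lborel (\<lambda>x. ennreal (gamma_density a b x)))"

definition channel_Y :: "real \<Rightarrow> real \<Rightarrow> ('a \<Rightarrow> real) \<Rightarrow> ('a \<Rightarrow> real) \<Rightarrow> 'a \<Rightarrow> real" where
  "channel_Y r lam X N \<omega> = sqrt (r * X \<omega>) + N \<omega> / sqrt (2 * lam)"

definition channel_X ::
  "real \<Rightarrow> real \<Rightarrow> ('a \<Rightarrow> real) \<Rightarrow> ('a \<Rightarrow> real) \<Rightarrow> ('a \<Rightarrow> real) \<Rightarrow> 'a \<Rightarrow> real" where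
  "channel_X r lam X G N \<omega> = G \<omega> + (channel_Y r lam X N \<omega>)\<^sup>2"

definition channel_V ::
  "real \<Rightarrow> real \<Rightarrow> ('a \<Rightarrow> real) \<Rightarrow> ('a \<Rightarrow> real) \<Rightarrow> ('a \<Rightarrow> real) \<Rightarrow> 'a \<Rightarrow> real" where
  "channel_V r lam X G N \<omega> = channel_Y r lam X N \<omega> / sqrt (channel_X r lam X G N \<omega>)"

definition abs_continuous_on :: "real set \<Rightarrow> (real \<Rightarrow> real) \<Rightarrow> bool" where
  "abs_continuous_on S f \<longleftrightarrow>
     (\<forall>\<epsilon>>0. \<exists>\<delta>>0. \<forall>(n::nat) u v.
        (\<forall>i<n. u i \<le> v i \<and> {u i..v i} \<subseteq> S) \<longrightarrow>
        disjoint_family_on (\<lambda>i. {u i<..<v i}) {..<n} \<longrightarrow>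
        (\<Sum>i<n. v i - u i) < \<delta> \<longrightarrow>
        (\<Sum>i<n. \<bar>f (v i) - f (u i)\<bar>) < \<epsilon>)"

text \<open>For a test function \<open>\<phi>\<close> as below the derivative exists Lebesgue-almost everywhere on
  \<open>(0, \<infinity>)\<close>; the value of \<open>deriv\<close> on the exceptional set does not matter as soon as the law under
  consideration has a density.\<close>

definition dsigma :: "(real \<Rightarrow> real) \<Rightarrow> real \<Rightarrow> real" where
  "dsigma \<phi> x = deriv (\<lambda>t. sqrt t * \<phi> t) x"

text \<open>\<open>\<rho>\<close> is a version of the score function of the positive random variable \<open>W\<close>, the score itself
  being \<open>\<rho> \<circ> W\<close>. Expectations of functions of \<open>W\<close> are written as integrals over \<open>(0, \<infinity>)\<close> with respect
  to the law of \<open>W\<close>, since test functions live on \<open>[0, \<infinity>)\<close> only. Absolute continuity is meant on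
  compact subintervals of \<open>[0, \<infinity>)\<close>, the endpoint \<open>0\<close> included: admitting \<open>\<phi> x = 1 / sqrt x\<close>, for which
  \<open>dsigma \<phi> = 0\<close>, would exclude laws whose density behaves like \<open>1 / sqrt x\<close> at \<open>0\<close>.

  The identity is required whenever both of its sides are defined. Integrability of
  \<open>sqrt x * dsigma \<phi> x\<close> alone does not make the left-hand side defined for unbounded \<open>\<phi>\<close>. For
  \<open>\<phi> = 1\<close> the right-hand side is defined, so that integrability of \<open>sqrt x * \<rho> x\<close> is
  part of the condition; it makes the left-hand side defined for all bounded \<open>\<phi>\<close>.\<close>

definition is_gamma_score :: "'a measure \<Rightarrow> ('a \<Rightarrow> real) \<Rightarrow> (real \<Rightarrow> real) \<Rightarrow> bool" where
  "is_gamma_score M W \<rho> \<longleftrightarrow>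
     \<rho> \<in> borel_measurable borel \<and>
     set_integrable (distr M borel W) {0<..} (\<lambda>x. sqrt x * \<rho> x) \<and>
     (\<forall>\<phi>. (\<forall>b>0. abs_continuous_on {0..b} \<phi>) \<longrightarrow>
          set_integrable (distr M borel W) {0<..} (\<lambda>x. sqrt x * dsigma \<phi> x) \<longrightarrow>
          set_integrable (distr M borel W) {0<..} (\<lambda>x. sqrt x * \<rho> x * \<phi> x) \<longrightarrow>
          (LINT x:{0<..}|distr M borel W. sqrt x * \<rho> x * \<phi> x) =
            - (LINT x:{0<..}|distr M borel W. sqrt x * dsigma \<phi> x))"

definition gamma_score :: "'a measure \<Rightarrow> ('a \<Rightarrow> real) \<Rightarrow> real \<Rightarrow> real" where
  "gamma_score M W = (SOME \<rho>. is_gamma_score M W \<rho>)"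

text \<open>Extended nonnegative, so that an infinite second moment is not silently read as \<open>0\<close>.\<close>

definition std_gamma_fisher_info :: "'a measure \<Rightarrow> real \<Rightarrow> real \<Rightarrow> ('a \<Rightarrow> real) \<Rightarrow> ennreal" where
  "std_gamma_fisher_info M \<alpha> lam W =
     ennreal (1 / lam) *
     (\<integral>\<^sup>+\<omega>. ennreal ((gamma_score M W (W \<omega>) + lam * sqrt (W \<omega>) - (\<alpha> - 1/2) / sqrt (W \<omega>))\<^sup>2) \<partial>M)"

definition cond_exp_given :: "'a measure \<Rightarrow> ('a \<Rightarrow> real) \<Rightarrow> ('a \<Rightarrow> real) \<Rightarrow> 'a \<Rightarrow> real" where
  "cond_exp_given M W f = real_cond_exp M (vimage_algebra (space M) W borel) f"

end

theory Submission
  imports Defs "HOL-Real_Asymp.Real_Asymp"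
begin

text \<open>Let \<open>W = G + Y\<^sup>2\<close> with \<open>Y = sqrt (r X) + N / sqrt (2 \<lambda>)\<close> be the output of the channel, \<open>\<mu>\<close> its law and
  \<open>\<beta> = \<alpha> - 1/2\<close>.  The score is characterised by an integration by parts against \<open>\<mu>\<close>, so the regression
  formula follows from two facts: the function read off from the right-hand side satisfies the
  characterising identity, and any two functions that satisfy it agree \<open>\<mu>\<close>-almost everywhere.

  The identity comes from integrating by parts in the two noise variables.  For a bounded test
  function \<open>f\<close>, conditioning on \<open>(X, N)\<close> and using the gamma density gives
  \<open>E[G f'(W)] = E[(\<lambda> G - \<beta>) f(W)]\<close>, and conditioning on \<open>(X, G)\<close> and using the Gaussian density gives
  \<open>E[f(W)/2 + Y\<^sup>2 f'(W)] = \<lambda> E[(Y - sqrt (r X)) Y f(W)]\<close>.  As \<open>W = G + Y\<^sup>2\<close>, the sum is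
  \<open>E[W f'(W) + f(W)/2] = E[(\<lambda> W - \<beta> - \<lambda> sqrt (r X) Y) f(W)]\<close> (\<open>channel_stein_identity\<close>).  The left-hand
  side is \<open>E[sqrt W \<partial>\<^sup>\<sigma>f(W)]\<close>.  On the right-hand side \<open>Y = sqrt W V\<close>, so that only
  \<open>g(W) = E[\<lambda> sqrt (r X) V | W]\<close> matters, and \<open>\<rho>(x) = g(x) - \<lambda> sqrt x + \<beta> / sqrt x\<close> satisfies the identity
  of the score for such \<open>f\<close> (\<open>score_regression\<close>).

  The definition of the score admits every locally absolutely continuous \<open>\<phi>\<close> for which both sides are
  defined; it may be unbounded, and its derivative exists only almost everywhere.  The passage to these \<open>\<phi>\<close> is the subject
  of the locale \<open>stein_law\<close>.  Applying the identity to \<open>f(x) = u(x) / sqrt x\<close>, where \<open>u\<close> is a ramp, shows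
  that \<open>\<mu>\<close> has on the positive axis a density \<open>p\<close> with \<open>sqrt y p(y) = q(y)\<close>, where \<open>q(y)\<close> is minus the
  integral of \<open>\<rho>\<close> over \<open>{y<..}\<close> (\<open>weighted_law_density\<close>).  With \<open>u(x) = sqrt x \<phi>(x)\<close> the identity of the
  score is therefore the integration by parts of \<open>u' q\<close>; it follows by Fubini from \<open>u\<close> being the
  integral of its derivative (\<open>by_parts\<close>).  The boundary term \<open>u q\<close> vanishes at \<open>0\<close> because \<open>\<phi>\<close> is
  bounded there and \<open>sqrt y q(y)\<close> tends to \<open>0\<close>.  At infinity it converges, and a limit other than \<open>0\<close>
  would make \<open>u\<close> bounded and \<open>q\<close> bounded away from \<open>0\<close>, against the finiteness of
  \<open>\<integral> sqrt x d\<mu> = \<integral> q(y) dy\<close> (\<open>uq_tendsto_0\<close>).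

  That an absolutely continuous function is differentiable almost everywhere and is the integral of
  its derivative (\<open>abs_continuous_on_FTC\<close>) is obtained from the Radon-Nikodym theorem: its total
  variation is again absolutely continuous, so the function is a difference of two increasing
  absolutely continuous functions, and the Stieltjes measures of these have densities; Lebesgue
  differentiation of indefinite integrals does the rest.

  For uniqueness, test functions that approximate the indicators of half-lines suffice
  (\<open>is_gamma_score_unique\<close>).  The formula for the Fisher information is the integral of the square of
  the regression formula; the square is integrable by Jensen's inequality, because \<open>\<bar>V\<bar> \<le> 1\<close>.\<close>

section \<open>Absolutely continuous functions and their variation\<close>

text \<open>Families over an arbitrary finite index set, possibly with degenerate intervals: both are convenient
  for cutting and for merging families.\<close>

definition nonoverlapping :: "'i set \<Rightarrow> ('i \<Rightarrow> real) \<Rightarrow> ('i \<Rightarrow> real) \<Rightarrow> bool" where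
  "nonoverlapping I u v \<longleftrightarrow>
     finite I \<and> (\<forall>i\<in>I. u i \<le> v i) \<and> disjoint_family_on (\<lambda>i. {u i<..<v i}) I"

lemma nonoverlapping_reindex:
  assumes "nonoverlapping I u v" "inj_on h J" "h ` J = I"
  shows "nonoverlapping J (\<lambda>j. u (h j)) (\<lambda>j. v (h j))"
proof -
  have "disjoint_family_on (\<lambda>j. {u (h j)<..<v (h j)}) J"
    unfolding disjoint_family_on_def
  proof (intro ballI impI)
    fix m n assume "m \<in> J" "n \<in> J" "m \<noteq> n"
    then have "h m \<in> I" "h n \<in> I" "h m \<noteq> h n" using assms by (auto dest: inj_onD)
    then show "{u (h m)<..<v (h m)} \<inter> {u (h n)<..<v (h n)} = {}"
      using assms(1) unfolding nonoverlapping_def disjoint_family_on_def by blast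
  qed
  then show ?thesis
    using assms unfolding nonoverlapping_def by (auto dest: inj_onD simp: finite_image_iff)
qed

text \<open>The \<open>\<epsilon>\<close>-\<open>\<delta>\<close> condition of absolute continuity for one fixed pair, so that one \<open>\<delta>\<close> can serve families
  over different index types.\<close>

definition ac_gauge :: "real set \<Rightarrow> (real \<Rightarrow> real) \<Rightarrow> real \<Rightarrow> real \<Rightarrow> bool" where
  "ac_gauge S f \<epsilon> \<delta> \<longleftrightarrow>
     (\<forall>(n::nat) u v. nonoverlapping {..<n} u v \<longrightarrow> (\<forall>i<n. {u i..v i} \<subseteq> S) \<longrightarrow>
        (\<Sum>i<n. v i - u i) < \<delta> \<longrightarrow> (\<Sum>i<n. \<bar>f (v i) - f (u i)\<bar>) < \<epsilon>)"

lemma abs_continuous_on_gauge: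
  "abs_continuous_on S f \<longleftrightarrow> (\<forall>\<epsilon>>0. \<exists>\<delta>>0. ac_gauge S f \<epsilon> \<delta>)"
proof -
  have "((\<forall>i<n. u i \<le> v i \<and> {u i..v i} \<subseteq> S) \<longrightarrow>
        disjoint_family_on (\<lambda>i. {u i<..<v i}) {..<n} \<longrightarrow> A \<longrightarrow> C) \<longleftrightarrow>
      (nonoverlapping {..<n} u v \<longrightarrow> (\<forall>i<n. {u i..v i} \<subseteq> S) \<longrightarrow> A \<longrightarrow> C)"
    for n :: nat and u v :: "nat \<Rightarrow> real" and A C
    unfolding nonoverlapping_def by (simp, blast)
  then show ?thesis
    unfolding abs_continuous_on_def ac_gauge_def by simp
qed

lemma ac_gaugeD:
  assumes "ac_gauge S f \<epsilon> \<delta>" "nonoverlapping I u v" "\<And>i. i \<in> I \<Longrightarrow> {u i..v i} \<subseteq> S"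
    "(\<Sum>i\<in>I. v i - u i) < \<delta>"
  shows "(\<Sum>i\<in>I. \<bar>f (v i) - f (u i)\<bar>) < \<epsilon>"
proof -
  have "finite I" using assms(2) by (simp add: nonoverlapping_def)
  then obtain h where h: "bij_betw h {0..<card I} I"
    using ex_bij_betw_nat_finite by blast
  then have h': "bij_betw h {..<card I} I" by (simp add: lessThan_atLeast0)
  have "nonoverlapping {..<card I} (\<lambda>j. u (h j)) (\<lambda>j. v (h j))"
    using h' by (intro nonoverlapping_reindex[OF assms(2)]) (auto simp: bij_betw_def)
  moreover have "\<forall>i<card I. {u (h i)..v (h i)} \<subseteq> S"
    using assms(3) bij_betwE[OF h'] by blast
  moreover have "(\<Sum>i<card I. v (h i) - u (h i)) < \<delta>"
    using assms(4) sum.reindex_bij_betw[OF h', of "\<lambda>i. v i - u i"] by simp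
  ultimately have "(\<Sum>i<card I. \<bar>f (v (h i)) - f (u (h i))\<bar>) < \<epsilon>"
    using assms(1) unfolding ac_gauge_def by blast
  then show ?thesis
    using sum.reindex_bij_betw[OF h', of "\<lambda>i. \<bar>f (v i) - f (u i)\<bar>"] by simp
qed

text \<open>The open intervals are disjoint, so their lengths add up to the measure of a subset of
  \<open>{c..d}\<close>.\<close>

lemma nonoverlapping_length_le:
  assumes "nonoverlapping I u v" "\<And>i. i \<in> I \<Longrightarrow> {u i..v i} \<subseteq> {c..d}" "c \<le> d"
  shows "(\<Sum>i\<in>I. v i - u i) \<le> d - c"
proof -
  have fin: "finite I" and le: "\<And>i. i \<in> I \<Longrightarrow> u i \<le> v i"
    and dis: "disjoint_family_on (\<lambda>i. {u i<..<v i}) I"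
    using assms(1) by (auto simp: nonoverlapping_def)
  have "(\<Sum>i\<in>I. v i - u i) = (\<Sum>i\<in>I. measure lborel {u i<..<v i})"
    using le by (intro sum.cong) auto
  also have "\<dots> = measure lborel (\<Union>i\<in>I. {u i<..<v i})"
    using dis fin le by (intro measure_finite_Union[symmetric]) auto
  also have "\<dots> \<le> measure lborel {c..d}"
  proof (rule measure_mono_fmeasurable)
    show "(\<Union>i\<in>I. {u i<..<v i}) \<subseteq> {c..d}"
      using assms(2) by (auto simp: subset_iff)
  qed (use fin in \<open>auto intro!: fmeasurable_compact\<close>)
  finally show ?thesis using assms(3) by simp
qed

lemma nonoverlapping_shrink:
  assumes "nonoverlapping I u v"
    and "\<And>i. i \<in> I \<Longrightarrow> u i \<le> v i \<Longrightarrow> u' i \<le> v' i \<and> {u' i<..<v' i} \<subseteq> {u i<..<v i}"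
  shows "nonoverlapping I u' v'"
proof -
  have "u' i \<le> v' i" "{u' i<..<v' i} \<subseteq> {u i<..<v i}" if "i \<in> I" for i
    using assms that unfolding nonoverlapping_def by auto
  moreover have "disjoint_family_on (\<lambda>i. {u' i<..<v' i}) I"
  proof (rule disjoint_family_on_bisimulation[where f = "\<lambda>i. {u i<..<v i}"])
    show "disjoint_family_on (\<lambda>i. {u i<..<v i}) I" using assms(1) by (simp add: nonoverlapping_def)
    show "{u' n<..<v' n} \<inter> {u' m<..<v' m} = {}"
      if "n \<in> I" "m \<in> I" "{u n<..<v n} \<inter> {u m<..<v m} = {}" for n m
      using that calculation by blast
  qed
  ultimately show ?thesis
    using assms(1) by (simp add: nonoverlapping_def)
qed

lemma nonoverlapping_min:
  "nonoverlapping I u v \<Longrightarrow> nonoverlapping I (\<lambda>i. min (u i) c) (\<lambda>i. min (v i) c)"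
  by (erule nonoverlapping_shrink) (auto simp: min_def split: if_splits)

lemma nonoverlapping_max:
  "nonoverlapping I u v \<Longrightarrow> nonoverlapping I (\<lambda>i. max (u i) c) (\<lambda>i. max (v i) c)"
  by (erule nonoverlapping_shrink) (auto simp: max_def split: if_splits)

text \<open>Cutting every interval of a family at \<open>c\<close> does not decrease the sum of the absolute increments; with
  \<open>min\<close> and \<open>max\<close> no interval has to be singled out as the one that contains \<open>c\<close>.\<close>

lemma sum_increments_cut:
  fixes f :: "real \<Rightarrow> real"
  shows "(\<Sum>i\<in>I. \<bar>f (v i) - f (u i)\<bar>) \<le>
     (\<Sum>i\<in>I. \<bar>f (min (v i) c) - f (min (u i) c)\<bar>) + (\<Sum>i\<in>I. \<bar>f (max (v i) c) - f (max (u i) c)\<bar>)"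
  unfolding sum.distrib[symmetric] by (intro sum_mono) (auto simp: min_def max_def)

text \<open>Extending a function by its boundary values reduces everything to absolute continuity on the whole
  line.\<close>

lemma abs_continuous_on_clamp:
  assumes "abs_continuous_on {a..b} f" "a \<le> b"
  shows "abs_continuous_on UNIV (\<lambda>x. f (max a (min b x)))"
  unfolding abs_continuous_on_gauge
proof (intro allI impI)
  fix \<epsilon> :: real assume "\<epsilon> > 0"
  then obtain \<delta> where \<delta>: "\<delta> > 0" "ac_gauge {a..b} f \<epsilon> \<delta>"
    using assms(1) by (auto simp: abs_continuous_on_gauge)
  have "ac_gauge UNIV (\<lambda>x. f (max a (min b x))) \<epsilon> \<delta>"
    unfolding ac_gauge_def
  proof (intro allI impI)
    fix n :: nat and u v :: "nat \<Rightarrow> real"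
    assume *: "nonoverlapping {..<n} u v" "(\<Sum>i<n. v i - u i) < \<delta>"
    have "nonoverlapping {..<n} (\<lambda>i. max a (min b (u i))) (\<lambda>i. max a (min b (v i)))"
      using nonoverlapping_max[OF nonoverlapping_min[OF *(1), of b], of a]
      by (simp add: max.commute min.commute)
    moreover have "(\<Sum>i<n. max a (min b (v i)) - max a (min b (u i))) < \<delta>"
    proof -
      have "(\<Sum>i<n. max a (min b (v i)) - max a (min b (u i))) \<le> (\<Sum>i<n. v i - u i)"
      proof (rule sum_mono)
        fix i assume "i \<in> {..<n}"
        then have "u i \<le> v i" using *(1) by (simp add: nonoverlapping_def)
        then show "max a (min b (v i)) - max a (min b (u i)) \<le> v i - u i" by linarith
      qed
      then show ?thesis using *(2) by simp
    qed
    ultimately show "(\<Sum>i<n. \<bar>f (max a (min b (v i))) - f (max a (min b (u i)))\<bar>) < \<epsilon>"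
      using assms(2) by (intro ac_gaugeD[OF \<delta>(2)]) auto
  qed
  then show "\<exists>\<delta>>0. ac_gauge UNIV (\<lambda>x. f (max a (min b x))) \<epsilon> \<delta>"
    using \<delta> by blast
qed

lemma abs_continuous_on_add:
  assumes "abs_continuous_on S f" "abs_continuous_on S g"
  shows "abs_continuous_on S (\<lambda>x. f x + g x)"
  unfolding abs_continuous_on_gauge
proof (intro allI impI)
  fix \<epsilon> :: real assume "\<epsilon> > 0"
  then have e2: "\<epsilon> / 2 > 0" by simp
  obtain \<delta> where \<delta>: "\<delta> > 0" "ac_gauge S f (\<epsilon>/2) \<delta>"
    using assms(1) e2 by (metis abs_continuous_on_gauge)
  obtain \<eta> where \<eta>: "\<eta> > 0" "ac_gauge S g (\<epsilon>/2) \<eta>"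
    using assms(2) e2 by (metis abs_continuous_on_gauge)
  have "ac_gauge S (\<lambda>x. f x + g x) \<epsilon> (min \<delta> \<eta>)"
    unfolding ac_gauge_def
  proof (intro allI impI)
    fix n :: nat and u v :: "nat \<Rightarrow> real"
    assume *: "nonoverlapping {..<n} u v" "\<forall>i<n. {u i..v i} \<subseteq> S" "(\<Sum>i<n. v i - u i) < min \<delta> \<eta>"
    have "(\<Sum>i<n. \<bar>f (v i) + g (v i) - (f (u i) + g (u i))\<bar>)
        \<le> (\<Sum>i<n. \<bar>f (v i) - f (u i)\<bar> + \<bar>g (v i) - g (u i)\<bar>)"
      by (intro sum_mono) auto
    also have "\<dots> = (\<Sum>i<n. \<bar>f (v i) - f (u i)\<bar>) + (\<Sum>i<n. \<bar>g (v i) - g (u i)\<bar>)"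
      by (rule sum.distrib)
    also have "(\<Sum>i<n. \<bar>f (v i) - f (u i)\<bar>) < \<epsilon>/2"
      using * by (intro ac_gaugeD[OF \<delta>(2)]) auto
    also have "(\<Sum>i<n. \<bar>g (v i) - g (u i)\<bar>) < \<epsilon>/2"
      using * by (intro ac_gaugeD[OF \<eta>(2)]) auto
    finally show "(\<Sum>i<n. \<bar>f (v i) + g (v i) - (f (u i) + g (u i))\<bar>) < \<epsilon>" by simp
  qed
  then show "\<exists>\<delta>>0. ac_gauge S (\<lambda>x. f x + g x) \<epsilon> \<delta>"
    using \<delta> \<eta> by (intro exI[of _ "min \<delta> \<eta>"]) auto
qed

text \<open>With \<open>\<delta>\<close> belonging to \<open>\<epsilon> = 1\<close>, the variation over an interval of length \<open>\<delta> / 2\<close> is at most \<open>1\<close>, and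
  finitely many such intervals cover \<open>{a..b}\<close>.\<close>

lemma abs_continuous_on_bounded_variation:
  assumes ac: "abs_continuous_on UNIV f" and "a \<le> b"
    and left: "\<And>x. x \<le> a \<Longrightarrow> f x = f a" and right: "\<And>x. x \<ge> b \<Longrightarrow> f x = f b"
  obtains B where "\<And>(I :: nat set) u v. nonoverlapping I u v \<Longrightarrow> (\<Sum>i\<in>I. \<bar>f (v i) - f (u i)\<bar>) \<le> B"
proof -
  obtain \<delta> where \<delta>: "\<delta> > 0" "ac_gauge UNIV f 1 \<delta>"
    using ac by (metis abs_continuous_on_gauge zero_less_one)
  have step: "(\<Sum>i\<in>I. \<bar>f (v i) - f (u i)\<bar>) \<le> real k"
    if "nonoverlapping I u v" "\<And>i. i \<in> I \<Longrightarrow> v i \<le> a + real k * (\<delta> / 2)" for k and I :: "nat set" and u v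
    using that
  proof (induction k arbitrary: u v)
    case 0
    have "f (v i) = f a \<and> f (u i) = f a" if "i \<in> I" for i
      using 0 that left[of "u i"] left[of "v i"] by (fastforce simp: nonoverlapping_def)
    then show ?case by simp
  next
    case (Suc k)
    let ?c = "a + real k * (\<delta> / 2)"
    have "(\<Sum>i\<in>I. \<bar>f (min (v i) ?c) - f (min (u i) ?c)\<bar>) \<le> real k"
      by (rule Suc.IH[OF nonoverlapping_min[OF Suc.prems(1)]]) auto
    moreover have "(\<Sum>i\<in>I. \<bar>f (max (v i) ?c) - f (max (u i) ?c)\<bar>) < 1"
    proof (rule ac_gaugeD[OF \<delta>(2) nonoverlapping_max[OF Suc.prems(1)]])
      have "(\<Sum>i\<in>I. max (v i) ?c - max (u i) ?c) \<le> ?c + \<delta> / 2 - ?c"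
      proof (rule nonoverlapping_length_le[OF nonoverlapping_max[OF Suc.prems(1)]])
        fix i assume "i \<in> I"
        then have "v i \<le> ?c + \<delta> / 2" using Suc.prems(2)[of i] by (simp add: algebra_simps add_divide_distrib)
        then show "{max (u i) ?c..max (v i) ?c} \<subseteq> {?c..?c + \<delta> / 2}" using \<delta>(1) by auto
      qed (use \<delta> in simp)
      also have "\<dots> < \<delta>" using \<delta> by simp
      finally show "(\<Sum>i\<in>I. max (v i) ?c - max (u i) ?c) < \<delta>" .
    qed simp
    ultimately show ?case
      using sum_increments_cut[of f v u I ?c] by simp
  qed
  obtain k :: nat where "real k > (b - a) / (\<delta> / 2)" using reals_Archimedean2 by blast
  then have k: "b \<le> a + real k * (\<delta> / 2)" using \<delta> by (simp add: field_simps)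
  show ?thesis
  proof
    fix I :: "nat set" and u v assume no: "nonoverlapping I u v"
    let ?c = "a + real k * (\<delta> / 2)"
    have "(\<Sum>i\<in>I. \<bar>f (min (v i) ?c) - f (min (u i) ?c)\<bar>) \<le> real k"
      by (rule step[OF nonoverlapping_min[OF no]]) auto
    moreover have "(\<Sum>i\<in>I. \<bar>f (max (v i) ?c) - f (max (u i) ?c)\<bar>) = 0"
      using k right by (intro sum.neutral) (metis abs_0 diff_self dual_order.trans max.cobounded2)
    ultimately show "(\<Sum>i\<in>I. \<bar>f (v i) - f (u i)\<bar>) \<le> real k"
      using sum_increments_cut[of f v u I ?c] by simp
  qed
qed

definition left_variation :: "(real \<Rightarrow> real) \<Rightarrow> real \<Rightarrow> real" where
  "left_variation f x = (SUP (n, u, v) \<in> {(n, u, v). nonoverlapping {..<n::nat} u v \<and> (\<forall>i<n. v i \<le> x)}.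
      \<Sum>i<n. \<bar>f (v i) - f (u i)\<bar>)"

context
  fixes f :: "real \<Rightarrow> real" and B :: real
  assumes bv: "\<And>(I :: nat set) u v. nonoverlapping I u v \<Longrightarrow> (\<Sum>i\<in>I. \<bar>f (v i) - f (u i)\<bar>) \<le> B"
begin

lemma left_variation_upper:
  assumes "nonoverlapping {..<n::nat} u v" "\<And>i. i < n \<Longrightarrow> v i \<le> x"
  shows "(\<Sum>i<n. \<bar>f (v i) - f (u i)\<bar>) \<le> left_variation f x"
  unfolding left_variation_def
  by (rule cSUP_upper2[where x = "(n, u, v)"]) (use assms bv in \<open>auto intro!: bdd_aboveI2[where M = B]\<close>)

lemma left_variation_approx:
  assumes "e > 0"
  obtains n :: nat and u v where "nonoverlapping {..<n} u v" "\<And>i. i < n \<Longrightarrow> v i \<le> x"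
    "left_variation f x < (\<Sum>i<n. \<bar>f (v i) - f (u i)\<bar>) + e"
proof -
  let ?A = "{(n, u, v). nonoverlapping {..<n::nat} u v \<and> (\<forall>i<n. v i \<le> x)}"
  have "(0, (\<lambda>_. 0), (\<lambda>_. 0)) \<in> ?A" by (simp add: nonoverlapping_def disjoint_family_on_def)
  then have "?A \<noteq> {}" by blast
  moreover have "bdd_above ((\<lambda>(n, u, v). \<Sum>i<n. \<bar>f (v i) - f (u i)\<bar>) ` ?A)"
    using bv by (auto intro!: bdd_aboveI2[where M = B])
  ultimately have "\<exists>p\<in>?A. left_variation f x - e < (\<lambda>(n, u, v). \<Sum>i<n. \<bar>f (v i) - f (u i)\<bar>) p"
    unfolding left_variation_def[of f x] using assms by (subst less_cSUP_iff[symmetric]) auto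
  then show ?thesis using that by (auto simp: algebra_simps)
qed

text \<open>A family for \<open>x\<close>, enlarged by the interval \<open>{x..y}\<close>, is a family for \<open>y\<close>.\<close>

lemma left_variation_increment_ge:
  assumes "x \<le> y"
  shows "left_variation f x + \<bar>f y - f x\<bar> \<le> left_variation f y"
proof (rule field_le_epsilon)
  fix e :: real assume "e > 0"
  from left_variation_approx[OF this, of x] obtain n :: nat and u v
    where no: "nonoverlapping {..<n} u v" and vx: "\<And>i. i < n \<Longrightarrow> v i \<le> x"
      and "left_variation f x < (\<Sum>i<n. \<bar>f (v i) - f (u i)\<bar>) + e"
    by metis
  moreover have "(\<Sum>i<Suc n. \<bar>f ((v(n := y)) i) - f ((u(n := x)) i)\<bar>) \<le> left_variation f y"
  proof (rule left_variation_upper)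
    show "nonoverlapping {..<Suc n} (u(n := x)) (v(n := y))"
    proof -
      have "{x<..<y} \<inter> (\<Union>i<n. {u i<..<v i}) = {}" using vx by fastforce
      moreover have "disjoint_family_on (\<lambda>i. {(u(n := x)) i<..<(v(n := y)) i}) {..<n}"
        using no unfolding nonoverlapping_def disjoint_family_on_def by simp
      ultimately have "disjoint_family_on (\<lambda>i. {(u(n := x)) i<..<(v(n := y)) i}) (insert n {..<n})"
        by (subst disjoint_family_on_insert) (simp_all del: fun_upd_apply, simp)
      then show ?thesis
        using no assms unfolding nonoverlapping_def by (simp add: lessThan_Suc)
    qed
    show "(v(n := y)) i \<le> y" if "i < Suc n" for i
      using that assms vx[of i] by (auto simp: less_Suc_eq)
  qed
  ultimately show "left_variation f x + \<bar>f y - f x\<bar> \<le> left_variation f y + e" by simp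
qed

text \<open>Cutting a nearly optimal family for \<open>y\<close> at the point \<open>x\<close> leaves a part to the left, which contributes
  at most the variation up to \<open>x\<close>.\<close>

lemma left_variation_increment_approx:
  assumes "x \<le> y" "e > 0"
  obtains n :: nat and u v where "nonoverlapping {..<n} u v" "\<And>i. i < n \<Longrightarrow> {u i..v i} \<subseteq> {x..y}"
    "left_variation f y - left_variation f x < (\<Sum>i<n. \<bar>f (v i) - f (u i)\<bar>) + e"
proof -
  from left_variation_approx[OF assms(2), of y] obtain n :: nat and u v
    where no: "nonoverlapping {..<n} u v" and vy: "\<And>i. i < n \<Longrightarrow> v i \<le> y"
      and *: "left_variation f y < (\<Sum>i<n. \<bar>f (v i) - f (u i)\<bar>) + e"
    by metis
  have "(\<Sum>i<n. \<bar>f (min (v i) x) - f (min (u i) x)\<bar>) \<le> left_variation f x"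
    by (rule left_variation_upper[OF nonoverlapping_min[OF no]]) auto
  then have "left_variation f y - left_variation f x < (\<Sum>i<n. \<bar>f (max (v i) x) - f (max (u i) x)\<bar>) + e"
    using * sum_increments_cut[of f v u "{..<n}" x] by simp
  moreover have "{max (u i) x..max (v i) x} \<subseteq> {x..y}" if "i < n" for i
    using vy[OF that] assms by auto
  ultimately show ?thesis
    using that[OF nonoverlapping_max[OF no, of x]] by blast
qed

text \<open>Each increment of the variation is nearly attained by a family inside the corresponding interval.
  All these families together form one nonoverlapping family of no larger total length, to which the
  absolute continuity of \<open>f\<close> itself applies.\<close>

lemma abs_continuous_on_left_variation:
  assumes ac: "abs_continuous_on UNIV f"
  shows "abs_continuous_on UNIV (left_variation f)"
  unfolding abs_continuous_on_gauge
proof (intro allI impI)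
  fix \<epsilon> :: real assume "\<epsilon> > 0"
  then have e2: "\<epsilon> / 2 > 0" by simp
  obtain \<delta> where \<delta>: "\<delta> > 0" "ac_gauge UNIV f (\<epsilon>/2) \<delta>"
    using ac e2 by (metis abs_continuous_on_gauge)
  have "ac_gauge UNIV (left_variation f) \<epsilon> \<delta>"
    unfolding ac_gauge_def
  proof (intro allI impI)
    fix n :: nat and u v :: "nat \<Rightarrow> real"
    assume no: "nonoverlapping {..<n} u v" and len: "(\<Sum>i<n. v i - u i) < \<delta>"
    have uv: "u i \<le> v i" if "i < n" for i using no that by (auto simp: nonoverlapping_def)
    define e where "e = \<epsilon> / (2 * (real n + 1))"
    have e: "e > 0" using \<open>\<epsilon> > 0\<close> by (simp add: e_def)
    let ?Q = "\<lambda>i (m :: nat, p, q). nonoverlapping {..<m} p q \<and> (\<forall>j<m. {p j..q j} \<subseteq> {u i..v i}) \<and>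
        left_variation f (v i) - left_variation f (u i) < (\<Sum>j<m. \<bar>f (q j) - f (p j)\<bar>) + e"
    have "\<forall>i\<in>{..<n}. \<exists>P. ?Q i P"
    proof
      fix i assume "i \<in> {..<n}"
      then have "u i \<le> v i" using uv by simp
      from left_variation_increment_approx[OF this e] obtain m :: nat and u' v' where
        "nonoverlapping {..<m} u' v'" "\<And>j. j < m \<Longrightarrow> {u' j..v' j} \<subseteq> {u i..v i}"
        "left_variation f (v i) - left_variation f (u i) < (\<Sum>j<m. \<bar>f (v' j) - f (u' j)\<bar>) + e" by metis
      then show "\<exists>P. ?Q i P" by (intro exI[of _ "(m, u', v')"]) auto
    qed
    then obtain P where P: "\<forall>i\<in>{..<n}. ?Q i (P i)" by (rule bchoice[THEN exE])
    define m p q where "m = (\<lambda>i. fst (P i))" and "p = (\<lambda>i. fst (snd (P i)))" and "q = (\<lambda>i. snd (snd (P i)))"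
    have no': "nonoverlapping {..<m i} (p i) (q i)" and sub: "\<And>j. j < m i \<Longrightarrow> {p i j..q i j} \<subseteq> {u i..v i}"
      and inc: "left_variation f (v i) - left_variation f (u i) < (\<Sum>j<m i. \<bar>f (q i j) - f (p i j)\<bar>) + e"
      if "i < n" for i
      using bspec[OF P, of i] that by (auto simp: m_def p_def q_def split_beta)
    let ?J = "Sigma {..<n} (\<lambda>i. {..<m i})"
    have pq: "p i j \<le> q i j" "u i \<le> p i j" "q i j \<le> v i" if "i < n" "j < m i" for i j
      using no'[OF that(1)] sub[OF that] that by (auto simp: nonoverlapping_def)
    have dis: "{p i j<..<q i j} \<inter> {p i' j'<..<q i' j'} = {}"
      if "i < n" "j < m i" "i' < n" "j' < m i'" "(i, j) \<noteq> (i', j')" for i j i' j'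
    proof (cases "i = i'")
      case True
      then show ?thesis
        using no'[OF that(1)] that disjoint_family_onD[of "\<lambda>j. {p i j<..<q i j}" "{..<m i}" j j']
        by (simp add: nonoverlapping_def)
    next
      case False
      then have "{u i<..<v i} \<inter> {u i'<..<v i'} = {}"
        using no that disjoint_family_onD[of "\<lambda>i. {u i<..<v i}" "{..<n}" i i']
        by (simp add: nonoverlapping_def)
      moreover have "{p i j<..<q i j} \<subseteq> {u i<..<v i}" "{p i' j'<..<q i' j'} \<subseteq> {u i'<..<v i'}"
        using pq(2,3)[OF that(1,2)] pq(2,3)[OF that(3,4)] by auto
      ultimately show ?thesis by blast
    qed
    have noJ: "nonoverlapping ?J (\<lambda>(i, j). p i j) (\<lambda>(i, j). q i j)"
      unfolding nonoverlapping_def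
    proof (intro conjI)
      show "disjoint_family_on (\<lambda>i. {(\<lambda>(i, j). p i j) i<..<(\<lambda>(i, j). q i j) i}) ?J"
        unfolding disjoint_family_on_def
      proof (intro ballI impI)
        fix x y assume "x \<in> ?J" "y \<in> ?J" "x \<noteq> y"
        then show "{(\<lambda>(i, j). p i j) x<..<(\<lambda>(i, j). q i j) x} \<inter> {(\<lambda>(i, j). p i j) y<..<(\<lambda>(i, j). q i j) y} = {}"
          using dis[of "fst x" "snd x" "fst y" "snd y"] by (cases x; cases y) (simp del: greaterThanLessThan_iff Int_greaterThanLessThan greaterThanLessThan_empty_iff)
      qed
    qed (use pq in auto)
    have "(\<Sum>(i, j)\<in>?J. q i j - p i j) = (\<Sum>i<n. \<Sum>j<m i. q i j - p i j)"
      by (subst sum.Sigma) auto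
    also have "\<dots> \<le> (\<Sum>i<n. v i - u i)"
      by (intro sum_mono nonoverlapping_length_le no') (use sub uv in auto)
    also note len
    finally have "(\<Sum>(i, j)\<in>?J. q i j - p i j) < \<delta>" .
    then have *: "(\<Sum>x\<in>?J. \<bar>f ((\<lambda>(i, j). q i j) x) - f ((\<lambda>(i, j). p i j) x)\<bar>) < \<epsilon> / 2"
      by (intro ac_gaugeD[OF \<delta>(2) noJ]) (auto simp: split_beta)
    have "(\<Sum>i<n. \<bar>left_variation f (v i) - left_variation f (u i)\<bar>)
        = (\<Sum>i<n. left_variation f (v i) - left_variation f (u i))"
    proof (rule sum.cong)
      fix i assume "i \<in> {..<n}"
      then have "u i \<le> v i" using uv by simp
      from left_variation_increment_ge[OF this]
      show "\<bar>left_variation f (v i) - left_variation f (u i)\<bar> = left_variation f (v i) - left_variation f (u i)"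
        by linarith
    qed simp
    also have "\<dots> \<le> (\<Sum>i<n. (\<Sum>j<m i. \<bar>f (q i j) - f (p i j)\<bar>) + e)"
      using inc by (intro sum_mono) (auto intro: less_imp_le)
    also have "\<dots> = (\<Sum>x\<in>?J. \<bar>f ((\<lambda>(i, j). q i j) x) - f ((\<lambda>(i, j). p i j) x)\<bar>) + real n * e"
      by (subst sum.distrib, subst sum.Sigma) (auto simp: split_beta)
    also have "\<dots> < \<epsilon> / 2 + \<epsilon> / 2"
    proof -
      have "real n * e \<le> \<epsilon> / 2" using \<open>\<epsilon> > 0\<close> by (simp add: e_def field_simps)
      then show ?thesis using * by simp
    qed
    finally show "(\<Sum>i<n. \<bar>left_variation f (v i) - left_variation f (u i)\<bar>) < \<epsilon>" by simp
  qed
  then show "\<exists>\<delta>>0. ac_gauge UNIV (left_variation f) \<epsilon> \<delta>" using \<delta> by blast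
qed

end

section \<open>The fundamental theorem of calculus for absolutely continuous functions\<close>

lemma abs_continuous_on_imp_continuous_on:
  assumes "abs_continuous_on S f" "is_interval S"
  shows "continuous_on S f"
  unfolding continuous_on_iff
proof (intro ballI allI impI)
  fix x and \<epsilon> :: real assume "x \<in> S" "\<epsilon> > 0"
  then obtain \<delta> where \<delta>: "\<delta> > 0" "ac_gauge S f \<epsilon> \<delta>"
    using assms(1) by (auto simp: abs_continuous_on_gauge)
  have "dist (f y) (f x) < \<epsilon>" if "y \<in> S" "dist y x < \<delta>" for y
  proof -
    have "nonoverlapping {()} (\<lambda>_. min x y) (\<lambda>_. max x y)"
      by (simp add: nonoverlapping_def disjoint_family_on_def)
    moreover have "{min x y..max x y} \<subseteq> S"
    proof
      fix z assume "z \<in> {min x y..max x y}"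
      then have z: "min x y \<le> z" "z \<le> max x y" by auto
      have "min x y \<in> S" "max x y \<in> S"
        using \<open>x \<in> S\<close> \<open>y \<in> S\<close> unfolding min_def max_def by presburger+
      then show "z \<in> S" using z by (rule mem_is_interval_1_I[OF assms(2)])
    qed
    moreover have "(\<Sum>i\<in>{()}. max x y - min x y) < \<delta>"
      using that by (auto simp: dist_real_def)
    ultimately have "(\<Sum>i\<in>{()}. \<bar>f (max x y) - f (min x y)\<bar>) < \<epsilon>"
      by (intro ac_gaugeD[OF \<delta>(2)]) auto
    then show ?thesis by (auto simp: dist_real_def min_def max_def split: if_splits)
  qed
  then show "\<exists>d>0. \<forall>x'\<in>S. dist x' x < d \<longrightarrow> dist (f x') (f x) < \<epsilon>" using \<delta> by blast
qed

text \<open>An open set is exhausted by finite unions of compact intervals, and such a union has a division into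
  nonoverlapping intervals, whose measures are increments of \<open>F\<close>.\<close>

lemma ac_gauge_emeasure_le:
  assumes mono: "\<And>x y. x \<le> y \<Longrightarrow> F x \<le> F y" and cont: "continuous_on UNIV F"
    and ac: "ac_gauge UNIV F \<epsilon> \<delta>" and U: "open U" "emeasure lborel U < ennreal \<delta>"
  shows "emeasure (interval_measure F) U \<le> ennreal \<epsilon>"
proof (cases "U = {}")
  case False
  define I where "I = {p \<in> \<rat> \<times> \<rat>. {fst p..snd p} \<subseteq> U}"
  have "countable I"
    unfolding I_def by (rule countable_subset[OF Collect_restrict]) (simp add: countable_rat)
  have UI: "U = (\<Union>p\<in>I. {fst p..snd p})"
  proof (intro equalityI subsetI)
    fix x assume "x \<in> U"
    then obtain e where e: "e > 0" "ball x e \<subseteq> U" using U(1) openE by blast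
    obtain a b where "a \<in> \<rat>" "x - e < a" "a < x" "b \<in> \<rat>" "x < b" "b < x + e"
      using e(1) Rats_dense_in_real[of "x - e" x] Rats_dense_in_real[of x "x + e"] by auto
    moreover from this have "{a..b} \<subseteq> ball x e" by (auto simp: dist_real_def)
    ultimately show "x \<in> (\<Union>p\<in>I. {fst p..snd p})"
      using e(2) by (intro UN_I[of "(a, b)"]) (auto simp: I_def)
  qed (auto simp: I_def)
  then have "I \<noteq> {}" using False by auto
  define D where "D = (\<lambda>n. {fst (from_nat_into I n)..snd (from_nat_into I n)})"
  have UD: "U = (\<Union>n. D n)"
  proof -
    have "U = (\<Union>p\<in>range (from_nat_into I). {fst p..snd p})"
      unfolding range_from_nat_into[OF \<open>I \<noteq> {}\<close> \<open>countable I\<close>] by (rule UI)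
    then show ?thesis unfolding D_def image_image .
  qed
  define A where "A = (\<lambda>n. \<Union>i<n. D i)"
  have A_bound: "emeasure (interval_measure F) (A n) \<le> ennreal \<epsilon>" for n
  proof -
    obtain p where p: "p division_of A n"
    proof (rule elementary_unions_intervals[of "D ` {..<n}"])
      show "\<exists>a b. s = cbox a b" if "s \<in> D ` {..<n}" for s
        using that unfolding D_def cbox_interval by blast
    qed (auto simp: A_def)
    have fin: "finite p" using p by blast
    have box: "K = {Inf K..Sup K}" "Inf K \<le> Sup K" if K: "K \<in> p" for K
    proof -
      obtain a b where "K = cbox a b" using p K by blast
      moreover have "K \<noteq> {}" using p K by blast
      ultimately show "K = {Inf K..Sup K}" "Inf K \<le> Sup K" by (auto simp: cbox_interval)
    qed
    have dis: "{Inf K<..<Sup K} \<inter> {Inf L<..<Sup L} = {}" if "K \<in> p" "L \<in> p" "K \<noteq> L" for K L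
    proof -
      have "interior K \<inter> interior L = {}" using p that by blast
      moreover have "interior K = {Inf K<..<Sup K}" "interior L = {Inf L<..<Sup L}"
        using box that by (metis interior_atLeastAtMost_real)+
      ultimately show ?thesis by simp
    qed
    have no: "nonoverlapping p Inf Sup"
      unfolding nonoverlapping_def disjoint_family_on_def using fin box(2) dis by blast
    have "ennreal (\<Sum>K\<in>p. Sup K - Inf K) = ennreal (measure lborel (\<Union>K\<in>p. {Inf K<..<Sup K}))"
      using box fin dis
      by (subst measure_finite_Union) (auto simp: disjoint_family_on_def intro!: sum.cong arg_cong[where f = ennreal])
    also have "\<dots> = emeasure lborel (\<Union>K\<in>p. {Inf K<..<Sup K})"
    proof (rule emeasure_eq_ennreal_measure[symmetric])
      have "emeasure lborel (\<Union>K\<in>p. {Inf K<..<Sup K}) \<le> (\<Sum>K\<in>p. emeasure lborel {Inf K<..<Sup K})"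
        using fin by (intro emeasure_subadditive_finite) auto
      also have "\<dots> < \<infinity>" using fin box by (auto simp: less_top[symmetric])
      finally show "emeasure lborel (\<Union>K\<in>p. {Inf K<..<Sup K}) \<noteq> top" by simp
    qed
    also have "\<dots> \<le> emeasure lborel U"
    proof (rule emeasure_mono)
      have "{Inf K<..<Sup K} \<subseteq> U" if "K \<in> p" for K
      proof -
        have "{Inf K<..<Sup K} \<subseteq> K" using box(1)[OF that] by (metis greaterThanLessThan_subseteq_atLeastAtMost_iff order_refl)
        also have "K \<subseteq> A n" using p that by blast
        also have "A n \<subseteq> U" unfolding A_def UD by auto
        finally show ?thesis .
      qed
      then show "(\<Union>K\<in>p. {Inf K<..<Sup K}) \<subseteq> U" by blast
    qed (use U in auto)
    also note U(2)
    finally have "ennreal (\<Sum>K\<in>p. Sup K - Inf K) < ennreal \<delta>" .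
    moreover have "0 \<le> (\<Sum>K\<in>p. Sup K - Inf K)" using box(2) by (intro sum_nonneg) simp
    ultimately have "(\<Sum>K\<in>p. Sup K - Inf K) < \<delta>" by (simp add: ennreal_less_iff)
    then have small: "(\<Sum>K\<in>p. \<bar>F (Sup K) - F (Inf K)\<bar>) < \<epsilon>"
      by (intro ac_gaugeD[OF ac no]) auto
    have "emeasure (interval_measure F) (A n) = emeasure (interval_measure F) (\<Union>K\<in>p. K)"
      using p by (auto dest: division_ofD(6))
    also have "\<dots> \<le> (\<Sum>K\<in>p. emeasure (interval_measure F) K)"
    proof (rule emeasure_subadditive_finite[OF fin])
      show "(\<lambda>K. K) ` p \<subseteq> sets (interval_measure F)"
        using p by (fastforce dest: division_ofD(4))
    qed
    also have "\<dots> = (\<Sum>K\<in>p. ennreal (F (Sup K) - F (Inf K)))"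
    proof (rule sum.cong)
      fix K assume "K \<in> p"
      then show "emeasure (interval_measure F) K = ennreal (F (Sup K) - F (Inf K))"
        using box emeasure_interval_measure_Icc[of "Inf K" "Sup K" F, OF _ mono cont] by metis
    qed simp
    also have "\<dots> = ennreal (\<Sum>K\<in>p. \<bar>F (Sup K) - F (Inf K)\<bar>)"
      using mono box(2) by (subst sum_ennreal[symmetric]) (auto intro!: sum.cong)
    also have "\<dots> \<le> ennreal \<epsilon>" using small by (intro ennreal_leI) simp
    finally show ?thesis .
  qed
  have "emeasure (interval_measure F) U = (SUP n. emeasure (interval_measure F) (A n))"
  proof -
    have "U = (\<Union>n. A n)" unfolding UD A_def by blast
    moreover have "range A \<subseteq> sets (interval_measure F)" unfolding A_def D_def by auto
    moreover have "incseq A" unfolding A_def incseq_def by (auto intro: less_le_trans)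
    ultimately show ?thesis using SUP_emeasure_incseq by metis
  qed
  also have "\<dots> \<le> ennreal \<epsilon>" using A_bound by (rule SUP_least)
  finally show ?thesis .
qed simp

text \<open>Null sets have open neighbourhoods of small Lebesgue measure, hence of small Stieltjes measure, so
  the Radon-Nikodym theorem applies to the latter.\<close>

lemma mono_abs_continuous_density:
  assumes mono: "\<And>x y. x \<le> y \<Longrightarrow> F x \<le> F y" and ac: "abs_continuous_on UNIV F"
  obtains g where "g \<in> borel_measurable borel"
    "\<And>a b. a \<le> b \<Longrightarrow> set_integrable lborel {a..b} g"
    "\<And>a b. a \<le> b \<Longrightarrow> (LINT x:{a..b}|lborel. g x) = F b - F a"
proof -
  let ?\<mu> = "interval_measure F"
  have cont: "continuous_on UNIV F"
    using abs_continuous_on_imp_continuous_on[OF ac] by simp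
  then have rc: "continuous (at_right a) F" for a
    by (metis UNIV_I continuous_at_imp_continuous_at_within continuous_on_eq_continuous_at open_UNIV)
  have sf: "sigma_finite_measure ?\<mu>" by (rule sigma_finite_interval_measure[OF mono rc])
  have acm: "absolutely_continuous lborel ?\<mu>"
    unfolding absolutely_continuous_def
  proof
    fix N :: "real set" assume N: "N \<in> null_sets lborel"
    have "emeasure ?\<mu> N \<le> ennreal \<epsilon>" if pos: "\<epsilon> > 0" for \<epsilon> :: real
    proof -
      obtain \<delta> where \<delta>: "\<delta> > 0" "ac_gauge UNIV F \<epsilon> \<delta>"
        using ac pos by (auto simp: abs_continuous_on_gauge)
      have "N \<in> sets borel" using N by auto
      from outer_regular_lborel[OF this \<delta>(1)] obtain U
        where U: "open U" "N \<subseteq> U" "emeasure lborel (U - N) < ennreal \<delta>" .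
      have "emeasure lborel U = emeasure lborel (U - N)"
        using U N by (intro emeasure_Diff_null_set[symmetric]) auto
      then have "emeasure ?\<mu> U \<le> ennreal \<epsilon>"
        using U by (intro ac_gauge_emeasure_le[OF mono cont \<delta>(2)]) auto
      moreover have "emeasure ?\<mu> N \<le> emeasure ?\<mu> U"
        using U by (intro emeasure_mono) auto
      ultimately show ?thesis by simp
    qed
    then have "emeasure ?\<mu> N = 0"
      by (metis (no_types, opaque_lifting) add.left_neutral ennreal_le_epsilon le_zero_eq)
    then show "N \<in> null_sets ?\<mu>" using N by (auto simp: null_sets_def)
  qed
  define h where "h = RN_deriv lborel ?\<mu>"
  have hm [measurable]: "h \<in> borel_measurable borel"
    unfolding h_def using borel_measurable_RN_deriv[of lborel ?\<mu>] by simp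
  have dens: "density lborel h = ?\<mu>"
    unfolding h_def using acm by (intro sigma_finite_measure.density_RN_deriv[OF sigma_finite_lborel]) auto
  have fin: "AE x in lborel. h x \<noteq> \<infinity>"
    unfolding h_def using acm sf by (intro sigma_finite_measure.RN_deriv_finite[OF sigma_finite_lborel]) auto
  define g where "g = (\<lambda>x. enn2real (h x))"
  have gm [measurable]: "g \<in> borel_measurable borel" unfolding g_def by measurable
  have nn: "(\<integral>\<^sup>+x. ennreal (indicator {a..b} x * g x) \<partial>lborel) = ennreal (F b - F a)" if "a \<le> b" for a b
  proof -
    have "(\<integral>\<^sup>+x. ennreal (indicator {a..b} x * g x) \<partial>lborel) = (\<integral>\<^sup>+x. h x * indicator {a..b} x \<partial>lborel)"
      using fin by (intro nn_integral_cong_AE) (auto simp: g_def indicator_def top.not_eq_extremum)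
    also have "\<dots> = emeasure (density lborel h) {a..b}"
      by (subst emeasure_density) auto
    also have "\<dots> = ennreal (F b - F a)"
      unfolding dens by (rule emeasure_interval_measure_Icc[OF that mono cont])
    finally show ?thesis .
  qed
  have g0: "g x \<ge> 0" for x by (simp add: g_def)
  show ?thesis
  proof
    fix a b :: real assume ab: "a \<le> b"
    have "has_bochner_integral lborel (\<lambda>x. indicator {a..b} x * g x) (F b - F a)"
      using nn[OF ab] mono[OF ab] g0 by (intro has_bochner_integral_nn_integral) auto
    then show "set_integrable lborel {a..b} g" "(LINT x:{a..b}|lborel. g x) = F b - F a"
      unfolding set_integrable_def set_lebesgue_integral_def
      by (auto simp: has_bochner_integral_iff)
  qed (rule gm)
qed

lemma AE_lborel_not_negligible:
  assumes "negligible N"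
  shows "AE x in lborel. x \<notin> N"
proof -
  obtain N' where "N' \<in> null_sets lborel" "N \<subseteq> N'"
    using assms unfolding negligible_iff_null_sets null_sets_completion_iff2 by auto
  then show ?thesis by (intro AE_I'[of N']) auto
qed

lemma AE_right_derivative_indefinite_integral:
  fixes g F :: "real \<Rightarrow> real"
  assumes int: "\<And>a b. a \<le> b \<Longrightarrow> set_integrable lborel {a..b} g"
    and F: "\<And>a b. a \<le> b \<Longrightarrow> (LINT x:{a..b}|lborel. g x) = F b - F a"
  shows "AE x in lborel. ((\<lambda>h. (F (x + h) - F x) / h) \<longlongrightarrow> g x) (at_right 0)"
proof -
  have "g integrable_on cbox a b" for a b :: real
  proof (cases "a \<le> b")
    case True
    then show ?thesis using set_borel_integral_eq_integral(1)[OF int[OF True]] by simp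
  qed auto
  from integrable_ccontinuous_explicit[OF this] obtain N where N: "negligible N"
    "\<And>x e. x \<notin> N \<Longrightarrow> 0 < e \<Longrightarrow> \<exists>d>0. \<forall>h. 0 < h \<and> h < d \<longrightarrow>
      norm (integral (cbox x (x + h *\<^sub>R One)) g /\<^sub>R h ^ DIM(real) - g x) < e" by metis
  have "((\<lambda>h. (F (x + h) - F x) / h) \<longlongrightarrow> g x) (at_right 0)" if "x \<notin> N" for x
  proof (rule tendstoI)
    fix e :: real assume "e > 0"
    from N(2)[OF that this] obtain d where d: "d > 0"
      "\<And>h. 0 < h \<Longrightarrow> h < d \<Longrightarrow> norm (integral (cbox x (x + h *\<^sub>R One)) g /\<^sub>R h ^ DIM(real) - g x) < e" by metis
    have "dist ((F (x + h) - F x) / h) (g x) < e" if h: "0 < h" "h < d" for h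
    proof -
      have "integral {x..x + h} g = F (x + h) - F x"
        using F[of x "x + h"] set_borel_integral_eq_integral(2)[OF int[of x "x + h"]] h by simp
      then show ?thesis using d(2)[OF h] h by (simp add: dist_real_def divide_inverse mult.commute)
    qed
    then show "\<forall>\<^sub>F h in at_right 0. dist ((F (x + h) - F x) / h) (g x) < e"
      using d(1) unfolding eventually_at_right[OF zero_less_one] by (intro exI[of _ d]) auto
  qed
  then show ?thesis using AE_lborel_not_negligible[OF N(1)] by auto
qed

text \<open>The derivative from the left is the derivative from the right of the reflected function.\<close>

lemma AE_derivative_indefinite_integral:
  fixes g F :: "real \<Rightarrow> real"
  assumes g: "g \<in> borel_measurable borel"
    and int: "\<And>a b. a \<le> b \<Longrightarrow> set_integrable lborel {a..b} g"
    and F: "\<And>a b. a \<le> b \<Longrightarrow> (LINT x:{a..b}|lborel. g x) = F b - F a"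
  shows "AE x in lborel. (F has_real_derivative g x) (at x)"
proof -
  have refl_eq: "indicator {a..b} (- x) *\<^sub>R g (- x) = indicator {-b..-a} x *\<^sub>R g (- x)" for a b x :: real
    by (auto simp: indicator_def)
  have "set_integrable lborel {a..b} (\<lambda>x. g (- x))" if "a \<le> b" for a b
  proof -
    have "integrable lborel (\<lambda>x. indicator {-b..-a} x *\<^sub>R g x)"
      using int[of "-b" "-a"] that unfolding set_integrable_def by simp
    from lborel_integrable_real_affine[OF this, of "-1" 0] show ?thesis
      by (simp add: refl_eq set_integrable_def del: real_scaleR_def)
  qed
  moreover have "(LINT x:{a..b}|lborel. g (- x)) = - F (- b) - (- F (- a))" if "a \<le> b" for a b
  proof -
    have "(LINT x:{-b..-a}|lborel. g x) = F (- a) - F (- b)" using F[of "-b" "-a"] that by simp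
    then show ?thesis
      unfolding set_lebesgue_integral_def
      by (subst (asm) lborel_integral_real_affine[where c = "-1" and t = 0]) (simp_all add: refl_eq del: real_scaleR_def)
  qed
  ultimately have "AE x in lborel. ((\<lambda>h. (- F (- (x + h)) - (- F (- x))) / h) \<longlongrightarrow> g (- x)) (at_right 0)"
    by (rule AE_right_derivative_indefinite_integral)
  then obtain N where N: "N \<in> null_sets lborel"
    "{x. \<not> ((\<lambda>h. (- F (- (x + h)) - (- F (- x))) / h) \<longlongrightarrow> g (- x)) (at_right 0)} \<subseteq> N"
    unfolding eventually_ae_filter by auto
  have "uminus -` N \<in> null_sets lborel"
    using N(1) null_sets_distr_iff[of uminus lborel borel N] by (simp add: lborel_distr_uminus)
  moreover have "{x. \<not> ((\<lambda>h. (- F (x - h) + F x) / h) \<longlongrightarrow> g x) (at_right 0)} \<subseteq> uminus -` N"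
  proof safe
    fix x assume "\<not> ((\<lambda>h. (- F (x - h) + F x) / h) \<longlongrightarrow> g x) (at_right 0)"
    then show "x \<in> uminus -` N" using N(2)[THEN subsetD, of "- x"] by simp
  qed
  ultimately have left: "AE x in lborel. ((\<lambda>h. (- F (x - h) + F x) / h) \<longlongrightarrow> g x) (at_right 0)"
    by (intro AE_I'[of "uminus -` N"]) auto
  have "AE x in lborel. ((\<lambda>h. (F (x + h) - F x) / h) \<longlongrightarrow> g x) (at_right 0)"
    using int F by (rule AE_right_derivative_indefinite_integral)
  with left show ?thesis
  proof eventually_elim
    case (elim x)
    have "(F (x + - h) - F x) / - h = (- F (x - h) + F x) / h" for h
      by (cases "h = 0") (simp_all add: field_simps)
    then have "filterlim (\<lambda>h. (F (x + h) - F x) / h) (nhds (g x)) (at_left 0)"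
      unfolding filterlim_at_left_to_right[of _ _ 0]
      using elim(1) by simp
    then show ?case
      unfolding DERIV_def using elim(2) by (simp add: filterlim_split_at)
  qed
qed

text \<open>The total variation \<open>V\<close> and \<open>V + f\<close> are both increasing and absolutely continuous; \<open>f\<close> is their
  difference.\<close>

theorem abs_continuous_on_FTC:
  assumes ac: "abs_continuous_on {a..b} f" and "a < b"
  obtains g where "g \<in> borel_measurable borel" "set_integrable lborel {a..b} g"
    "\<And>x. x \<in> {a..b} \<Longrightarrow> (LINT y:{a..x}|lborel. g y) = f x - f a"
    "AE x in lborel. x \<in> {a<..<b} \<longrightarrow> (f has_real_derivative g x) (at x)"
proof -
  define F where "F = (\<lambda>x. f (max a (min b x)))"
  have acF: "abs_continuous_on UNIV F"
    unfolding F_def using assms by (intro abs_continuous_on_clamp) auto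
  have left: "F x = F a" if "x \<le> a" for x using that assms(2) by (simp add: F_def)
  have right: "F x = F b" if "b \<le> x" for x using that assms(2) by (simp add: F_def)
  obtain B where B: "\<And>(I :: nat set) u v. nonoverlapping I u v \<Longrightarrow> (\<Sum>i\<in>I. \<bar>F (v i) - F (u i)\<bar>) \<le> B"
    using abs_continuous_on_bounded_variation[OF acF less_imp_le[OF assms(2)] left right] by metis
  let ?V = "left_variation F"
  have inc: "?V x + \<bar>F y - F x\<bar> \<le> ?V y" if "x \<le> y" for x y
    by (rule left_variation_increment_ge[OF B that])
  have acV: "abs_continuous_on UNIV ?V"
    by (rule abs_continuous_on_left_variation[OF B acF])
  have m1: "?V x \<le> ?V y" and m2: "?V x + F x \<le> ?V y + F y" if "x \<le> y" for x y
    using inc[OF that] by auto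
  obtain g1 where g1: "g1 \<in> borel_measurable borel" "\<And>a b. a \<le> b \<Longrightarrow> set_integrable lborel {a..b} g1"
    "\<And>a b. a \<le> b \<Longrightarrow> (LINT x:{a..b}|lborel. g1 x) = ?V b - ?V a"
    using mono_abs_continuous_density[OF m1 acV] by metis
  obtain g2 where g2: "g2 \<in> borel_measurable borel" "\<And>a b. a \<le> b \<Longrightarrow> set_integrable lborel {a..b} g2"
    "\<And>a b. a \<le> b \<Longrightarrow> (LINT x:{a..b}|lborel. g2 x) = (?V b + F b) - (?V a + F a)"
    using mono_abs_continuous_density[OF m2 abs_continuous_on_add[OF acV acF]] by metis
  define g where "g = (\<lambda>x. g2 x - g1 x)"
  have gm: "g \<in> borel_measurable borel" using g1(1) g2(1) by (simp add: g_def)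
  have gi: "set_integrable lborel {c..d} g" if "c \<le> d" for c d
    unfolding g_def using g1(2) g2(2) that by (intro set_integral_diff) auto
  have gF: "(LINT x:{c..d}|lborel. g x) = F d - F c" if "c \<le> d" for c d
    unfolding g_def using g1(2,3)[OF that] g2(2,3)[OF that] by (subst set_integral_diff) auto
  have "AE x in lborel. (F has_real_derivative g x) (at x)"
    by (rule AE_derivative_indefinite_integral[OF gm gi gF])
  moreover have "(f has_real_derivative g x) (at x)"
    if "(F has_real_derivative g x) (at x)" "x \<in> {a<..<b}" for x
  proof (rule has_field_derivative_transform_within_open[OF that(1) _ that(2)])
    show "F y = f y" if "y \<in> {a<..<b}" for y using that by (simp add: F_def)
  qed simp
  ultimately have "AE x in lborel. x \<in> {a<..<b} \<longrightarrow> (f has_real_derivative g x) (at x)"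
    by auto
  moreover have "(LINT y:{a..x}|lborel. g y) = f x - f a" if "x \<in> {a..b}" for x
    using gF[of a x] that by (auto simp: F_def max_def min_def)
  ultimately show ?thesis using that[OF gm gi[of a b]] assms by auto
qed

lemma abs_continuous_on_subset:
  "abs_continuous_on T f \<Longrightarrow> S \<subseteq> T \<Longrightarrow> abs_continuous_on S f"
  unfolding abs_continuous_on_gauge ac_gauge_def by (meson order_trans)

lemma Lipschitz_imp_abs_continuous_on:
  assumes "\<And>x y. x \<in> S \<Longrightarrow> y \<in> S \<Longrightarrow> \<bar>f x - f y\<bar> \<le> L * \<bar>x - y\<bar>"
  shows "abs_continuous_on S f"
  unfolding abs_continuous_on_gauge
proof (intro allI impI)
  fix \<epsilon> :: real assume "\<epsilon> > 0"
  define K where "K = max L 1"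
  have K: "K > 0" "L \<le> K" by (auto simp: K_def)
  have "ac_gauge S f \<epsilon> (\<epsilon> / K)"
    unfolding ac_gauge_def
  proof (intro allI impI)
    fix n :: nat and u v :: "nat \<Rightarrow> real"
    assume no: "nonoverlapping {..<n} u v" and sub: "\<forall>i<n. {u i..v i} \<subseteq> S"
      and len: "(\<Sum>i<n. v i - u i) < \<epsilon> / K"
    have "(\<Sum>i<n. \<bar>f (v i) - f (u i)\<bar>) \<le> (\<Sum>i<n. K * (v i - u i))"
    proof (rule sum_mono)
      fix i assume i: "i \<in> {..<n}"
      then have le: "u i \<le> v i" using no by (simp add: nonoverlapping_def)
      then have "u i \<in> S" "v i \<in> S"
        using sub i by (meson atLeastAtMost_iff lessThan_iff order_refl subsetD)+
      then have "\<bar>f (v i) - f (u i)\<bar> \<le> L * \<bar>v i - u i\<bar>" using assms by blast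
      also have "\<dots> \<le> K * \<bar>v i - u i\<bar>" using K by (intro mult_right_mono) auto
      finally show "\<bar>f (v i) - f (u i)\<bar> \<le> K * (v i - u i)" using le by simp
    qed
    also have "\<dots> = K * (\<Sum>i<n. v i - u i)" by (rule sum_distrib_left[symmetric])
    also have "\<dots> < \<epsilon>" using len K by (simp add: field_simps)
    finally show "(\<Sum>i<n. \<bar>f (v i) - f (u i)\<bar>) < \<epsilon>" .
  qed
  moreover have "\<epsilon> / K > 0" using \<open>\<epsilon> > 0\<close> K by simp
  ultimately show "\<exists>\<delta>>0. ac_gauge S f \<epsilon> \<delta>" by blast
qed

lemma C1_imp_abs_continuous_on:
  fixes f :: "real \<Rightarrow> real"
  assumes "\<And>x. x \<in> {a..b} \<Longrightarrow> (f has_real_derivative f' x) (at x within {a..b})"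
    and "continuous_on {a..b} f'"
  shows "abs_continuous_on {a..b} f"
proof -
  have "bounded (f' ` {a..b})"
    using assms(2) by (intro compact_imp_bounded compact_continuous_image) auto
  then obtain L where L: "\<forall>x\<in>{a..b}. norm (f' x) \<le> L" unfolding bounded_iff by auto
  show ?thesis
  proof (rule Lipschitz_imp_abs_continuous_on)
    fix x y assume "x \<in> {a..b}" "y \<in> {a..b}"
    then show "\<bar>f x - f y\<bar> \<le> L * \<bar>x - y\<bar>"
      using field_differentiable_bound[of "{a..b}" f f' L x y] assms(1) L by auto
  qed
qed

lemma abs_continuous_on_mult:
  assumes f: "abs_continuous_on {a..b} f" and g: "abs_continuous_on {a..b} g"
  shows "abs_continuous_on {a..b} (\<lambda>x. f x * g x)"
  unfolding abs_continuous_on_gauge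
proof (intro allI impI)
  fix \<epsilon> :: real assume e: "\<epsilon> > 0"
  have "bounded (f ` {a..b})" "bounded (g ` {a..b})"
    using abs_continuous_on_imp_continuous_on[OF f is_interval_cc] abs_continuous_on_imp_continuous_on[OF g is_interval_cc]
    by (auto intro!: compact_imp_bounded compact_continuous_image)
  then obtain A B where AB: "\<forall>x\<in>{a..b}. norm (f x) \<le> A" "\<forall>x\<in>{a..b}. norm (g x) \<le> B"
    unfolding bounded_iff by auto
  define K where "K = max 1 (max A B)"
  have K: "K > 0" "\<And>x. x \<in> {a..b} \<Longrightarrow> \<bar>f x\<bar> \<le> K" "\<And>x. x \<in> {a..b} \<Longrightarrow> \<bar>g x\<bar> \<le> K"
    using AB by (simp_all add: K_def le_max_iff_disj)
  have e2: "\<epsilon> / (2 * K) > 0" using e K by simp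
  obtain \<delta> where \<delta>: "\<delta> > 0" "ac_gauge {a..b} f (\<epsilon> / (2 * K)) \<delta>"
    using f e2 unfolding abs_continuous_on_gauge by blast
  obtain \<eta> where \<eta>: "\<eta> > 0" "ac_gauge {a..b} g (\<epsilon> / (2 * K)) \<eta>"
    using g e2 unfolding abs_continuous_on_gauge by blast
  have "ac_gauge {a..b} (\<lambda>x. f x * g x) \<epsilon> (min \<delta> \<eta>)"
    unfolding ac_gauge_def
  proof (intro allI impI)
    fix n :: nat and u v :: "nat \<Rightarrow> real"
    assume *: "nonoverlapping {..<n} u v" "\<forall>i<n. {u i..v i} \<subseteq> {a..b}" "(\<Sum>i<n. v i - u i) < min \<delta> \<eta>"
    have "(\<Sum>i<n. \<bar>f (v i) * g (v i) - f (u i) * g (u i)\<bar>)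
        \<le> (\<Sum>i<n. K * \<bar>f (v i) - f (u i)\<bar> + K * \<bar>g (v i) - g (u i)\<bar>)"
    proof (rule sum_mono)
      fix i assume i: "i \<in> {..<n}"
      then have "u i \<le> v i" using * by (simp add: nonoverlapping_def)
      then have uv: "u i \<in> {a..b}" "v i \<in> {a..b}" using *(2) i by auto
      have "f (v i) * g (v i) - f (u i) * g (u i) = g (u i) * (f (v i) - f (u i)) + f (v i) * (g (v i) - g (u i))"
        by (simp add: algebra_simps)
      also have "\<bar>\<dots>\<bar> \<le> \<bar>g (u i)\<bar> * \<bar>f (v i) - f (u i)\<bar> + \<bar>f (v i)\<bar> * \<bar>g (v i) - g (u i)\<bar>"
        by (rule order_trans[OF abs_triangle_ineq]) (simp add: abs_mult)
      also have "\<dots> \<le> K * \<bar>f (v i) - f (u i)\<bar> + K * \<bar>g (v i) - g (u i)\<bar>"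
        using K(2)[OF uv(2)] K(3)[OF uv(1)] by (intro add_mono mult_right_mono) auto
      finally show "\<bar>f (v i) * g (v i) - f (u i) * g (u i)\<bar> \<le> K * \<bar>f (v i) - f (u i)\<bar> + K * \<bar>g (v i) - g (u i)\<bar>" .
    qed
    also have "\<dots> = K * (\<Sum>i<n. \<bar>f (v i) - f (u i)\<bar>) + K * (\<Sum>i<n. \<bar>g (v i) - g (u i)\<bar>)"
      by (simp add: sum.distrib sum_distrib_left)
    also have "\<dots> < K * (\<epsilon> / (2 * K)) + K * (\<epsilon> / (2 * K))"
      using * K(1) ac_gaugeD[OF \<delta>(2) *(1)] ac_gaugeD[OF \<eta>(2) *(1)]
      by (intro add_strict_mono mult_strict_left_mono) auto
    also have "\<dots> = \<epsilon>" using K(1) by (simp add: field_simps)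
    finally show "(\<Sum>i<n. \<bar>f (v i) * g (v i) - f (u i) * g (u i)\<bar>) < \<epsilon>" .
  qed
  then show "\<exists>\<delta>>0. ac_gauge {a..b} (\<lambda>x. f x * g x) \<epsilon> \<delta>"
    using \<delta> \<eta> by (intro exI[of _ "min \<delta> \<eta>"]) auto
qed

text \<open>The square root is not Lipschitz at \<open>0\<close>, so that this is stated away from \<open>0\<close>, where it is
  continuously differentiable.\<close>

lemma abs_continuous_on_sqrt_mult:
  assumes "abs_continuous_on {0..b} \<phi>" "0 < a"
  shows "abs_continuous_on {a..b} (\<lambda>x. sqrt x * \<phi> x)"
proof (rule abs_continuous_on_mult)
  show "abs_continuous_on {a..b} sqrt"
  proof (rule C1_imp_abs_continuous_on)
    show "(sqrt has_real_derivative inverse (sqrt x) / 2) (at x within {a..b})" if "x \<in> {a..b}" for x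
      using that assms by (intro DERIV_subset[OF DERIV_real_sqrt]) auto
    show "continuous_on {a..b} (\<lambda>x. inverse (sqrt x) / 2)"
      using assms by (intro continuous_intros) auto
  qed
  show "abs_continuous_on {a..b} \<phi>"
    using assms by (intro abs_continuous_on_subset[OF assms(1)]) auto
qed

section \<open>From a Stein identity to the integration by parts that defines the score\<close>

text \<open>The test functions for which the Stein identities of the noise variables are derived.  Finitely many
  exceptional points admit piecewise defined functions; the bound on \<open>x * f' x\<close> makes \<open>G * f' W\<close> and
  \<open>Y\<^sup>2 * f' W\<close> bounded, as both \<open>G\<close> and \<open>Y\<^sup>2\<close> lie between \<open>0\<close> and \<open>W\<close>.\<close>

definition stein_test :: "(real \<Rightarrow> real) \<Rightarrow> (real \<Rightarrow> real) \<Rightarrow> bool" where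
  "stein_test f f' \<longleftrightarrow> continuous_on UNIV f \<and> f' \<in> borel_measurable borel \<and>
     (\<exists>S. finite S \<and> (\<forall>x. x \<notin> S \<longrightarrow> (f has_real_derivative f' x) (at x))) \<and>
     (\<exists>K. \<forall>x. \<bar>f x\<bar> \<le> K \<and> \<bar>x * f' x\<bar> \<le> K)"

text \<open>The antiderivative of the indicator of \<open>{s<..<t}\<close> that vanishes up to \<open>s\<close>.\<close>

definition ramp :: "real \<Rightarrow> real \<Rightarrow> real \<Rightarrow> real" where
  "ramp s t x = max 0 (min x t - s)"

definition ramp_test :: "real \<Rightarrow> real \<Rightarrow> real \<Rightarrow> real" where
  "ramp_test s t x = ramp s t x / sqrt x"

definition ramp_test_deriv :: "real \<Rightarrow> real \<Rightarrow> real \<Rightarrow> real" where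
  "ramp_test_deriv s t x = (indicator {s<..<t} x - ramp s t x / (2 * x)) / sqrt x"

text \<open>With \<open>u = sqrt x * f\<close> one has \<open>x * f' + f / 2 = sqrt x * u'\<close>; here \<open>u\<close> is the ramp.\<close>

lemma ramp_test_weighted:
  assumes "0 < s"
  shows "x * ramp_test_deriv s t x + ramp_test s t x / 2 = sqrt x * indicator {s<..<t} x"
proof (cases "x > 0")
  case True
  then have "x = sqrt x * sqrt x" by simp
  with True show ?thesis
    unfolding ramp_test_deriv_def ramp_test_def
    by (simp add: field_simps)
next
  case False
  then show ?thesis using assms
    by (auto simp: ramp_test_deriv_def ramp_test_def ramp_def indicator_def)
qed

lemma ramp_test_bounded:
  assumes "0 < s" "s < t"
  shows "\<bar>ramp_test s t x\<bar> \<le> (t - s) / sqrt s"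
proof (cases "x > s")
  case True
  then have "sqrt s \<le> sqrt x" "0 < sqrt s" using assms by auto
  moreover have "0 \<le> ramp s t x" "ramp s t x \<le> t - s" using assms by (auto simp: ramp_def)
  ultimately show ?thesis unfolding ramp_test_def by (auto intro!: frac_le)
qed (use assms in \<open>auto simp: ramp_test_def ramp_def\<close>)

lemma stein_test_ramp:
  assumes "0 < s" "s < t"
  shows "stein_test (ramp_test s t) (ramp_test_deriv s t)"
  unfolding stein_test_def
proof (intro conjI)
  have "ramp_test s t = (\<lambda>x. ramp s t x / sqrt (max x s))"
    using assms by (auto simp: ramp_test_def ramp_def fun_eq_iff max_def)
  moreover have "continuous_on UNIV (\<lambda>x. ramp s t x / sqrt (max x s))"
    unfolding ramp_def using assms by (intro continuous_intros) auto
  ultimately show "continuous_on UNIV (ramp_test s t)" by simp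
  show "ramp_test_deriv s t \<in> borel_measurable borel"
    unfolding ramp_test_deriv_def ramp_def by measurable
  have "(ramp_test s t has_real_derivative ramp_test_deriv s t x) (at x)" if ne: "x \<notin> {s, t}" for x
  proof -
    consider "x < s" | "s < x" "x < t" | "t < x" using ne by fastforce
    then show ?thesis
    proof cases
      case 1
      have "((\<lambda>_. 0) has_real_derivative ramp_test_deriv s t x) (at x)"
        using 1 assms by (auto simp: ramp_test_deriv_def ramp_def)
      then show ?thesis
        by (rule has_field_derivative_transform_within_open[where S = "{..<s}"])
          (use 1 assms in \<open>auto simp: ramp_test_def ramp_def\<close>)
    next
      case 2
      have "((\<lambda>x. (x - s) / sqrt x) has_real_derivative ramp_test_deriv s t x) (at x)"
        using 2 assms
        by (auto intro!: derivative_eq_intros simp: ramp_test_deriv_def ramp_def field_simps)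
      then show ?thesis
        by (rule has_field_derivative_transform_within_open[where S = "{s<..<t}"])
          (use 2 assms in \<open>auto simp: ramp_test_def ramp_def\<close>)
    next
      case 3
      have "((\<lambda>x. (t - s) / sqrt x) has_real_derivative ramp_test_deriv s t x) (at x)"
        using 3 assms
        by (auto intro!: derivative_eq_intros simp: ramp_test_deriv_def ramp_def field_simps)
      then show ?thesis
        by (rule has_field_derivative_transform_within_open[where S = "{t<..}"])
          (use 3 assms in \<open>auto simp: ramp_test_def ramp_def\<close>)
    qed
  qed
  then show "\<exists>S. finite S \<and> (\<forall>x. x \<notin> S \<longrightarrow> (ramp_test s t has_real_derivative ramp_test_deriv s t x) (at x))"
    by (intro exI[of _ "{s, t}"]) auto
  show "\<exists>K. \<forall>x. \<bar>ramp_test s t x\<bar> \<le> K \<and> \<bar>x * ramp_test_deriv s t x\<bar> \<le> K"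
  proof (intro exI allI conjI)
    fix x
    let ?K = "sqrt t + (t - s) / sqrt s"
    show "\<bar>ramp_test s t x\<bar> \<le> ?K"
    proof -
      have "0 \<le> sqrt t" using assms by simp
      then show ?thesis using ramp_test_bounded[OF assms, of x] by linarith
    qed
    have "x * ramp_test_deriv s t x = sqrt x * indicator {s<..<t} x - ramp_test s t x / 2"
      using ramp_test_weighted[OF assms(1), of x t] by simp
    moreover have "\<bar>sqrt x * indicator {s<..<t} x\<bar> \<le> sqrt t"
      using assms by (auto simp: indicator_def)
    ultimately show "\<bar>x * ramp_test_deriv s t x\<bar> \<le> ?K"
      using ramp_test_bounded[OF assms, of x] by linarith
  qed
qed

text \<open>Exchange of the order of integration over the region \<open>y < x\<close>: the form that integration by parts
  takes when one factor is the tail of a measure and the other an indefinite integral.\<close>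

lemma Fubini_lower_triangle:
  fixes \<rho> h :: "real \<Rightarrow> real"
  assumes mu: "finite_measure \<mu>" "sets \<mu> = sets borel"
    and rho: "integrable \<mu> \<rho>" and h: "integrable lborel h"
  shows "(LINT x|\<mu>. \<rho> x * (LBINT y. h y * indicator {..<x} y)) =
         (LBINT y. h y * (LINT x|\<mu>. \<rho> x * indicator {y<..} x))"
    "integrable lborel (\<lambda>y. h y * (LINT x|\<mu>. \<rho> x * indicator {y<..} x))"
proof -
  interpret finite_measure \<mu> by fact
  interpret pair_sigma_finite \<mu> lborel ..
  note [measurable_cong] = mu(2)
  have [measurable]: "\<rho> \<in> borel_measurable borel"
    using borel_measurable_integrable[OF rho] measurable_cong_sets[OF mu(2) refl] by blast
  have [measurable]: "h \<in> borel_measurable borel" using h by auto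
  have "integrable (\<mu> \<Otimes>\<^sub>M lborel) (\<lambda>(x, y). \<rho> x * h y)"
  proof (rule Fubini_integrable)
    show "integrable \<mu> (\<lambda>x. LBINT y. norm (case (x, y) of (x, y) \<Rightarrow> \<rho> x * h y))"
    proof -
      have "(\<lambda>x. LBINT y. norm (case (x, y) of (x, y) \<Rightarrow> \<rho> x * h y)) = (\<lambda>x. \<bar>\<rho> x\<bar> * (LBINT y. \<bar>h y\<bar>))"
        by (simp add: abs_mult)
      then show ?thesis using rho by (simp add: integrable_mult_left)
    qed
  qed (use h in auto)
  then have int: "integrable (\<mu> \<Otimes>\<^sub>M lborel) (\<lambda>(x, y). \<rho> x * h y * indicator {p. snd p < fst p} (x, y))"
    by (rule Bochner_Integration.integrable_bound) (auto simp: indicator_def)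
  have "(LBINT y. (LINT x|\<mu>. \<rho> x * h y * indicator {p. snd p < fst p} (x, y)))
      = (LINT x|\<mu>. (LBINT y. \<rho> x * h y * indicator {p. snd p < fst p} (x, y)))"
    using Fubini_integral[OF int] by simp
  moreover have "(LINT x|\<mu>. \<rho> x * h y * indicator {p. snd p < fst p} (x, y)) =
      h y * (LINT x|\<mu>. \<rho> x * indicator {y<..} x)" for y
  proof -
    have "(\<lambda>x. \<rho> x * h y * indicator {p. snd p < fst p} (x, y)) = (\<lambda>x. h y * (\<rho> x * indicator {y<..} x))"
      by (auto simp: indicator_def)
    then show ?thesis by simp
  qed
  moreover have "(LBINT y. \<rho> x * h y * indicator {p. snd p < fst p} (x, y)) =
      \<rho> x * (LBINT y. h y * indicator {..<x} y)" for x
  proof -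
    have "(\<lambda>y. \<rho> x * h y * indicator {p. snd p < fst p} (x, y)) = (\<lambda>y. \<rho> x * (h y * indicator {..<x} y))"
      by (auto simp: indicator_def)
    then show ?thesis by simp
  qed
  ultimately show "(LINT x|\<mu>. \<rho> x * (LBINT y. h y * indicator {..<x} y)) =
         (LBINT y. h y * (LINT x|\<mu>. \<rho> x * indicator {y<..} x))"
    "integrable lborel (\<lambda>y. h y * (LINT x|\<mu>. \<rho> x * indicator {y<..} x))"
    using integrable_snd[OF int] by simp_all
qed

text \<open>A law on the nonnegative axis for which \<open>R x / sqrt x\<close> satisfies the identity of the score, but only for
  the restricted class of test functions; \<open>score_identity\<close> below removes the restriction.\<close>

locale stein_law = finite_measure \<mu> for \<mu> :: "real measure" +
  fixes R :: "real \<Rightarrow> real"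
  assumes sets_mu [measurable_cong, simp]: "sets \<mu> = sets borel"
    and nonneg: "AE x in \<mu>. 0 \<le> x"
    and R_int: "integrable \<mu> R" and sqrt_int: "integrable \<mu> sqrt"
    and stein: "stein_test f f' \<Longrightarrow> (LINT x|\<mu>. x * f' x + f x / 2) = - (LINT x|\<mu>. R x * f x)"
begin

lemma space_mu [simp]: "space \<mu> = UNIV"
  using sets_eq_imp_space_eq[OF sets_mu] by simp

lemma R_meas [measurable]: "R \<in> borel_measurable borel"
  using borel_measurable_integrable[OF R_int] measurable_cong_sets[OF sets_mu refl] by blast

definition \<rho> :: "real \<Rightarrow> real" where "\<rho> x = R x / sqrt x"

lemma rho_meas [measurable]: "\<rho> \<in> borel_measurable borel"
  unfolding \<rho>_def by measurable

text \<open>If \<open>\<mu>\<close> has a smooth density \<open>p\<close> and \<open>\<rho>\<close> is its score, then \<open>\<rho> * p\<close> is the derivative of \<open>sqrt y * p y\<close>;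
  hence this tail integral is the only candidate for \<open>sqrt y * p y\<close>.\<close>

definition q :: "real \<Rightarrow> real" where "q y = - (LINT x|\<mu>. \<rho> x * indicator {y<..} x)"

lemma rho_tail_bound:
  assumes "0 < s" "s \<le> y"
  shows "\<bar>\<rho> x * indicator {y<..} x\<bar> \<le> \<bar>R x\<bar> / sqrt s"
proof (cases "x > y")
  case True
  then have "sqrt s \<le> sqrt x" "0 < sqrt s" using assms by auto
  then have "\<bar>R x\<bar> / sqrt x \<le> \<bar>R x\<bar> / sqrt s" by (intro divide_left_mono) auto
  then show ?thesis using True assms by (simp add: \<rho>_def abs_divide)
qed (use assms in simp)

lemma rho_tail_int:
  assumes "0 < s" shows "integrable \<mu> (\<lambda>x. \<rho> x * indicator {s<..} x)"
proof (rule Bochner_Integration.integrable_bound)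
  show "integrable \<mu> (\<lambda>x. \<bar>R x\<bar> / sqrt s)" using R_int by (intro integrable_divide integrable_abs)
  show "AE x in \<mu>. norm (\<rho> x * indicator {s<..} x) \<le> norm (\<bar>R x\<bar> / sqrt s)"
    using rho_tail_bound[OF assms order_refl] assms by (auto intro!: AE_I2)
qed measurable

lemma q_meas [measurable]: "q \<in> borel_measurable borel"
proof -
  have "(\<lambda>y. LINT x|\<mu>. \<rho> x * indicator {p. snd p < fst p} (x, y)) \<in> borel_measurable borel"
    by measurable
  moreover have "(\<lambda>x. \<rho> x * indicator {p. snd p < fst p} (x, y)) = (\<lambda>x. \<rho> x * indicator {y<..} x)" for y
    by (auto simp: indicator_def)
  ultimately show ?thesis unfolding q_def by simp
qed

text \<open>The Stein identity for the ramp between \<open>s\<close> and \<open>t\<close>, after exchanging the order of integration.\<close>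

lemma interval_identity:
  assumes "0 < s" "s < t"
  shows "(LINT x|\<mu>. sqrt x * indicator {s<..<t} x) = (LBINT y. indicator {s<..<t} y * q y)"
    "integrable lborel (\<lambda>y. indicator {s<..<t} y * q y)"
proof -
  let ?\<rho> = "\<lambda>x. \<rho> x * indicator {s<..} x"
  have eq: "indicator {s<..<t} y * (LINT x|\<mu>. ?\<rho> x * indicator {y<..} x) = - (indicator {s<..<t} y * q y)" for y :: real
  proof (cases "y \<in> {s<..<t}")
    case True
    then have "(\<lambda>x. ?\<rho> x * indicator {y<..} x) = (\<lambda>x. \<rho> x * indicator {y<..} x)"
      by (auto simp: indicator_def)
    then show ?thesis unfolding q_def by simp
  qed simp
  have h: "integrable lborel (indicator {s<..<t} :: real \<Rightarrow> real)"
    by (rule integrable_real_indicator) (use assms in auto)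
  have ramp: "(LBINT y. indicator {s<..<t} y * indicator {..<x} y) = ramp s t x" for x
  proof -
    have "(\<lambda>y. indicator {s<..<t} y * indicator {..<x} y) = (indicator {s<..<min x t} :: real \<Rightarrow> real)"
      by (auto simp: indicator_def)
    then show ?thesis by (cases "s \<le> min x t") (auto simp: ramp_def)
  qed
  have "(LINT x|\<mu>. sqrt x * indicator {s<..<t} x) = - (LINT x|\<mu>. R x * ramp_test s t x)"
    using stein[OF stein_test_ramp[OF assms]] by (simp add: ramp_test_weighted[OF assms(1)])
  also have "(LINT x|\<mu>. R x * ramp_test s t x) = (LINT x|\<mu>. ?\<rho> x * ramp s t x)"
    by (intro Bochner_Integration.integral_cong) (auto simp: \<rho>_def ramp_test_def ramp_def indicator_def)
  also have "\<dots> = (LBINT y. indicator {s<..<t} y * (LINT x|\<mu>. ?\<rho> x * indicator {y<..} x))"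
    using Fubini_lower_triangle(1)[OF finite_measure_axioms sets_mu rho_tail_int[OF assms(1)] h] by (simp add: ramp)
  finally show "(LINT x|\<mu>. sqrt x * indicator {s<..<t} x) = (LBINT y. indicator {s<..<t} y * q y)"
    by (simp add: eq)
  show "integrable lborel (\<lambda>y. indicator {s<..<t} y * q y)"
    using Fubini_lower_triangle(2)[OF finite_measure_axioms sets_mu rho_tail_int[OF assms(1)] h] by (simp add: eq)
qed

lemma q_right_continuous:
  assumes "0 < y" "y' \<longlonglongrightarrow> y" "\<And>n. y < y' n"
  shows "(\<lambda>n. q (y' n)) \<longlonglongrightarrow> q y"
  unfolding q_def
proof (intro tendsto_minus integral_dominated_convergence)
  show "integrable \<mu> (\<lambda>x. \<bar>R x\<bar> / sqrt y)" using R_int by (intro integrable_divide integrable_abs)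
  show "AE x in \<mu>. norm (\<rho> x * indicator {y' n<..} x) \<le> \<bar>R x\<bar> / sqrt y" for n
    using rho_tail_bound[OF assms(1) less_imp_le[OF assms(3)[of n]]] by auto
  show "AE x in \<mu>. (\<lambda>n. \<rho> x * indicator {y' n<..} x) \<longlonglongrightarrow> \<rho> x * indicator {y<..} x"
  proof (rule AE_I2)
    fix x
    have "(\<lambda>n. indicator {y' n<..} x :: real) \<longlonglongrightarrow> indicator {y<..} x"
    proof (cases "y < x")
      case True
      then have "\<forall>\<^sub>F n in sequentially. y' n < x" using assms(2) by (rule order_tendstoD(2)[rotated])
      then show ?thesis using True
        by (intro tendsto_eventually) (auto elim!: eventually_mono)
    next
      case False
      then have "\<not> y' n < x" for n using assms(3)[of n] by linarith
      then show ?thesis using False by simp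
    qed
    then show "(\<lambda>n. \<rho> x * indicator {y' n<..} x) \<longlonglongrightarrow> \<rho> x * indicator {y<..} x"
      by (intro tendsto_intros)
  qed
qed measurable

text \<open>The integrals of \<open>q\<close> over intervals are nonnegative by \<open>interval_identity\<close>; right-continuity turns this
  into a pointwise statement.\<close>

lemma q_nonneg:
  assumes "0 < y" shows "0 \<le> q y"
proof (rule ccontr)
  assume "\<not> 0 \<le> q y"
  then have neg: "q y < 0" by simp
  have "\<exists>\<epsilon>>0. \<forall>z. y < z \<and> z < y + \<epsilon> \<longrightarrow> q z < 0"
  proof (rule ccontr)
    assume "\<not> ?thesis"
    then have "\<forall>n. \<exists>z. y < z \<and> z < y + inverse (real (Suc n)) \<and> q z \<ge> 0"
      by (metis inverse_positive_iff_positive not_le of_nat_0_less_iff zero_less_Suc)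
    then obtain z where z: "\<And>n. y < z n" "\<And>n. z n < y + inverse (real (Suc n))" "\<And>n. q (z n) \<ge> 0"
      by metis
    have "z \<longlonglongrightarrow> y"
    proof (rule real_tendsto_sandwich[where f = "\<lambda>_. y"])
      show "(\<lambda>n. y + inverse (real (Suc n))) \<longlonglongrightarrow> y"
        using tendsto_add[OF tendsto_const LIMSEQ_inverse_real_of_nat] by simp
      show "\<forall>\<^sub>F n in sequentially. y \<le> z n" using z(1) by (simp add: less_imp_le)
      show "\<forall>\<^sub>F n in sequentially. z n \<le> y + inverse (real (Suc n))"
        by (rule always_eventually) (use z(2) less_imp_le in blast)
    qed simp
    from q_right_continuous[OF assms this z(1)] have "q y \<ge> 0"
      using z(3) by (intro tendsto_lowerbound[where F = sequentially]) auto
    with neg show False by simp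
  qed
  then obtain \<epsilon> where e: "\<epsilon> > 0" "\<And>z. y < z \<Longrightarrow> z < y + \<epsilon> \<Longrightarrow> q z < 0" by blast
  have yt: "y < y + \<epsilon>" using e by simp
  note id = interval_identity[OF assms yt]
  have "0 \<le> (LINT x|\<mu>. sqrt x * indicator {y<..<y + \<epsilon>} x)"
    using nonneg by (intro integral_nonneg_AE) (auto simp: indicator_def)
  then have ge: "0 \<le> (LBINT z. indicator {y<..<y + \<epsilon>} z * q z)" using id(1) by simp
  have "(LBINT z. - (indicator {y<..<y + \<epsilon>} z * q z)) = 0"
  proof (rule antisym)
    show "(LBINT z. - (indicator {y<..<y + \<epsilon>} z * q z)) \<le> 0" using ge by simp
    show "0 \<le> (LBINT z. - (indicator {y<..<y + \<epsilon>} z * q z))"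
      using e(2) by (intro integral_nonneg_AE AE_I2) (auto simp: indicator_def less_imp_le)
  qed
  then have "AE z in lborel. - (indicator {y<..<y + \<epsilon>} z * q z) = 0"
    using id(2) e(2)
    by (subst (asm) integral_nonneg_eq_0_iff_AE) (auto simp: indicator_def less_imp_le)
  then have "AE z in lborel. z \<notin> {y<..<y + \<epsilon>}"
    by eventually_elim (use e(2) in \<open>force simp: indicator_def split: if_splits\<close>)
  then have "{y<..<y + \<epsilon>} \<in> null_sets lborel"
    by (subst AE_iff_null_sets) auto
  then have "emeasure lborel {y<..<y + \<epsilon>} = 0" by auto
  then show False using e(1) by simp
qed

text \<open>Both measures agree on intervals that are bounded away from \<open>0\<close>, and half-lines are exhausted by
  such intervals.\<close>

lemma weighted_law_density:
  "density \<mu> (\<lambda>x. ennreal (sqrt x * indicator {0<..} x)) =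
   density lborel (\<lambda>x. ennreal (q x * indicator {0<..} x))"
  (is "?A = ?B")
proof (rule measure_eqI_lessThan)
  show "sets ?A = sets borel" "sets ?B = sets borel" by simp_all
  show "emeasure ?A {a<..} < \<infinity>" for a
  proof -
    have "emeasure ?A {a<..} \<le> (\<integral>\<^sup>+x. ennreal (norm (sqrt x)) \<partial>\<mu>)"
      by (subst emeasure_density) (auto intro!: nn_integral_mono simp: indicator_def)
    also have "\<dots> < \<infinity>" using sqrt_int by (simp add: integrable_iff_bounded)
    finally show ?thesis .
  qed
  have ioo: "emeasure ?A {s<..<t} = emeasure ?B {s<..<t}" if "0 < s" for s t
  proof (cases "s < t")
    case True
    have "emeasure ?A {s<..<t} = (\<integral>\<^sup>+x. ennreal (sqrt x * indicator {s<..<t} x) \<partial>\<mu>)"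
      using that by (subst emeasure_density) (auto intro!: nn_integral_cong simp: indicator_def)
    also have "\<dots> = ennreal (LINT x|\<mu>. sqrt x * indicator {s<..<t} x)"
      using that by (intro nn_integral_eq_integral integrable_real_mult_indicator sqrt_int)
         (auto simp: indicator_def)
    also have "\<dots> = ennreal (LBINT y. indicator {s<..<t} y * q y)"
      by (simp add: interval_identity(1)[OF that True])
    also have "\<dots> = (\<integral>\<^sup>+y. ennreal (indicator {s<..<t} y * q y) \<partial>lborel)"
      using that q_nonneg by (intro nn_integral_eq_integral[symmetric] interval_identity(2) True)
         (auto simp: indicator_def)
    also have "\<dots> = emeasure ?B {s<..<t}"
      using that by (subst emeasure_density) (auto intro!: nn_integral_cong simp: indicator_def)
    finally show ?thesis .
  qed simp
  show "emeasure ?A {a<..} = emeasure ?B {a<..}" for a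
  proof -
    define c where "c = max a 0"
    define I where "I = (\<lambda>n. {c + inverse (real (Suc n))<..<c + real (Suc n)})"
    have UI: "(\<Union>n. I n) = {c<..}"
    proof (intro equalityI subsetI)
      fix x assume "x \<in> {c<..}"
      then have x: "0 < x - c" by simp
      obtain n where n: "inverse (real (Suc n)) < x - c" using reals_Archimedean[OF x] by blast
      obtain m where m: "x - c < real m" using reals_Archimedean2 by blast
      have "inverse (real (Suc (max m n))) \<le> inverse (real (Suc n))"
        by (intro le_imp_inverse_le) auto
      moreover have "real m \<le> real (Suc (max m n))" by simp
      ultimately have "x \<in> I (max m n)"
        unfolding I_def greaterThanLessThan_iff using n m by linarith
      then show "x \<in> (\<Union>n. I n)" by blast
    qed (auto simp: I_def intro: less_trans[rotated])
    have inc: "incseq I"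
    proof (rule incseq_SucI)
      fix n
      have "inverse (real (Suc (Suc n))) \<le> inverse (real (Suc n))" by (intro le_imp_inverse_le) auto
      moreover have "real (Suc n) \<le> real (Suc (Suc n))" by simp
      ultimately show "I n \<subseteq> I (Suc n)"
        unfolding I_def greaterThanLessThan_subseteq_greaterThanLessThan by linarith
    qed
    have pos: "0 < c + inverse (real (Suc n))" for n unfolding c_def by (simp add: add_nonneg_pos)
    have "emeasure ?A {c<..} = (SUP n. emeasure ?A (I n))"
      unfolding UI[symmetric] by (rule SUP_emeasure_incseq[OF _ inc, symmetric]) (auto simp: I_def)
    also have "\<dots> = (SUP n. emeasure ?B (I n))"
      unfolding I_def using ioo[OF pos] by simp
    also have "\<dots> = emeasure ?B {c<..}"
      unfolding UI[symmetric] by (rule SUP_emeasure_incseq[OF _ inc]) (auto simp: I_def)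
    finally have "emeasure ?A {c<..} = emeasure ?B {c<..}" .
    moreover have "emeasure ?A {a<..} = emeasure ?A {c<..}" "emeasure ?B {a<..} = emeasure ?B {c<..}"
      by (subst (1 2) emeasure_density; auto intro!: nn_integral_cong simp: c_def indicator_def)+
    ultimately show ?thesis by simp
  qed
qed

lemma
  assumes [measurable]: "\<psi> \<in> borel_measurable borel"
  shows integrable_weighted_iff:
      "integrable \<mu> (\<lambda>x. sqrt x * indicator {0<..} x * \<psi> x) \<longleftrightarrow>
       integrable lborel (\<lambda>x. q x * indicator {0<..} x * \<psi> x)"
    and integral_weighted:
      "(LINT x|\<mu>. sqrt x * indicator {0<..} x * \<psi> x) = (LBINT x. q x * indicator {0<..} x * \<psi> x)"
proof -
  have 1: "0 \<le> sqrt x * indicator {0<..} x" for x :: real by (simp add: indicator_def)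
  have 2: "0 \<le> q x * indicator {0<..} x" for x :: real using q_nonneg[of x] by (simp add: indicator_def)
  show "integrable \<mu> (\<lambda>x. sqrt x * indicator {0<..} x * \<psi> x) \<longleftrightarrow>
       integrable lborel (\<lambda>x. q x * indicator {0<..} x * \<psi> x)"
    using integrable_density[of \<psi> \<mu> "\<lambda>x. sqrt x * indicator {0<..} x"] 1 2
      integrable_density[of \<psi> lborel "\<lambda>x. q x * indicator {0<..} x"]
    by (simp add: weighted_law_density)
  show "(LINT x|\<mu>. sqrt x * indicator {0<..} x * \<psi> x) = (LBINT x. q x * indicator {0<..} x * \<psi> x)"
    using integral_density[of \<psi> \<mu> "\<lambda>x. sqrt x * indicator {0<..} x"] 1 2
      integral_density[of \<psi> lborel "\<lambda>x. q x * indicator {0<..} x"]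
    by (simp add: weighted_law_density)
qed

end

context stein_law
begin

text \<open>On \<open>{a<..}\<close> the integrand \<open>sqrt a * \<bar>R x\<bar> / sqrt x\<close> is bounded by \<open>\<bar>R x\<bar>\<close> and it tends to \<open>0\<close> with \<open>a\<close>.\<close>

lemma sqrt_q_tendsto_0:
  assumes "a \<longlonglongrightarrow> 0" "\<And>n. 0 < a n"
  shows "(\<lambda>n. sqrt (a n) * q (a n)) \<longlonglongrightarrow> 0"
proof -
  have "(\<lambda>n. LINT x|\<mu>. sqrt (a n) * (\<rho> x * indicator {a n<..} x)) \<longlonglongrightarrow> (LINT x|\<mu>. 0)"
  proof (rule integral_dominated_convergence)
    show "integrable \<mu> (\<lambda>x. \<bar>R x\<bar>)" using R_int by (rule integrable_abs)
    show "AE x in \<mu>. norm (sqrt (a n) * (\<rho> x * indicator {a n<..} x)) \<le> \<bar>R x\<bar>" for n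
    proof (rule AE_I2)
      fix x
      have "sqrt (a n) * \<bar>\<rho> x * indicator {a n<..} x\<bar> \<le> sqrt (a n) * (\<bar>R x\<bar> / sqrt (a n))"
        using assms(2)[of n] by (intro mult_left_mono rho_tail_bound) auto
      then show "norm (sqrt (a n) * (\<rho> x * indicator {a n<..} x)) \<le> \<bar>R x\<bar>"
        using assms(2)[of n] by (simp add: abs_mult)
    qed
    show "AE x in \<mu>. (\<lambda>n. sqrt (a n) * (\<rho> x * indicator {a n<..} x)) \<longlonglongrightarrow> 0"
    proof (rule AE_I2)
      fix x
      have "(\<lambda>n. sqrt (a n) * \<bar>\<rho> x\<bar>) \<longlonglongrightarrow> sqrt 0 * \<bar>\<rho> x\<bar>"
        by (intro tendsto_intros assms)
      then have "(\<lambda>n. sqrt (a n) * \<bar>\<rho> x\<bar>) \<longlonglongrightarrow> 0" by simp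
      then show "(\<lambda>n. sqrt (a n) * (\<rho> x * indicator {a n<..} x)) \<longlonglongrightarrow> 0"
        by (rule Lim_null_comparison[rotated])
          (use assms(2) in \<open>auto simp: abs_mult indicator_def less_imp_le intro!: always_eventually\<close>)
    qed
  qed measurable
  then have "(\<lambda>n. - (sqrt (a n) * q (a n))) \<longlonglongrightarrow> 0" by (simp add: q_def)
  then show ?thesis using tendsto_minus_cancel_left[of _ 0] by fastforce
qed

context
  fixes \<phi> :: "real \<Rightarrow> real"
  assumes ac: "\<And>b. 0 < b \<Longrightarrow> abs_continuous_on {0..b} \<phi>"
    and D_int: "integrable \<mu> (\<lambda>x. indicator {0<..} x * (sqrt x * dsigma \<phi> x))"
    and rho_int: "integrable \<mu> (\<lambda>x. indicator {0<..} x * (sqrt x * \<rho> x * \<phi> x))"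
begin

definition u :: "real \<Rightarrow> real" where "u x = sqrt x * \<phi> x"
text \<open>The almost everywhere defined derivative of \<open>u\<close>, cut off at \<open>0\<close>.\<close>

definition D :: "real \<Rightarrow> real" where "D x = indicator {0<..} x * dsigma \<phi> x"

lemma D_meas [measurable]: "D \<in> borel_measurable borel"
proof -
  have "(\<lambda>x. indicator {0<..} x * (sqrt x * dsigma \<phi> x)) \<in> borel_measurable borel"
    using borel_measurable_integrable[OF D_int] measurable_cong_sets[OF sets_mu refl] by blast
  then have "(\<lambda>x. (indicator {0<..} x * (sqrt x * dsigma \<phi> x)) / sqrt x) \<in> borel_measurable borel"
    by measurable
  moreover have "(indicator {0<..} x * (sqrt x * dsigma \<phi> x)) / sqrt x = D x" for x
    by (auto simp: D_def indicator_def)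
  ultimately show ?thesis by simp
qed

lemma qD_int: "integrable lborel (\<lambda>x. q x * D x)"
  and qD_integral: "(LINT x|\<mu>. indicator {0<..} x * (sqrt x * dsigma \<phi> x)) = (LBINT x. q x * D x)"
proof -
  have 1: "indicator {0<..} x * (sqrt x * dsigma \<phi> x) = sqrt x * indicator {0<..} x * D x" for x
    by (simp add: D_def indicator_def)
  have 2: "q x * indicator {0<..} x * D x = q x * D x" for x
    by (simp add: D_def indicator_def)
  show "integrable lborel (\<lambda>x. q x * D x)"
    using D_int integrable_weighted_iff[OF D_meas] unfolding 1 2 by simp
  show "(LINT x|\<mu>. indicator {0<..} x * (sqrt x * dsigma \<phi> x)) = (LBINT x. q x * D x)"
    using integral_weighted[OF D_meas] unfolding 1 2 by simp
qed

lemma rho_u_int: "integrable \<mu> (\<lambda>x. \<rho> x * u x * indicator {0<..} x)"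
  using rho_int by (simp add: u_def mult_ac)

lemma u_FTC:
  assumes "0 < a" "a < b"
  shows "set_integrable lborel {a..b} D"
    and "\<And>x. x \<in> {a..b} \<Longrightarrow> (LINT y:{a..x}|lborel. D y) = u x - u a"
    and "continuous_on {a..b} u"
proof -
  have acu: "abs_continuous_on {a..b} u"
    unfolding u_def using ac[of b] assms by (intro abs_continuous_on_sqrt_mult) auto
  show "continuous_on {a..b} u" by (rule abs_continuous_on_imp_continuous_on[OF acu is_interval_cc])
  obtain g where g: "g \<in> borel_measurable borel" "set_integrable lborel {a..b} g"
    "\<And>x. x \<in> {a..b} \<Longrightarrow> (LINT y:{a..x}|lborel. g y) = u x - u a"
    "AE x in lborel. x \<in> {a<..<b} \<longrightarrow> (u has_real_derivative g x) (at x)"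
    by (rule abs_continuous_on_FTC[OF acu assms(2)]) (rule that)
  have "AE x in lborel. x \<noteq> a" "AE x in lborel. x \<noteq> b" by (rule AE_lborel_singleton)+
  with g(4) have eq: "AE x in lborel. x \<in> {a..b} \<longrightarrow> D x = g x"
  proof eventually_elim
    case (elim x)
    show ?case
    proof
      assume "x \<in> {a..b}"
      then have x: "x \<in> {a<..<b}" using elim by auto
      then have "deriv u x = g x" using elim by (intro DERIV_imp_deriv) auto
      then show "D x = g x" using x assms by (simp add: D_def dsigma_def u_def[abs_def])
    qed
  qed
  show "set_integrable lborel {a..b} D"
    using g(2) unfolding set_integrable_def
    by (rule integrable_cong_AE_imp) (use eq g(1) in \<open>auto simp: indicator_def\<close>)
  show "(LINT y:{a..x}|lborel. D y) = u x - u a" if "x \<in> {a..b}" for x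
    unfolding g(3)[OF that, symmetric] set_lebesgue_integral_def
    by (rule integral_cong_AE) (use eq g(1) that in \<open>auto simp: indicator_def\<close>)
qed

text \<open>The tail \<open>q\<close> has the measure \<open>\<rho> d\<mu>\<close> as its differential, and \<open>u\<close> is the integral of \<open>D\<close>; the product rule
  for the two is Fubini's theorem over a triangle.\<close>

lemma by_parts:
  assumes "0 < a" "a < b"
  shows "(LINT x|\<mu>. \<rho> x * u x * indicator {a<..b} x) =
     u b * q b - u a * q a - (LBINT y. q y * D y * indicator {a..b} y)"
proof -
  let ?J = "\<lambda>y. LINT x|\<mu>. \<rho> x * indicator {a<..b} x * indicator {y<..} x"
  note FTC = u_FTC[OF assms]
  have r_int: "integrable \<mu> (\<lambda>x. \<rho> x * indicator {a<..b} x)"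
    by (rule Bochner_Integration.integrable_bound[OF rho_tail_int[OF assms(1)]]) (auto simp: indicator_def)
  have rho_Ioc: "(LINT x|\<mu>. \<rho> x * indicator {y<..b} x) = q b - q y" if "a \<le> y" "y \<le> b" for y
  proof -
    have "(\<lambda>x. \<rho> x * indicator {y<..b} x) = (\<lambda>x. \<rho> x * indicator {y<..} x - \<rho> x * indicator {b<..} x)"
      using that by (auto simp: indicator_def fun_eq_iff)
    then show ?thesis
      using that assms by (simp add: q_def Bochner_Integration.integral_diff[OF rho_tail_int rho_tail_int])
  qed
  have h_int: "integrable lborel (\<lambda>y. D y * indicator {a..b} y)"
    using FTC(1) by (simp add: set_integrable_def mult.commute)
  define H where "H = (\<lambda>x. LBINT y. D y * indicator {a..b} y * indicator {..<x} y)"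
  have inner: "H x = u x - u a" if "x \<in> {a<..b}" for x
  proof -
    have "H x = (LINT y:{a..x}|lborel. D y)"
      unfolding set_lebesgue_integral_def H_def
    proof (rule integral_cong_AE)
      show "AE y in lborel. D y * indicator {a..b} y * indicator {..<x} y = indicator {a..x} y *\<^sub>R D y"
        using AE_lborel_singleton[of x] by eventually_elim (use that in \<open>auto simp: indicator_def\<close>)
    qed measurable
    then show ?thesis using FTC(2)[of x] that by simp
  qed
  have qD: "integrable lborel (\<lambda>y. q y * D y * indicator {a..b} y)"
    by (intro integrable_real_mult_indicator qD_int) auto
  have key: "\<rho> x * indicator {a<..b} x * H x =
      \<rho> x * u x * indicator {a<..b} x - u a * (\<rho> x * indicator {a<..b} x)" for x
    by (cases "x \<in> {a<..b}") (simp_all add: inner algebra_simps)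
  have ru_int: "integrable \<mu> (\<lambda>x. \<rho> x * u x * indicator {a<..b} x)"
  proof -
    have "integrable \<mu> (\<lambda>x. \<rho> x * u x * indicator {0<..} x * indicator {a<..b} x)"
      by (intro integrable_real_mult_indicator rho_u_int) auto
    moreover have "(\<lambda>x. \<rho> x * u x * indicator {0<..} x * indicator {a<..b} x) = (\<lambda>x. \<rho> x * u x * indicator {a<..b} x)"
      using assms by (auto simp: indicator_def)
    ultimately show ?thesis by simp
  qed
  have "(LINT x|\<mu>. \<rho> x * indicator {a<..b} x * H x) =
      (LINT x|\<mu>. \<rho> x * u x * indicator {a<..b} x) - u a * (q b - q a)"
    unfolding key using ru_int r_int rho_Ioc[of a] assms
    by (subst Bochner_Integration.integral_diff) auto
  moreover have "(LINT x|\<mu>. \<rho> x * indicator {a<..b} x * H x) =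
      (LBINT y. D y * indicator {a..b} y * ?J y)"
    unfolding H_def
    by (rule Fubini_lower_triangle(1)[OF finite_measure_axioms sets_mu r_int h_int])
  moreover have "(LBINT y. D y * indicator {a..b} y * ?J y)
     = (LBINT y. q b * (D y * indicator {a..b} y) - q y * D y * indicator {a..b} y)"
  proof (rule Bochner_Integration.integral_cong)
    fix y :: real
    show "D y * indicator {a..b} y * ?J y =
        q b * (D y * indicator {a..b} y) - q y * D y * indicator {a..b} y"
    proof (cases "y \<in> {a..b}")
      case True
      then have "(\<lambda>x. \<rho> x * indicator {a<..b} x * indicator {y<..} x) = (\<lambda>x. \<rho> x * indicator {y<..b} x)"
        by (auto simp: indicator_def fun_eq_iff)
      then have E: "?J y = q b - q y"
        using rho_Ioc[of y] True by simp
      show ?thesis unfolding E using True by (simp add: algebra_simps)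
    qed simp
  qed simp
  moreover have "(LBINT y. q b * (D y * indicator {a..b} y) - q y * D y * indicator {a..b} y) = q b * (u b - u a) - (LBINT y. q y * D y * indicator {a..b} y)"
    using FTC(2)[of b] assms h_int qD
    by (subst Bochner_Integration.integral_diff) (auto simp: set_lebesgue_integral_def mult.commute)
  ultimately show ?thesis by (simp add: algebra_simps)
qed

lemma tendsto_integral_indicator_at_top:
  fixes f :: "'b::{banach, second_countable_topology} \<Rightarrow> real"
  assumes "integrable M f" "\<And>b. A b \<in> sets M" "\<And>x. \<forall>\<^sub>F b :: real in at_top. x \<in> A b \<longleftrightarrow> x \<in> B" "B \<in> sets M"
  shows "((\<lambda>b. LINT x|M. f x * indicator (A b) x) \<longlongrightarrow> (LINT x|M. f x * indicator B x)) at_top"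
proof (rule integral_dominated_convergence_at_top[where w = "\<lambda>x. norm (f x)"])
  show "AE x in M. ((\<lambda>b. f x * indicator (A b) x) \<longlongrightarrow> f x * indicator B x) at_top"
  proof (rule AE_I2)
    fix x
    have "\<forall>\<^sub>F b in at_top. f x * indicator (A b) x = f x * indicator B x"
      using assms(3)[of x] by eventually_elim (simp add: indicator_def)
    then show "((\<lambda>b. f x * indicator (A b) x) \<longlongrightarrow> f x * indicator B x) at_top"
      by (rule tendsto_eventually)
  qed
  show "\<forall>\<^sub>F b in at_top. AE x in M. norm (f x * indicator (A b) x) \<le> norm (f x)"
    by (auto simp: indicator_def intro!: always_eventually)
qed (use assms in \<open>auto intro!: borel_measurable_times borel_measurable_indicator\<close>)

text \<open>By \<open>by_parts\<close> the boundary term is, up to a constant, a sum of two integrals over \<open>{1..b}\<close> of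
  integrable functions.\<close>

lemma uq_convergent: "\<exists>L. ((\<lambda>b. u b * q b) \<longlongrightarrow> L) at_top"
proof -
  have 1: "((\<lambda>b. LINT x|\<mu>. \<rho> x * u x * indicator {0<..} x * indicator {1<..b} x) \<longlongrightarrow>
      (LINT x|\<mu>. \<rho> x * u x * indicator {0<..} x * indicator {1<..} x)) at_top"
  proof (rule tendsto_integral_indicator_at_top[OF rho_u_int])
    show "\<forall>\<^sub>F b in at_top. x \<in> {1<..b} \<longleftrightarrow> x \<in> {1<..}" for x :: real
      using eventually_ge_at_top[of x] by eventually_elim auto
  qed auto
  have eq: "(\<lambda>x. \<rho> x * u x * indicator {0<..} x * indicator {1<..b} x) = (\<lambda>x. \<rho> x * u x * indicator {1<..b} x)" for b
    by (auto simp: indicator_def fun_eq_iff)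
  have 2: "((\<lambda>b. LBINT y. q y * D y * indicator {1..b} y) \<longlongrightarrow> (LBINT y. q y * D y * indicator {1..} y)) at_top"
  proof (rule tendsto_integral_indicator_at_top[OF qD_int])
    show "\<forall>\<^sub>F b in at_top. x \<in> {1..b} \<longleftrightarrow> x \<in> {1..}" for x :: real
      using eventually_ge_at_top[of x] by eventually_elim auto
  qed auto
  have "\<forall>\<^sub>F b in at_top. (LINT x|\<mu>. \<rho> x * u x * indicator {1<..b} x) + (LBINT y. q y * D y * indicator {1..b} y) + u 1 * q 1 = u b * q b"
    using eventually_gt_at_top[of "1::real"] by eventually_elim (use by_parts[of 1] in auto)
  from Lim_transform_eventually[OF tendsto_add[OF tendsto_add[OF 1[unfolded eq] 2] tendsto_const] this]
  show ?thesis by blast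
qed

text \<open>If \<open>\<bar>u q\<bar> \<ge> c\<close> on \<open>{B..}\<close>, then \<open>\<bar>D\<bar> \<le> \<bar>q D\<bar> \<bar>u\<bar> / c\<close> there.  Hence \<open>u\<close> varies over \<open>{B..t}\<close> by at most half of
  the maximum of \<open>\<bar>u\<bar>\<close>, which is therefore at most twice the value at \<open>B\<close>.\<close>

lemma u_bounded_if_uq_away_0:
  assumes B: "1 \<le> B" and c: "0 < c" and away: "\<And>x. B \<le> x \<Longrightarrow> c \<le> \<bar>u x * q x\<bar>"
    and tail: "(LBINT y. \<bar>q y * D y\<bar> * indicator {B..} y) \<le> c / 2"
    and t: "B < t"
  shows "\<bar>u t\<bar> \<le> 2 * \<bar>u B\<bar>"
proof -
  have B0: "0 < B" using B by simp
  note FTC = u_FTC[OF B0 t]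
  have "\<exists>z\<in>{B..t}. \<forall>x\<in>{B..t}. \<bar>u x\<bar> \<le> \<bar>u z\<bar>"
    by (rule continuous_attains_sup) (use t FTC(3) in \<open>auto intro!: continuous_on_rabs\<close>)
  then obtain z where z: "z \<in> {B..t}" "\<And>x. x \<in> {B..t} \<Longrightarrow> \<bar>u x\<bar> \<le> \<bar>u z\<bar>" by blast
  have "u z - u B = (LBINT y. indicator {B..z} y * D y)"
    using FTC(2)[OF z(1)] by (simp add: set_lebesgue_integral_def)
  also have "\<bar>\<dots>\<bar> \<le> (LBINT y. \<bar>indicator {B..z} y * D y\<bar>)"
    by (rule integral_abs_bound)
  also have "\<dots> \<le> (LBINT y. \<bar>u z\<bar> / c * (\<bar>q y * D y\<bar> * indicator {B..} y))"
  proof (rule integral_mono)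
    have "set_integrable lborel {B..z} D"
      using z(1) by (intro set_integrable_subset[OF FTC(1)]) auto
    then show "integrable lborel (\<lambda>y. \<bar>indicator {B..z} y * D y\<bar>)"
      by (simp add: set_integrable_def integrable_abs)
    show "integrable lborel (\<lambda>y. \<bar>u z\<bar> / c * (\<bar>q y * D y\<bar> * indicator {B..} y))"
      by (intro integrable_mult_right integrable_real_mult_indicator integrable_abs qD_int) auto
    fix y :: real
    show "\<bar>indicator {B..z} y * D y\<bar> \<le> \<bar>u z\<bar> / c * (\<bar>q y * D y\<bar> * indicator {B..} y)"
    proof (cases "y \<in> {B..z}")
      case True
      then have "c \<le> \<bar>u y\<bar> * \<bar>q y\<bar>" using away[of y] by (simp add: abs_mult)
      also have "\<dots> \<le> \<bar>u z\<bar> * \<bar>q y\<bar>" using z True by (intro mult_right_mono) auto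
      finally have "c * \<bar>D y\<bar> \<le> \<bar>u z\<bar> * \<bar>q y\<bar> * \<bar>D y\<bar>" by (intro mult_right_mono) auto
      then show ?thesis using True c by (simp add: abs_mult field_simps)
    next
      case False
      have "0 \<le> \<bar>u z\<bar> / c * (\<bar>q y * D y\<bar> * indicator {B..} y)"
        using c by (intro mult_nonneg_nonneg divide_nonneg_nonneg) auto
      with False show ?thesis by simp
    qed
  qed
  also have "\<dots> = \<bar>u z\<bar> / c * (LBINT y. \<bar>q y * D y\<bar> * indicator {B..} y)" by simp
  also have "\<dots> \<le> \<bar>u z\<bar> / c * (c / 2)" using tail c by (intro mult_left_mono) auto
  also have "\<dots> = \<bar>u z\<bar> / 2" using c by simp
  finally have "\<bar>u z\<bar> \<le> 2 * \<bar>u B\<bar>" by linarith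
  then show ?thesis using z(2)[of t] t by simp
qed

text \<open>A limit other than \<open>0\<close> would make \<open>u\<close> bounded and hence \<open>q \<ge> c / K\<close> far out; then the integral of \<open>q\<close>
  over \<open>{T<..<2 * T}\<close> grows linearly in \<open>T\<close>, although it is bounded by the integral of \<open>sqrt x\<close> under \<open>\<mu>\<close>.\<close>

lemma uq_tendsto_0: "((\<lambda>b. u b * q b) \<longlongrightarrow> 0) at_top"
proof -
  let ?tail = "\<lambda>b. LBINT y. \<bar>q y * D y\<bar> * indicator {b..} y"
  obtain L where L: "((\<lambda>b. u b * q b) \<longlongrightarrow> L) at_top" using uq_convergent by blast
  have "L = 0"
  proof (rule ccontr)
    assume "L \<noteq> 0"
    define c where "c = \<bar>L\<bar> / 2"
    have c: "0 < c" "c < \<bar>L\<bar>" using \<open>L \<noteq> 0\<close> by (auto simp: c_def)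
    have "(?tail \<longlongrightarrow> (LBINT y. \<bar>q y * D y\<bar> * indicator {} y)) at_top"
    proof (rule tendsto_integral_indicator_at_top[OF integrable_abs[OF qD_int]])
      show "\<forall>\<^sub>F b in at_top. x \<in> {b..} \<longleftrightarrow> x \<in> {}" for x :: real
        using eventually_gt_at_top[of x] by eventually_elim auto
    qed auto
    then have "\<forall>\<^sub>F b in at_top. ?tail b < c / 2"
      using c(1) by (intro order_tendstoD(2)) auto
    moreover have "\<forall>\<^sub>F b in at_top. c < \<bar>u b * q b\<bar>"
      using order_tendstoD(1)[OF tendsto_rabs[OF L] c(2)] .
    ultimately have "\<forall>\<^sub>F b in at_top. ?tail b < c / 2 \<and> c < \<bar>u b * q b\<bar>"
      by (rule eventually_conj)
    then obtain B0 where B0: "\<And>b. B0 \<le> b \<Longrightarrow> ?tail b < c / 2 \<and> c < \<bar>u b * q b\<bar>"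
      unfolding eventually_at_top_linorder by blast
    define B where "B = max B0 1"
    have tail: "?tail B \<le> c / 2"
      using B0[of B] by (simp add: B_def)
    have away: "c \<le> \<bar>u x * q x\<bar>" if "B \<le> x" for x using B0[of x] that by (simp add: B_def)
    have B1: "1 \<le> B" by (simp add: B_def)
    define K where "K = 2 * \<bar>u B\<bar>"
    have "u B \<noteq> 0" using away[of B] c(1) by auto
    then have K: "0 < K" by (simp add: K_def)
    have q_ge: "c / K \<le> q t" if "B < t" for t
    proof -
      have t0: "0 < t" using that B1 by simp
      have "c \<le> \<bar>u t\<bar> * \<bar>q t\<bar>" using away[of t] that by (simp add: abs_mult)
      also have "\<dots> \<le> K * \<bar>q t\<bar>"
        using u_bounded_if_uq_away_0[OF B1 c(1) away tail that] unfolding K_def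
        by (intro mult_right_mono) auto
      finally show ?thesis using q_nonneg[OF t0] K by (simp add: field_simps)
    qed
    define C where "C = (LINT x|\<mu>. \<bar>sqrt x\<bar>)"
    have bound: "c / K * T \<le> C" if "B < T" for T
    proof -
      have T: "0 < T" "T < 2 * T" using that B1 by auto
      have "c / K * T = (LBINT y. indicator {T<..<2 * T} y * (c / K))" using T by simp
      also have "\<dots> \<le> (LBINT y. indicator {T<..<2 * T} y * q y)"
      proof (rule integral_mono)
        show "integrable lborel (\<lambda>y. indicator {T<..<2 * T} y * (c / K))"
          using T by (intro integrable_mult_left integrable_real_indicator) auto
        show "integrable lborel (\<lambda>y. indicator {T<..<2 * T} y * q y)" by (rule interval_identity(2)[OF T])
        show "indicator {T<..<2 * T} y * (c / K) \<le> indicator {T<..<2 * T} y * q y" for y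
          using q_ge[of y] that by (auto simp: indicator_def)
      qed
      also have "\<dots> = (LINT x|\<mu>. sqrt x * indicator {T<..<2 * T} x)" by (rule interval_identity(1)[OF T, symmetric])
      also have "\<dots> \<le> C" unfolding C_def
      proof (rule integral_mono)
        show "integrable \<mu> (\<lambda>x. sqrt x * indicator {T<..<2 * T} x)"
          by (intro integrable_real_mult_indicator sqrt_int) auto
        show "integrable \<mu> (\<lambda>x. \<bar>sqrt x\<bar>)" by (rule integrable_abs[OF sqrt_int])
      qed (auto simp: indicator_def)
      finally show ?thesis .
    qed
    \<comment> \<open>large enough for the linear lower bound to reach \<open>C + 1\<close>\<close>
    define T where "T = max (B + 1) ((C + 1) * K / c)"
    have "C + 1 = c / K * ((C + 1) * K / c)" using c(1) K by simp
    also have "\<dots> \<le> c / K * T" using c(1) K by (intro mult_left_mono) (auto simp: T_def)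
    also have "\<dots> \<le> C" by (rule bound) (auto simp: T_def)
    finally show False by simp
  qed
  with L show ?thesis by simp
qed

text \<open>The limit of \<open>by_parts\<close> as \<open>{a..b}\<close> exhausts the positive axis.\<close>

lemma score_identity:
  "(LINT x|\<mu>. indicator {0<..} x * (sqrt x * \<rho> x * \<phi> x)) = - (LINT x|\<mu>. indicator {0<..} x * (sqrt x * dsigma \<phi> x))"
proof -
  let ?h = "\<lambda>x. \<rho> x * u x * indicator {0<..} x"
  define a where "a = (\<lambda>n. inverse (real (Suc (Suc n))))"
  define b where "b = (\<lambda>n. real (Suc (Suc n)))"
  let ?I = "\<lambda>n. LBINT y. q y * D y * indicator {a n..b n} y"
  have a: "0 < a n" "a n < 1" and b: "1 < b n" for n
    unfolding a_def b_def by (auto intro: inverse_less_1_iff[THEN iffD2])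
  have a0: "a \<longlonglongrightarrow> 0"
    unfolding a_def by (rule LIMSEQ_Suc[OF LIMSEQ_inverse_real_of_nat])
  have b_top: "filterlim b at_top sequentially"
    unfolding b_def using filterlim_compose[OF filterlim_real_sequentially filterlim_compose[OF filterlim_Suc filterlim_Suc]] by simp
  have ev: "\<forall>\<^sub>F n in sequentially. a n < x \<and> x < b n" if "0 < x" for x
    using order_tendstoD(2)[OF a0 that] filterlim_at_top_dense[THEN iffD1, OF b_top, rule_format, of x]
    by (rule eventually_conj)
  have 1: "(\<lambda>n. LINT x|\<mu>. \<rho> x * u x * indicator {a n<..b n} x) \<longlonglongrightarrow> (LINT x|\<mu>. ?h x)"
  proof (rule integral_dominated_convergence)
    show "integrable \<mu> (\<lambda>x. \<bar>?h x\<bar>)" by (rule integrable_abs[OF rho_u_int])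
    show ru: "?h \<in> borel_measurable \<mu>" using rho_u_int by auto
    show "(\<lambda>x. \<rho> x * u x * indicator {a n<..b n} x) \<in> borel_measurable \<mu>" for n
    proof -
      have "(\<lambda>x. ?h x * indicator {a n<..b n} x) \<in> borel_measurable \<mu>"
        using ru by measurable
      moreover have "(\<lambda>x. ?h x * indicator {a n<..b n} x) = (\<lambda>x. \<rho> x * u x * indicator {a n<..b n} x)"
        using a(1)[of n] by (auto simp: indicator_def fun_eq_iff)
      ultimately show ?thesis by simp
    qed
    show "AE x in \<mu>. norm (\<rho> x * u x * indicator {a n<..b n} x) \<le> \<bar>?h x\<bar>" for n
      using a(1)[of n] by (intro AE_I2) (auto simp: indicator_def)
    show "AE x in \<mu>. (\<lambda>n. \<rho> x * u x * indicator {a n<..b n} x) \<longlonglongrightarrow> ?h x"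
    proof (rule AE_I2)
      fix x
      show "(\<lambda>n. \<rho> x * u x * indicator {a n<..b n} x) \<longlonglongrightarrow> ?h x"
      proof (cases "0 < x")
        case True
        show ?thesis
          by (rule tendsto_eventually, use ev[OF True] in eventually_elim) (use True in auto)
      next
        case False
        then have "x \<notin> {a n<..b n}" for n using a(1)[of n] by auto
        then show ?thesis using False by simp
      qed
    qed
  qed
  have 2: "?I \<longlonglongrightarrow> (LBINT y. q y * D y)"
  proof (rule integral_dominated_convergence)
    show "integrable lborel (\<lambda>x. \<bar>q x * D x\<bar>)" by (rule integrable_abs[OF qD_int])
    show "AE x in lborel. norm (q x * D x * indicator {a n..b n} x) \<le> \<bar>q x * D x\<bar>" for n
      by (intro AE_I2) (auto simp: indicator_def)
    show "AE x in lborel. (\<lambda>n. q x * D x * indicator {a n..b n} x) \<longlonglongrightarrow> q x * D x"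
    proof (rule AE_I2)
      fix x
      show "(\<lambda>n. q x * D x * indicator {a n..b n} x) \<longlonglongrightarrow> q x * D x"
      proof (cases "0 < x")
        case True
        show ?thesis
          by (rule tendsto_eventually, use ev[OF True] in eventually_elim) auto
      qed (simp add: D_def)
    qed
  qed measurable
  have 3: "(\<lambda>n. u (b n) * q (b n)) \<longlonglongrightarrow> 0"
    by (rule filterlim_compose[OF uq_tendsto_0 b_top])
  have 4: "(\<lambda>n. u (a n) * q (a n)) \<longlonglongrightarrow> 0"
  proof -
    have "continuous_on {0..1} \<phi>"
      by (rule abs_continuous_on_imp_continuous_on[OF ac[OF zero_less_one] is_interval_cc])
    then have "(\<lambda>n. \<phi> (a n)) \<longlonglongrightarrow> \<phi> 0"
      by (rule continuous_on_tendsto_compose[OF _ a0]) (use a less_imp_le in \<open>auto intro!: always_eventually\<close>)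
    from tendsto_mult[OF this sqrt_q_tendsto_0[OF a0 a(1)]] show ?thesis
      by (simp add: u_def mult_ac)
  qed
  have "(\<lambda>n. u (b n) * q (b n) - u (a n) * q (a n) - ?I n)
     \<longlonglongrightarrow> 0 - 0 - (LBINT y. q y * D y)"
    by (intro tendsto_diff 2 3 4)
  moreover have "u (b n) * q (b n) - u (a n) * q (a n) - ?I n
     = (LINT x|\<mu>. \<rho> x * u x * indicator {a n<..b n} x)" for n
    by (rule by_parts[symmetric, OF a(1) less_trans[OF a(2) b]])
  ultimately have "(LINT x|\<mu>. ?h x) = - (LBINT y. q y * D y)"
    using LIMSEQ_unique[OF 1] by simp
  then show ?thesis unfolding qD_integral by (simp add: u_def mult_ac)
qed

end

text \<open>Test functions that shrink to the indicator of \<open>{0}\<close> with \<open>x * f' x\<close> bounded and tending to \<open>0\<close> turn the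
  Stein identity into \<open>m / 2 = - R 0 * m\<close> for the mass \<open>m\<close> of \<open>{0}\<close>.\<close>

lemma no_atom_at_0:
  assumes "0 \<le> R 0"
  shows "AE x in \<mu>. 0 < x"
proof -
  define f where "f = (\<lambda>n x :: real. 1 / (1 + real n * x\<^sup>2))"
  define f' where "f' = (\<lambda>n x :: real. - (2 * real n * x) / (1 + real n * x\<^sup>2)\<^sup>2)"
  have pos: "1 \<le> 1 + real n * x\<^sup>2" for n x by simp
  have pos': "0 < 1 + real n * x\<^sup>2" for n x using pos[of n x] by linarith
  have f_le: "\<bar>f n x\<bar> \<le> 1" for n x
    unfolding f_def using pos'[of n x] by (simp add: abs_of_pos pos_divide_le_eq)
  have xf'_le: "\<bar>x * f' n x\<bar> \<le> 2" for n x
  proof -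
    have "\<bar>x * f' n x\<bar> = 2 * (real n * x\<^sup>2) / (1 + real n * x\<^sup>2)\<^sup>2"
      by (simp add: f'_def power2_eq_square abs_mult)
    also have "\<dots> \<le> 2 * (1 + real n * x\<^sup>2)\<^sup>2 / (1 + real n * x\<^sup>2)\<^sup>2"
    proof (intro divide_right_mono mult_left_mono)
      show "real n * x\<^sup>2 \<le> (1 + real n * x\<^sup>2)\<^sup>2"
        using self_le_power[OF pos[of n x], of 2] by simp
    qed auto
    also have "\<dots> = 2" using pos'[of n x] by simp
    finally show ?thesis .
  qed
  have test: "stein_test (f n) (f' n)" for n
    unfolding stein_test_def
  proof (intro conjI exI allI impI)
    show "continuous_on UNIV (f n)" unfolding f_def
      using pos' by (intro continuous_intros) (metis less_irrefl)
    show "f' n \<in> borel_measurable borel" unfolding f'_def by measurable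
    show "(f n has_real_derivative f' n x) (at x)" for x
      unfolding f_def f'_def using pos'[of n x]
      by (auto intro!: derivative_eq_intros simp: power2_eq_square)
    show "\<bar>f n x\<bar> \<le> 2" for x using f_le[of n x] by simp
  qed (use xf'_le in auto)
  have f_lim: "(\<lambda>n. f n x) \<longlonglongrightarrow> indicator {0} x" for x
  proof (cases "x = 0")
    case False
    then have "(\<lambda>n. 1 / (1 + real n * x\<^sup>2)) \<longlonglongrightarrow> 0" by real_asymp
    with False show ?thesis by (simp add: f_def)
  qed (simp add: f_def)
  have xf'_lim: "(\<lambda>n. x * f' n x) \<longlonglongrightarrow> 0" for x
  proof (cases "x = 0")
    case False
    then have "(\<lambda>n. x * (- (2 * real n * x) / (1 + real n * x\<^sup>2)\<^sup>2)) \<longlonglongrightarrow> 0" by real_asymp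
    then show ?thesis by (simp add: f'_def)
  qed simp
  have m: "f n \<in> borel_measurable \<mu>" "f' n \<in> borel_measurable \<mu>" for n
    unfolding f_def f'_def by measurable
  have lim1: "(\<lambda>n. LINT x|\<mu>. x * f' n x + f n x / 2) \<longlonglongrightarrow> (LINT x|\<mu>. 0 + indicator {0} x / 2)"
  proof (rule integral_dominated_convergence[where w = "\<lambda>_. 3"])
    show "AE x in \<mu>. norm (x * f' n x + f n x / 2) \<le> 3" for n
    proof (rule AE_I2)
      fix x show "norm (x * f' n x + f n x / 2) \<le> 3"
        using f_le[of n x] xf'_le[of x n] unfolding real_norm_def by linarith
    qed
    show "AE x in \<mu>. (\<lambda>n. x * f' n x + f n x / 2) \<longlonglongrightarrow> 0 + indicator {0} x / 2"
      by (intro AE_I2 tendsto_intros f_lim xf'_lim) auto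
  qed (use m in auto)
  have lim2: "(\<lambda>n. LINT x|\<mu>. R x * f n x) \<longlonglongrightarrow> (LINT x|\<mu>. R x * indicator {0} x)"
  proof (rule integral_dominated_convergence[where w = "\<lambda>x. \<bar>R x\<bar>"])
    show "AE x in \<mu>. norm (R x * f n x) \<le> \<bar>R x\<bar>" for n
      using f_le by (auto simp: abs_mult intro!: mult_left_le)
    show "AE x in \<mu>. (\<lambda>n. R x * f n x) \<longlonglongrightarrow> R x * indicator {0} x"
      by (intro AE_I2 tendsto_intros f_lim)
  qed (use m R_int in auto)
  have "(LINT x|\<mu>. 0 + indicator {0} x / 2) = - (LINT x|\<mu>. R x * indicator {0} x)"
    by (rule LIMSEQ_unique[OF lim1[unfolded stein[OF test]] tendsto_minus[OF lim2]])
  moreover have "(\<lambda>x. R x * indicator {0} x) = (\<lambda>x. R 0 * indicator {0} x)"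
    by (auto simp: indicator_def)
  ultimately have "measure \<mu> {0} / 2 = - (R 0 * measure \<mu> {0})" by simp
  then have "(1 / 2 + R 0) * measure \<mu> {0} = 0" by (simp add: algebra_simps)
  then have "measure \<mu> {0} = 0" using assms by auto
  then have "{0} \<in> null_sets \<mu>" by (simp add: emeasure_eq_measure null_setsI)
  then have "AE x in \<mu>. x \<notin> {0}" by (rule AE_not_in)
  with nonneg show ?thesis by eventually_elim auto
qed

end

section \<open>Uniqueness and existence of the score\<close>

text \<open>The positive and the negative part of \<open>f\<close> are densities of two finite measures that agree on all
  half-lines.\<close>

lemma integral_greaterThan_zero_imp_AE_zero:
  fixes f :: "real \<Rightarrow> real"
  assumes mu: "finite_measure \<mu>" "sets \<mu> = sets borel" and f: "integrable \<mu> f"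
    and zero: "\<And>t. (LINT x|\<mu>. f x * indicator {t<..} x) = 0"
  shows "AE x in \<mu>. f x = 0"
proof -
  interpret finite_measure \<mu> by fact
  note [measurable_cong] = mu(2)
  have [measurable]: "f \<in> borel_measurable \<mu>" using f by auto
  have tail: "emeasure (density \<mu> (\<lambda>x. ennreal (g x))) {t<..} = ennreal (LINT x|\<mu>. max 0 (g x) * indicator {t<..} x)"
    if g: "integrable \<mu> g" for g :: "real \<Rightarrow> real" and t
  proof -
    have "emeasure (density \<mu> (\<lambda>x. ennreal (g x))) {t<..} = (\<integral>\<^sup>+x. ennreal (max 0 (g x) * indicator {t<..} x) \<partial>\<mu>)"
      using g by (subst emeasure_density)
        (auto intro!: nn_integral_cong simp: indicator_def max_def ennreal_neg mu(2))
    also have "\<dots> = ennreal (LINT x|\<mu>. max 0 (g x) * indicator {t<..} x)"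
      using g by (intro nn_integral_eq_integral integrable_real_mult_indicator integrable_max)
        (auto simp: mu(2))
    finally show ?thesis .
  qed
  have "density \<mu> (\<lambda>x. ennreal (f x)) = density \<mu> (\<lambda>x. ennreal (- f x))"
  proof (rule measure_eqI_lessThan)
    fix t
    have "(LINT x|\<mu>. max 0 (f x) * indicator {t<..} x) - (LINT x|\<mu>. max 0 (- f x) * indicator {t<..} x)
        = (LINT x|\<mu>. max 0 (f x) * indicator {t<..} x - max 0 (- f x) * indicator {t<..} x)"
      using f by (intro Bochner_Integration.integral_diff[symmetric] integrable_real_mult_indicator integrable_max)
        (auto simp: mu(2))
    also have "\<dots> = (LINT x|\<mu>. f x * indicator {t<..} x)"
      by (intro Bochner_Integration.integral_cong) (auto simp: max_def indicator_def)
    finally show "emeasure (density \<mu> (\<lambda>x. ennreal (f x))) {t<..} = emeasure (density \<mu> (\<lambda>x. ennreal (- f x))) {t<..}"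
      using zero f by (simp add: tail)
    show "emeasure (density \<mu> (\<lambda>x. ennreal (f x))) {t<..} < \<infinity>"
      using f by (simp add: tail)
  qed (simp_all add: mu(2))
  then have "AE x in \<mu>. ennreal (f x) = ennreal (- f x)"
    by (intro density_unique) auto
  then show ?thesis
  proof eventually_elim
    case (elim x)
    then show ?case by (cases "f x" "0 :: real" rule: linorder_cases) (auto simp: ennreal_neg ennreal_eq_0_iff)
  qed
qed

lemma integrable_mult_bounded:
  fixes A h :: "'b \<Rightarrow> real"
  assumes "integrable M A" "h \<in> borel_measurable M" "AE x in M. A x \<noteq> 0 \<longrightarrow> \<bar>h x\<bar> \<le> K"
  shows "integrable M (\<lambda>x. A x * h x)"
proof (rule Bochner_Integration.integrable_bound)
  show "integrable M (\<lambda>x. K * A x)" by (intro integrable_mult_right assms)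
  show "AE x in M. norm (A x * h x) \<le> norm (K * A x)"
    using assms(3)
  proof eventually_elim
    case (elim x)
    then have "\<bar>A x\<bar> * \<bar>h x\<bar> \<le> \<bar>A x\<bar> * \<bar>K\<bar>" by (cases "A x = 0") (auto intro!: mult_left_mono)
    then show ?case by (simp add: abs_mult mult.commute)
  qed
qed (use assms(1,2) in simp)

text \<open>For a \<open>\<phi>\<close> of this kind both sides of the defining identity exist, and its right-hand side is the same
  for the two scores.\<close>

lemma gamma_scores_orthogonal:
  fixes \<phi> \<phi>' :: "real \<Rightarrow> real"
  assumes M: "finite_measure M" "W \<in> borel_measurable M"
    and s1: "is_gamma_score M W \<rho>1" and s2: "is_gamma_score M W \<rho>2"
    and deriv: "\<And>x. 0 \<le> x \<Longrightarrow> (\<phi> has_real_derivative \<phi>' x) (at x)"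
    and cont: "continuous_on {0..} \<phi>'"
    and meas [measurable]: "\<phi> \<in> borel_measurable borel" "\<phi>' \<in> borel_measurable borel"
    and bound: "\<And>x. 0 < x \<Longrightarrow> \<bar>\<phi> x\<bar> \<le> K" "\<And>x. 0 < x \<Longrightarrow> \<bar>x * \<phi>' x\<bar> \<le> K"
  shows "(LINT x|distr M borel W. indicator {0<..} x * (sqrt x * (\<rho>1 x - \<rho>2 x)) * \<phi> x) = 0"
proof -
  let ?\<mu> = "distr M borel W"
  interpret finite_measure ?\<mu> using M by (intro finite_measure.finite_measure_distr) auto
  have ac: "\<forall>b>0. abs_continuous_on {0..b} \<phi>"
  proof (intro allI impI C1_imp_abs_continuous_on)
    fix b x :: real assume "x \<in> {0..b}"
    then show "(\<phi> has_real_derivative \<phi>' x) (at x within {0..b})"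
      by (intro DERIV_subset[OF deriv]) auto
  qed (rule continuous_on_subset[OF cont], auto)
  have ds: "sqrt x * dsigma \<phi> x = \<phi> x / 2 + x * \<phi>' x" if "0 < x" for x
  proof -
    have "((\<lambda>t. sqrt t * \<phi> t) has_real_derivative (inverse (sqrt x) / 2 * \<phi> x + \<phi>' x * sqrt x)) (at x)"
      using that by (intro DERIV_mult DERIV_real_sqrt deriv) auto
    then have "dsigma \<phi> x = inverse (sqrt x) / 2 * \<phi> x + \<phi>' x * sqrt x"
      unfolding dsigma_def by (rule DERIV_imp_deriv)
    then have "sqrt x * dsigma \<phi> x = (sqrt x * inverse (sqrt x)) * \<phi> x / 2 + (sqrt x * sqrt x) * \<phi>' x"
      by (simp add: algebra_simps)
    then show ?thesis using that by simp
  qed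
  have "set_integrable ?\<mu> {0<..} (\<lambda>x. \<phi> x / 2 + x * \<phi>' x)"
    unfolding set_integrable_def
  proof (rule integrable_const_bound[where B = "2 * K"])
    show "AE x in ?\<mu>. norm (indicator {0<..} x *\<^sub>R (\<phi> x / 2 + x * \<phi>' x)) \<le> 2 * K"
    proof (rule AE_I2)
      fix x
      have K0: "0 \<le> K" using bound(1)[of 1] by linarith
      show "norm (indicator {0<..} x *\<^sub>R (\<phi> x / 2 + x * \<phi>' x)) \<le> 2 * K"
      proof (cases "0 < x")
        case True
        then have "\<bar>\<phi> x / 2 + x * \<phi>' x\<bar> \<le> 2 * K"
          using bound[OF True] by linarith
        then show ?thesis using True by simp
      qed (use K0 in simp)
    qed
  qed measurable
  then have D_int: "set_integrable ?\<mu> {0<..} (\<lambda>x. sqrt x * dsigma \<phi> x)"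
    by (subst set_integrable_cong[OF refl refl ds]) auto
  have rho_int: "set_integrable ?\<mu> {0<..} (\<lambda>x. sqrt x * \<rho> x * \<phi> x)"
    and rho_id: "(LINT x:{0<..}|?\<mu>. sqrt x * \<rho> x * \<phi> x) = - (LINT x:{0<..}|?\<mu>. sqrt x * dsigma \<phi> x)"
    if s: "is_gamma_score M W \<rho>" for \<rho>
  proof -
    have [measurable]: "\<rho> \<in> borel_measurable borel"
      and int: "integrable ?\<mu> (\<lambda>x. indicator {0<..} x *\<^sub>R (sqrt x * \<rho> x))"
      using s by (auto simp: is_gamma_score_def set_integrable_def)
    show 1: "set_integrable ?\<mu> {0<..} (\<lambda>x. sqrt x * \<rho> x * \<phi> x)"
      using integrable_mult_bounded[OF int, of \<phi> K] bound(1)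
      by (simp add: set_integrable_def mult_ac indicator_def)
    show "(LINT x:{0<..}|?\<mu>. sqrt x * \<rho> x * \<phi> x) = - (LINT x:{0<..}|?\<mu>. sqrt x * dsigma \<phi> x)"
      using s ac D_int 1 by (simp add: is_gamma_score_def)
  qed
  have "(LINT x|?\<mu>. indicator {0<..} x * (sqrt x * (\<rho>1 x - \<rho>2 x)) * \<phi> x) =
      (LINT x:{0<..}|?\<mu>. sqrt x * \<rho>1 x * \<phi> x - sqrt x * \<rho>2 x * \<phi> x)"
    unfolding set_lebesgue_integral_def by (intro Bochner_Integration.integral_cong) (auto simp: algebra_simps)
  also have "\<dots> = 0"
    using rho_int[OF s1] rho_int[OF s2] rho_id[OF s1] rho_id[OF s2] by (subst set_integral_diff) auto
  finally show ?thesis .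
qed

text \<open>With \<open>Z = (x / t) ^ n / n\<close> the functions \<open>Z / (1 + Z)\<close> tend to the indicator of \<open>{t<..}\<close>, while
  \<open>x * \<phi>' x\<close> stays bounded for each fixed \<open>n\<close>.  The denominator \<open>n\<close> makes the limit at \<open>x = t\<close> equal to \<open>0\<close>.\<close>

lemma is_gamma_score_unique:
  assumes M: "finite_measure M" and W [measurable]: "W \<in> borel_measurable M"
    and s1: "is_gamma_score M W \<rho>1" and s2: "is_gamma_score M W \<rho>2"
  shows "AE x in distr M borel W. 0 < x \<longrightarrow> \<rho>1 x = \<rho>2 x"
proof -
  let ?\<mu> = "distr M borel W"
  interpret finite_measure ?\<mu> using M by (intro finite_measure.finite_measure_distr) auto
  define f where "f = (\<lambda>x. indicator {0<..} x * (sqrt x * (\<rho>1 x - \<rho>2 x)))"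
  have f_int: "integrable ?\<mu> f"
  proof -
    have "set_integrable ?\<mu> {0<..} (\<lambda>x. sqrt x * \<rho>1 x - sqrt x * \<rho>2 x)"
      using s1 s2 unfolding is_gamma_score_def by (intro set_integral_diff) auto
    then show ?thesis by (simp add: f_def set_integrable_def algebra_simps)
  qed
  have total: "(LINT x|?\<mu>. f x) = 0"
    using gamma_scores_orthogonal[OF M W s1 s2, of "\<lambda>_. 1" "\<lambda>_. 0" 1] by (simp add: f_def)
  have pos: "(LINT x|?\<mu>. f x * indicator {t<..} x) = 0" if t: "0 < t" for t
  proof -
    define Z where "Z = (\<lambda>m x. (x / t) ^ Suc m / real (Suc m))"
    define \<phi> where "\<phi> = (\<lambda>m x. 1 - 1 / (1 + Z m x))"
    define \<phi>' where "\<phi>' = (\<lambda>m x. ((x / t) ^ m / t) / (1 + Z m x)\<^sup>2)"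
    have Z0: "0 \<le> Z m x" if "0 \<le> x" for m x unfolding Z_def using that t by simp
    have \<phi>_le: "\<bar>\<phi> m x\<bar> \<le> 1" if "0 < x" for m x
      using Z0[of x m] that unfolding \<phi>_def by (simp add: field_simps)
    have x\<phi>'_le: "\<bar>x * \<phi>' m x\<bar> \<le> real (Suc m)" if "0 < x" for m x
    proof -
      have z: "0 \<le> Z m x" using Z0 that by simp
      have "x * \<phi>' m x = real (Suc m) * Z m x / (1 + Z m x)\<^sup>2"
        by (simp add: \<phi>'_def Z_def del: of_nat_Suc)
      also have "\<bar>\<dots>\<bar> \<le> real (Suc m)"
      proof -
        have "Z m x \<le> (1 + Z m x)\<^sup>2" using z by (simp add: power2_eq_square algebra_simps)
        then have "real (Suc m) * Z m x \<le> real (Suc m) * (1 + Z m x)\<^sup>2" by (intro mult_left_mono) auto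
        moreover have "0 < (1 + Z m x)\<^sup>2" using z by simp
        moreover have "0 \<le> real (Suc m) * Z m x" using z by simp
        ultimately show ?thesis by (simp add: abs_of_nonneg pos_divide_le_eq del: of_nat_Suc)
      qed
      finally show ?thesis .
    qed
    have zero: "(LINT x|?\<mu>. f x * \<phi> m x) = 0" for m
      unfolding f_def
    proof (rule gamma_scores_orthogonal[OF M W s1 s2])
      show "(\<phi> m has_real_derivative \<phi>' m x) (at x)" if "0 \<le> x" for x
      proof -
        have "(Z m has_real_derivative (x / t) ^ m / t) (at x)"
        proof -
          have "((\<lambda>x. x / t) has_real_derivative 1 / t) (at x)" by (rule DERIV_cdivide[OF DERIV_ident])
          from DERIV_cdivide[OF DERIV_power[OF this, of "Suc m"], of "real (Suc m)"] show ?thesis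
            by (simp add: Z_def del: of_nat_Suc power_Suc)
        qed
        moreover have "1 + Z m x \<noteq> 0" using Z0[OF that, of m] by linarith
        ultimately show ?thesis unfolding \<phi>_def \<phi>'_def
          by (auto intro!: derivative_eq_intros simp: power2_eq_square)
      qed
      have "1 + Z m x \<noteq> 0" if "0 \<le> x" for x using Z0[OF that, of m] by linarith
      then show "continuous_on {0..} (\<phi>' m)"
        unfolding \<phi>'_def Z_def using t by (intro continuous_intros) auto
      show "\<phi> m \<in> borel_measurable borel" "\<phi>' m \<in> borel_measurable borel"
        unfolding \<phi>_def \<phi>'_def Z_def by measurable
      show "\<bar>\<phi> m x\<bar> \<le> real (Suc m)" if "0 < x" for x using \<phi>_le[OF that, of m] by simp
    qed (rule x\<phi>'_le)
    have lim: "(\<lambda>m. \<phi> m x) \<longlonglongrightarrow> indicator {t<..} x" if "0 < x" for x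
    proof (cases "t < x")
      case True
      then have y: "1 < x / t" using t by simp
      have "(\<lambda>m. 1 - 1 / (1 + y ^ Suc m / real (Suc m))) \<longlonglongrightarrow> 1" if "1 < y" for y :: real
        using that by real_asymp
      from this[OF y] show ?thesis using True by (simp add: \<phi>_def Z_def)
    next
      case False
      then have "0 < x / t" "x / t \<le> 1" using t that by simp_all
      have "(\<lambda>m. (x / t) ^ Suc m / real (Suc m)) \<longlonglongrightarrow> 0"
      proof (rule real_tendsto_sandwich[where f = "\<lambda>_. 0"])
        show "(\<lambda>m. 1 / real (Suc m)) \<longlonglongrightarrow> 0" by real_asymp
        show "\<forall>\<^sub>F m in sequentially. 0 \<le> (x / t) ^ Suc m / real (Suc m)"
          using t that by (intro always_eventually) auto
        show "\<forall>\<^sub>F m in sequentially. (x / t) ^ Suc m / real (Suc m) \<le> 1 / real (Suc m)"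
        proof (intro always_eventually allI divide_right_mono)
          show "(x / t) ^ Suc m \<le> 1" for m
            by (rule power_le_one) (use \<open>0 < x / t\<close> \<open>x / t \<le> 1\<close> in auto)
        qed simp
      qed simp
      then have "(\<lambda>m. 1 - 1 / (1 + (x / t) ^ Suc m / real (Suc m))) \<longlonglongrightarrow> 1 - 1 / (1 + 0)"
        by (intro tendsto_intros) auto
      then show ?thesis using False by (simp add: \<phi>_def Z_def)
    qed
    have [measurable]: "f \<in> borel_measurable borel" using f_int by simp
    have [measurable]: "\<phi> m \<in> borel_measurable borel" for m unfolding \<phi>_def Z_def by measurable
    have "(\<lambda>m. LINT x|?\<mu>. f x * \<phi> m x) \<longlonglongrightarrow> (LINT x|?\<mu>. f x * indicator {t<..} x)"
    proof (rule integral_dominated_convergence[where w = "\<lambda>x. \<bar>f x\<bar>"])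
      show "AE x in ?\<mu>. norm (f x * \<phi> m x) \<le> \<bar>f x\<bar>" for m
      proof (rule AE_I2)
        fix x show "norm (f x * \<phi> m x) \<le> \<bar>f x\<bar>"
          using \<phi>_le[of x m] by (cases "0 < x") (auto simp: abs_mult f_def intro!: mult_left_le)
      qed
      show "AE x in ?\<mu>. (\<lambda>m. f x * \<phi> m x) \<longlonglongrightarrow> f x * indicator {t<..} x"
      proof (rule AE_I2)
        fix x show "(\<lambda>m. f x * \<phi> m x) \<longlonglongrightarrow> f x * indicator {t<..} x"
        proof (cases "0 < x")
          case True
          then show ?thesis by (intro tendsto_intros lim)
        qed (simp add: f_def)
      qed
    qed (use f_int in \<open>auto intro: integrable_abs\<close>)
    then show ?thesis using LIMSEQ_unique[OF tendsto_const] unfolding zero by metis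
  qed
  have "AE x in ?\<mu>. f x = 0"
  proof (rule integral_greaterThan_zero_imp_AE_zero[OF finite_measure_axioms _ f_int])
    fix t
    show "(LINT x|?\<mu>. f x * indicator {t<..} x) = 0"
    proof (cases "0 < t")
      case False
      then have "(\<lambda>x. f x * indicator {t<..} x) = f" by (auto simp: f_def indicator_def fun_eq_iff)
      then show ?thesis using total by simp
    qed (rule pos)
  qed simp
  then show ?thesis by eventually_elim (auto simp: f_def)
qed

lemma stein_law_gamma_score:
  assumes "stein_law (distr M borel W) R"
  shows "is_gamma_score M W (\<lambda>x. R x / sqrt x)"
proof -
  interpret stein_law "distr M borel W" R by fact
  have rho: "\<rho> = (\<lambda>x. R x / sqrt x)" by (simp add: \<rho>_def fun_eq_iff)
  have "integrable (distr M borel W) (\<lambda>x. R x * indicator {0<..} x)"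
    by (intro integrable_real_mult_indicator R_int) auto
  moreover have "R x * indicator {0<..} x = indicator {0<..} x *\<^sub>R (sqrt x * \<rho> x)" for x
    by (simp add: \<rho>_def indicator_def)
  ultimately have "set_integrable (distr M borel W) {0<..} (\<lambda>x. sqrt x * \<rho> x)"
    by (simp add: set_integrable_def)
  moreover have "(LINT x:{0<..}|distr M borel W. sqrt x * \<rho> x * \<phi> x) =
            - (LINT x:{0<..}|distr M borel W. sqrt x * dsigma \<phi> x)"
    if "\<forall>b>0. abs_continuous_on {0..b} \<phi>"
      "set_integrable (distr M borel W) {0<..} (\<lambda>x. sqrt x * dsigma \<phi> x)"
      "set_integrable (distr M borel W) {0<..} (\<lambda>x. sqrt x * \<rho> x * \<phi> x)" for \<phi>
    using score_identity[of \<phi>] that by (simp add: set_integrable_def set_lebesgue_integral_def)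
  ultimately show ?thesis
    unfolding is_gamma_score_def rho[symmetric] using rho_meas by blast
qed

section \<open>Stein identities for the Gaussian and the gamma law\<close>

text \<open>The fundamental theorem of calculus on \<open>{-n..n}\<close>, as \<open>n\<close> tends to infinity.\<close>

lemma integral_derivative_eq_0:
  fixes F f :: "real \<Rightarrow> real"
  assumes cont: "continuous_on UNIV F" and S: "finite S"
    and deriv: "\<And>x. x \<notin> S \<Longrightarrow> (F has_real_derivative f x) (at x)"
    and int: "integrable lborel f"
    and lim: "(F \<longlongrightarrow> 0) at_top" "(F \<longlongrightarrow> 0) at_bot"
  shows "(LBINT x. f x) = 0"
proof -
  have FTC: "(LBINT x. f x * indicator {- real n..real n} x) = F (real n) - F (- real n)" for n
  proof -
    have "(f has_integral F (real n) - F (- real n)) {- real n..real n}"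
    proof (rule fundamental_theorem_of_calculus_interior_strong[OF S])
      show "(F has_vector_derivative f x) (at x)" if "x \<in> {- real n<..<real n} - S" for x
        using deriv[of x] that by (simp add: has_real_derivative_iff_has_vector_derivative)
      show "continuous_on {- real n..real n} F" by (rule continuous_on_subset[OF cont]) simp
    qed simp
    moreover have si: "set_integrable lborel {- real n..real n} f"
      unfolding set_integrable_def by (intro integrable_mult_indicator int) simp
    ultimately have "(LINT x:{- real n..real n}|lborel. f x) = F (real n) - F (- real n)"
      using set_borel_integral_eq_integral(2)[OF si] by (simp add: integral_unique)
    then show ?thesis by (simp add: set_lebesgue_integral_def mult.commute)
  qed
  have "(\<lambda>n. LBINT x. f x * indicator {- real n..real n} x) \<longlonglongrightarrow> (LBINT x. f x)"
  proof (rule integral_dominated_convergence[where w = "\<lambda>x. \<bar>f x\<bar>"])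
    show "AE x in lborel. (\<lambda>n. f x * indicator {- real n..real n} x) \<longlonglongrightarrow> f x"
    proof (rule AE_I2)
      fix x
      have "\<forall>\<^sub>F n in sequentially. \<bar>x\<bar> \<le> real n"
        using filterlim_real_sequentially unfolding filterlim_at_top by blast
      then have "\<forall>\<^sub>F n in sequentially. f x * indicator {- real n..real n} x = f x"
        by eventually_elim (auto simp: indicator_def)
      then show "(\<lambda>n. f x * indicator {- real n..real n} x) \<longlonglongrightarrow> f x" by (rule tendsto_eventually)
    qed
    show "AE x in lborel. norm (f x * indicator {- real n..real n} x) \<le> \<bar>f x\<bar>" for n
      by (intro AE_I2) (auto simp: indicator_def)
  qed (use int in \<open>auto intro: integrable_abs\<close>)
  moreover have "(\<lambda>n. F (real n) - F (- real n)) \<longlonglongrightarrow> 0 - 0"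
    by (intro tendsto_diff filterlim_compose[OF lim(1)] filterlim_compose[OF lim(2)]
        filterlim_real_sequentially filterlim_compose[OF filterlim_uminus_at_bot_at_top])
  ultimately show ?thesis using LIMSEQ_unique unfolding FTC by fastforce
qed

lemma integrable_gamma_kernel:
  assumes "0 < a" "0 < b"
  shows "integrable lborel (\<lambda>t. indicator {0<..} t * (t powr (a - 1) * exp (- b * t)) :: real)"
proof -
  have "set_integrable lebesgue {0<..} (\<lambda>t. norm (complex_of_real t powr (complex_of_real a - 1) / of_real (exp (b * t))))"
    using assms by (intro set_integrable_norm absolutely_integrable_Gamma_integral) auto
  moreover have "norm (complex_of_real t powr (complex_of_real a - 1) / of_real (exp (b * t))) = t powr (a - 1) * exp (- b * t)"
    if "0 < t" for t
    using that by (simp add: norm_divide norm_powr_real_powr exp_minus field_simps)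
  ultimately have "set_integrable lebesgue {0<..} (\<lambda>t. t powr (a - 1) * exp (- b * t))"
    by (subst (asm) set_integrable_cong[OF refl refl]) auto
  then have "integrable lebesgue (\<lambda>t. indicator {0<..} t * (t powr (a - 1) * exp (- b * t)))"
    by (simp add: set_integrable_def)
  then show ?thesis by (subst (asm) integrable_completion) auto
qed

lemma integrable_gamma_density:
  assumes "0 < a" "0 < b"
  shows "integrable lborel (gamma_density a b)" "integrable lborel (\<lambda>x. gamma_density a b x * x)"
proof -
  have "integrable lborel (\<lambda>t. (b powr a / Gamma a) * (indicator {0<..} t * (t powr (a - 1) * exp (- b * t))))"
    by (intro integrable_mult_right integrable_gamma_kernel assms)
  moreover have "(\<lambda>t. (b powr a / Gamma a) * (indicator {0<..} t * (t powr (a - 1) * exp (- b * t)))) = gamma_density a b"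
    by (auto simp: gamma_density_def fun_eq_iff)
  ultimately show "integrable lborel (gamma_density a b)" by simp
  have "integrable lborel (\<lambda>t. (b powr a / Gamma a) * (indicator {0<..} t * (t powr ((a + 1) - 1) * exp (- b * t))))"
    using assms by (intro integrable_mult_right integrable_gamma_kernel) auto
  moreover have "(\<lambda>t. (b powr a / Gamma a) * (indicator {0<..} t * (t powr ((a + 1) - 1) * exp (- b * t))))
      = (\<lambda>x. gamma_density a b x * x)"
    by (auto simp: gamma_density_def fun_eq_iff powr_diff)
  ultimately show "integrable lborel (\<lambda>x. gamma_density a b x * x)" by simp
qed

lemma gamma_density_nonneg: "0 < a \<Longrightarrow> 0 < b \<Longrightarrow> 0 \<le> gamma_density a b x"
  by (simp add: gamma_density_def Gamma_real_pos less_imp_le)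

lemma gamma_density_measurable [measurable]: "gamma_density a b \<in> borel_measurable borel"
  unfolding gamma_density_def by measurable

lemma stein_testE:
  assumes "stein_test f f'"
  obtains S K where "continuous_on UNIV f" "f \<in> borel_measurable borel" "f' \<in> borel_measurable borel" "finite S"
    "\<And>x. x \<notin> S \<Longrightarrow> (f has_real_derivative f' x) (at x)" "\<And>x. \<bar>f x\<bar> \<le> K" "\<And>x. \<bar>x * f' x\<bar> \<le> K" "0 \<le> K"
proof -
  obtain S K where *: "continuous_on UNIV f" "f' \<in> borel_measurable borel" "finite S"
    "\<And>x. x \<notin> S \<Longrightarrow> (f has_real_derivative f' x) (at x)" "\<And>x. \<bar>f x\<bar> \<le> K" "\<And>x. \<bar>x * f' x\<bar> \<le> K"
    using assms unfolding stein_test_def by blast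
  have "0 \<le> K" using *(5)[of 0] by linarith
  moreover have "f \<in> borel_measurable borel" using *(1) by (rule borel_measurable_continuous_onI)
  ultimately show ?thesis using that * by blast
qed

text \<open>The integrand is the derivative of \<open>y * f (g + y\<^sup>2)\<close> times the Gaussian density; it exists except at
  the finitely many \<open>n\<close> for which \<open>g + y\<^sup>2\<close> is an exceptional point of \<open>f\<close>.\<close>

lemma normal_stein_identity:
  fixes a k g :: real
  assumes test: "stein_test f f'" and k: "0 < k" and g: "0 \<le> g"
  defines "y \<equiv> \<lambda>n. a + n / k"
  shows "(LBINT n. std_normal_density n *
      ((f (g + (y n)\<^sup>2) + 2 * (y n)\<^sup>2 * f' (g + (y n)\<^sup>2)) / k - n * y n * f (g + (y n)\<^sup>2))) = 0"
proof -
  let ?e = "\<lambda>n. (f (g + (y n)\<^sup>2) + 2 * (y n)\<^sup>2 * f' (g + (y n)\<^sup>2)) / k - n * y n * f (g + (y n)\<^sup>2)"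
  obtain S K where f: "continuous_on UNIV f" and [measurable]: "f \<in> borel_measurable borel" "f' \<in> borel_measurable borel"
    and S: "finite S"
    and deriv: "\<And>x. x \<notin> S \<Longrightarrow> (f has_real_derivative f' x) (at x)" and K: "\<And>x. \<bar>f x\<bar> \<le> K" "\<And>x. \<bar>x * f' x\<bar> \<le> K" "0 \<le> K"
    by (rule stein_testE[OF test]) (rule that)
  have yf': "\<bar>(y n)\<^sup>2 * f' (g + (y n)\<^sup>2)\<bar> \<le> K" for n
  proof -
    have "\<bar>(y n)\<^sup>2 * f' (g + (y n)\<^sup>2)\<bar> \<le> \<bar>g + (y n)\<^sup>2\<bar> * \<bar>f' (g + (y n)\<^sup>2)\<bar>"
      unfolding abs_mult using g by (intro mult_right_mono) auto
    also have "\<dots> \<le> K" using K(2)[of "g + (y n)\<^sup>2"] by (simp add: abs_mult)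
    finally show ?thesis .
  qed
  define T where "T = (\<Union>s\<in>S. {k * (sqrt (s - g) - a), k * (- sqrt (s - g) - a)})"
  have T: "g + (y n)\<^sup>2 \<notin> S" if "n \<notin> T" for n
  proof
    assume "g + (y n)\<^sup>2 \<in> S"
    moreover have "\<bar>y n\<bar> = sqrt ((g + (y n)\<^sup>2) - g)" by simp
    then have "y n = sqrt ((g + (y n)\<^sup>2) - g) \<or> y n = - sqrt ((g + (y n)\<^sup>2) - g)" by linarith
    then have "n = k * (sqrt ((g + (y n)\<^sup>2) - g) - a) \<or> n = k * (- sqrt ((g + (y n)\<^sup>2) - g) - a)"
      unfolding y_def using k by (auto simp: field_simps)
    ultimately show False using that unfolding T_def by blast
  qed
  show ?thesis
  proof (rule integral_derivative_eq_0)
    let ?F = "\<lambda>n. std_normal_density n * (y n * f (g + (y n)\<^sup>2))"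
    show "finite T" unfolding T_def using S by auto
    have cf: "continuous_on UNIV (\<lambda>n. f (g + (y n)\<^sup>2))"
      by (rule continuous_on_compose2[OF f]) (use k in \<open>auto simp: y_def intro!: continuous_intros\<close>)
    show "continuous_on UNIV ?F"
      unfolding std_normal_density_def y_def by (intro continuous_intros cf[unfolded y_def]) (use k in auto)
    show "(?F has_real_derivative std_normal_density n * ?e n) (at n)" if "n \<notin> T" for n
    proof -
      have dy: "(y has_real_derivative 1 / k) (at n)"
        unfolding y_def using DERIV_add[OF DERIV_const DERIV_cdivide[OF DERIV_ident, of k], of a n UNIV] by simp
      have "((\<lambda>n. g + (y n)\<^sup>2) has_real_derivative 2 * y n * (1 / k)) (at n)"
        by (auto intro!: derivative_eq_intros dy)
      from DERIV_chain2[OF deriv[OF T[OF that]] this]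
      have df: "((\<lambda>n. f (g + (y n)\<^sup>2)) has_real_derivative f' (g + (y n)\<^sup>2) * (2 * y n * (1 / k))) (at n)" .
      have dd: "(std_normal_density has_real_derivative - n * std_normal_density n) (at n)"
        unfolding std_normal_density_def by (auto intro!: derivative_eq_intros simp: field_simps)
      show ?thesis
        by (rule DERIV_cong[OF DERIV_mult[OF dd DERIV_mult[OF dy df]]])
          (use k in \<open>simp add: field_simps power2_eq_square\<close>)
    qed
    let ?w = "\<lambda>n. (3 * K / k) * (std_normal_density n * \<bar>n\<bar> ^ 0) + (K * \<bar>a\<bar>) * (std_normal_density n * \<bar>n\<bar> ^ 1)
        + (K / k) * (std_normal_density n * \<bar>n\<bar> ^ 2)"
    show "integrable lborel (\<lambda>n. std_normal_density n * ?e n)"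
    proof (rule Bochner_Integration.integrable_bound[where f = ?w])
      show "integrable lborel ?w"
        by (intro Bochner_Integration.integrable_add integrable_mult_right integrable_std_normal_moment_abs)
      show "AE n in lborel. norm (std_normal_density n * ?e n) \<le> norm (?w n)"
      proof (rule AE_I2)
        fix n
        have "\<bar>(f (g + (y n)\<^sup>2) + 2 * (y n)\<^sup>2 * f' (g + (y n)\<^sup>2)) / k\<bar> \<le> 3 * K / k"
        proof -
          have "\<bar>f (g + (y n)\<^sup>2) + 2 * (y n)\<^sup>2 * f' (g + (y n)\<^sup>2)\<bar> \<le> 3 * K"
            using K(1)[of "g + (y n)\<^sup>2"] yf'[of n] by linarith
          then show ?thesis using k by (simp add: divide_right_mono)
        qed
        moreover have "\<bar>n * y n * f (g + (y n)\<^sup>2)\<bar> \<le> (\<bar>n\<bar> * (\<bar>a\<bar> + \<bar>n\<bar> / k)) * K"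
        proof -
          have "\<bar>y n\<bar> \<le> \<bar>a\<bar> + \<bar>n\<bar> / k" using abs_triangle_ineq[of a "n / k"] k by (simp add: y_def)
          then show ?thesis unfolding abs_mult using K(1,3) by (intro mult_mono) auto
        qed
        ultimately have "\<bar>?e n\<bar>
          \<le> 3 * K / k + (\<bar>n\<bar> * (\<bar>a\<bar> + \<bar>n\<bar> / k)) * K"
          by linarith
        then have "std_normal_density n * \<bar>?e n\<bar>
          \<le> std_normal_density n * (3 * K / k + (\<bar>n\<bar> * (\<bar>a\<bar> + \<bar>n\<bar> / k)) * K)"
          by (intro mult_left_mono) auto
        also have "\<dots> = ?w n" by (simp add: algebra_simps power2_eq_square)
        also have "\<dots> \<le> norm (?w n)" by simp
        finally show "norm (std_normal_density n * ?e n) \<le> norm (?w n)"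
          by (simp add: abs_mult)
      qed
    qed (simp add: y_def)
    have bound: "norm (?F n) \<le> K * (\<bar>a\<bar> * std_normal_density n + \<bar>n\<bar> * std_normal_density n / k)" for n
    proof -
      have "\<bar>y n\<bar> \<le> \<bar>a\<bar> + \<bar>n\<bar> / k" using abs_triangle_ineq[of a "n / k"] k by (simp add: y_def)
      then have "\<bar>y n\<bar> * \<bar>f (g + (y n)\<^sup>2)\<bar> \<le> (\<bar>a\<bar> + \<bar>n\<bar> / k) * K"
        using K(1,3) by (intro mult_mono) auto
      then have "std_normal_density n * (\<bar>y n\<bar> * \<bar>f (g + (y n)\<^sup>2)\<bar>) \<le> std_normal_density n * ((\<bar>a\<bar> + \<bar>n\<bar> / k) * K)"
        by (intro mult_left_mono) auto
      then show ?thesis by (simp add: abs_mult algebra_simps)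
    qed
    have decay: "(std_normal_density \<longlongrightarrow> 0) at_top" "((\<lambda>n. \<bar>n\<bar> * std_normal_density n) \<longlongrightarrow> 0) at_top"
      "(std_normal_density \<longlongrightarrow> 0) at_bot" "((\<lambda>n. \<bar>n\<bar> * std_normal_density n) \<longlongrightarrow> 0) at_bot"
      unfolding std_normal_density_def by real_asymp+
    have lim: "((\<lambda>n. K * (\<bar>a\<bar> * std_normal_density n + \<bar>n\<bar> * std_normal_density n / k)) \<longlongrightarrow> K * (\<bar>a\<bar> * 0 + 0 / k)) F"
      if "(std_normal_density \<longlongrightarrow> 0) F" "((\<lambda>n. \<bar>n\<bar> * std_normal_density n) \<longlongrightarrow> 0) F" for F
      using k by (intro tendsto_intros that) auto
    show "(?F \<longlongrightarrow> 0) at_top"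
      by (rule Lim_null_comparison[OF always_eventually]) (use bound lim[OF decay(1,2)] in auto)
    show "(?F \<longlongrightarrow> 0) at_bot"
      by (rule Lim_null_comparison[OF always_eventually]) (use bound lim[OF decay(3,4)] in auto)
  qed
qed

text \<open>The integrand is the derivative of \<open>x * gamma_density a b x * f (x + c)\<close>, which vanishes at \<open>0\<close> because
  \<open>a > 0\<close>.\<close>

lemma gamma_stein_identity:
  assumes test: "stein_test f f'" and a: "0 < a" and b: "0 < b" and c: "0 \<le> c"
  shows "(LBINT x. gamma_density a b x * (x * f' (x + c) + a * f (x + c) - b * x * f (x + c))) = 0"
proof -
  let ?e = "\<lambda>x. x * f' (x + c) + a * f (x + c) - b * x * f (x + c)"
  obtain S K where f: "continuous_on UNIV f" and [measurable]: "f \<in> borel_measurable borel" "f' \<in> borel_measurable borel"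
    and S: "finite S"
    and deriv: "\<And>x. x \<notin> S \<Longrightarrow> (f has_real_derivative f' x) (at x)" and K: "\<And>x. \<bar>f x\<bar> \<le> K" "\<And>x. \<bar>x * f' x\<bar> \<le> K" "0 \<le> K"
    by (rule stein_testE[OF test]) (rule that)
  define C where "C = b powr a / Gamma a"
  let ?F = "\<lambda>x. C * (max 0 x powr a * exp (- b * x) * f (x + c))"
  show ?thesis
  proof (rule integral_derivative_eq_0)
    show "finite (insert 0 ((\<lambda>s. s - c) ` S))" using S by simp
    have cf: "continuous_on UNIV (\<lambda>x. f (x + c))"
      by (rule continuous_on_compose2[OF f]) (auto intro!: continuous_intros)
    show "continuous_on UNIV ?F"
      using a by (intro continuous_intros continuous_on_powr' cf) auto
    show "(?F has_real_derivative gamma_density a b x * ?e x) (at x)"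
      if "x \<notin> insert 0 ((\<lambda>s. s - c) ` S)" for x
    proof (cases "x < 0")
      case True
      have "((\<lambda>_. 0) has_real_derivative gamma_density a b x * ?e x) (at x)"
        using True by (simp add: gamma_density_def)
      then show ?thesis
        by (rule has_field_derivative_transform_within_open[where S = "{..<0}"]) (use True in auto)
    next
      case False
      then have x: "0 < x" using that by auto
      have "x + c \<notin> S" using that by force
      from DERIV_chain2[OF deriv[OF this] DERIV_add[OF DERIV_ident DERIV_const]]
      have df: "((\<lambda>x. f (x + c)) has_real_derivative f' (x + c)) (at x)" by simp
      have dp: "((\<lambda>x. x powr a) has_real_derivative a * x powr (a - 1)) (at x)"
        using x by (rule has_real_derivative_powr)
      have de: "((\<lambda>x. exp (- b * x)) has_real_derivative - b * exp (- b * x)) (at x)"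
        by (auto intro!: derivative_eq_intros)
      have px: "x powr a = x * x powr (a - 1)" using x by (simp add: powr_diff)
      have "((\<lambda>x. C * (x powr a * exp (- b * x) * f (x + c))) has_real_derivative
          gamma_density a b x * ?e x) (at x)"
        by (rule DERIV_cong[OF DERIV_cmult[OF DERIV_mult[OF DERIV_mult[OF dp de] df]]])
          (use x in \<open>simp add: gamma_density_def C_def px algebra_simps add_divide_distrib\<close>)
      then show ?thesis
        by (rule has_field_derivative_transform_within_open[where S = "{0<..}"]) (use x in auto)
    qed
    let ?w = "\<lambda>x. (K + a * K) * gamma_density a b x + (b * K) * (gamma_density a b x * x)"
    show "integrable lborel (\<lambda>x. gamma_density a b x * ?e x)"
    proof (rule Bochner_Integration.integrable_bound[where f = ?w])
      show "integrable lborel ?w"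
        by (intro Bochner_Integration.integrable_add integrable_mult_right integrable_gamma_density a b)
      show "AE x in lborel. norm (gamma_density a b x * ?e x) \<le> norm (?w x)"
      proof (rule AE_I2)
        fix x :: real
        show "norm (gamma_density a b x * ?e x) \<le> norm (?w x)"
        proof (cases "0 < x")
          case True
          have "\<bar>x * f' (x + c)\<bar> \<le> \<bar>x + c\<bar> * \<bar>f' (x + c)\<bar>"
            unfolding abs_mult using True c by (intro mult_right_mono) auto
          also have "\<dots> \<le> K" using K(2)[of "x + c"] by (simp add: abs_mult)
          finally have 1: "\<bar>x * f' (x + c)\<bar> \<le> K" .
          have 2: "\<bar>a * f (x + c)\<bar> \<le> a * K" using K(1)[of "x + c"] a by (simp add: abs_mult)
          have 3: "\<bar>b * x * f (x + c)\<bar> \<le> b * x * K" using K(1)[of "x + c"] b True by (simp add: abs_mult)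
          have "\<bar>?e x\<bar> \<le> K + a * K + b * x * K"
            using 1 2 3 by linarith
          then have "gamma_density a b x * \<bar>?e x\<bar>
            \<le> gamma_density a b x * (K + a * K + b * x * K)"
            using gamma_density_nonneg[OF a b] by (intro mult_left_mono) auto
          also have "\<dots> = ?w x" by (simp add: algebra_simps)
          also have "\<dots> \<le> norm (?w x)" by simp
          finally show ?thesis using gamma_density_nonneg[OF a b, of x] by (simp add: abs_mult)
        qed (simp add: gamma_density_def)
      qed
    qed measurable
    have "((\<lambda>x. \<bar>C\<bar> * (x powr a * exp (- b * x)) * K) \<longlongrightarrow> \<bar>C\<bar> * 0 * K) at_top"
    proof (intro tendsto_intros)
      show "((\<lambda>x. x powr a * exp (- b * x)) \<longlongrightarrow> 0) at_top" using a b by real_asymp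
    qed
    then have lim: "((\<lambda>x. \<bar>C\<bar> * (x powr a * exp (- b * x)) * K) \<longlongrightarrow> 0) at_top" by simp
    show "(?F \<longlongrightarrow> 0) at_top"
    proof (rule Lim_null_comparison[OF _ lim])
      show "\<forall>\<^sub>F x in at_top. norm (?F x) \<le> \<bar>C\<bar> * (x powr a * exp (- b * x)) * K"
        using eventually_gt_at_top[of 0]
      proof eventually_elim
        case (elim x)
        have "\<bar>C\<bar> * (x powr a * exp (- b * x)) * \<bar>f (x + c)\<bar> \<le> \<bar>C\<bar> * (x powr a * exp (- b * x)) * K"
          using K(1)[of "x + c"] by (intro mult_left_mono) auto
        then show ?case using elim by (simp add: abs_mult mult_ac)
      qed
    qed
    show "(?F \<longlongrightarrow> 0) at_bot"
      by (rule tendsto_eventually, use eventually_le_at_bot[of "0::real"] in eventually_elim) (use a in auto)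
  qed
qed

lemma (in prob_space) expectation_eq_0_if_conditional_eq_0:
  fixes \<Phi> :: "'b \<times> 'b \<Rightarrow> real"
  assumes ind: "indep_var S A T B" and \<Phi> [measurable]: "\<Phi> \<in> borel_measurable (S \<Otimes>\<^sub>M T)"
    and int: "integrable M (\<lambda>\<omega>. \<Phi> (A \<omega>, B \<omega>))"
    and zero: "AE \<omega> in M. (LINT b|distr M T B. \<Phi> (A \<omega>, b)) = 0"
  shows "(LINT \<omega>|M. \<Phi> (A \<omega>, B \<omega>)) = 0"
proof -
  have [measurable]: "A \<in> measurable M S" "B \<in> measurable M T"
    and eq: "distr M S A \<Otimes>\<^sub>M distr M T B = distr M (S \<Otimes>\<^sub>M T) (\<lambda>\<omega>. (A \<omega>, B \<omega>))"
    using ind by (auto simp: indep_var_distribution_eq)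
  interpret DA: prob_space "distr M S A" by (rule prob_space_distr) simp
  interpret DB: prob_space "distr M T B" by (rule prob_space_distr) simp
  interpret pair_sigma_finite "distr M S A" "distr M T B" ..
  have int': "integrable (distr M S A \<Otimes>\<^sub>M distr M T B) \<Phi>"
    unfolding eq using int by (subst integrable_distr_eq) auto
  have "(LINT \<omega>|M. \<Phi> (A \<omega>, B \<omega>)) = (\<integral>p. \<Phi> p \<partial>(distr M S A \<Otimes>\<^sub>M distr M T B))"
    unfolding eq by (subst integral_distr) auto
  also have "\<dots> = (LINT a|distr M S A. (LINT b|distr M T B. \<Phi> (a, b)))"
    by (rule integral_fst'[OF int', symmetric])
  also have "\<dots> = (LINT \<omega>|M. (LINT b|distr M T B. \<Phi> (A \<omega>, b)))"
    by (subst integral_distr) auto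
  also have "\<dots> = 0"
    using zero by (subst integral_cong_AE[where g = "\<lambda>_. 0"]) auto
  finally show ?thesis .
qed

text \<open>Conditioning on two of three independent variables.\<close>

lemma (in prob_space) expectation_eq_0_by_third:
  fixes \<Phi> :: "real \<Rightarrow> real \<Rightarrow> real \<Rightarrow> real"
  assumes ind: "indep_vars (\<lambda>_. borel) Z I" and I: "i \<in> I" "j \<in> I" "k \<in> I" "k \<noteq> i" "k \<noteq> j"
    and \<Phi> [measurable]: "(\<lambda>(x, y, z). \<Phi> x y z) \<in> borel_measurable (borel \<Otimes>\<^sub>M borel \<Otimes>\<^sub>M borel)"
    and int: "integrable M (\<lambda>\<omega>. \<Phi> (Z i \<omega>) (Z j \<omega>) (Z k \<omega>))"
    and zero: "AE \<omega> in M. (LINT z|distr M borel (Z k). \<Phi> (Z i \<omega>) (Z j \<omega>) z) = 0"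
  shows "(LINT \<omega>|M. \<Phi> (Z i \<omega>) (Z j \<omega>) (Z k \<omega>)) = 0"
proof -
  let ?A = "\<lambda>\<omega>. restrict (\<lambda>i. Z i \<omega>) {i, j}" and ?B = "\<lambda>\<omega>. restrict (\<lambda>i. Z i \<omega>) {k}"
  let ?\<Phi> = "\<lambda>(p, s). \<Phi> (p i) (p j) (s k)"
  have [measurable]: "Z k \<in> borel_measurable M" using ind I by (auto simp: indep_vars_def)
  have iv: "indep_var (PiM {i, j} (\<lambda>_. borel)) ?A (PiM {k} (\<lambda>_. borel)) ?B"
    using I by (intro indep_var_restrict[OF ind]) auto
  have [measurable]: "(\<lambda>p. p i) \<in> borel_measurable (PiM {i, j} (\<lambda>_. borel))"
    "(\<lambda>p. p j) \<in> borel_measurable (PiM {i, j} (\<lambda>_. borel))"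
    "(\<lambda>p. p k) \<in> borel_measurable (PiM {k} (\<lambda>_. borel))"
    by (intro measurable_component_singleton; simp)+
  have \<Phi>': "?\<Phi> \<in> borel_measurable (PiM {i, j} (\<lambda>_. borel) \<Otimes>\<^sub>M PiM {k} (\<lambda>_. borel))"
  proof -
    have "(\<lambda>q. (fst q i, fst q j, snd q k)) \<in>
        measurable (PiM {i, j} (\<lambda>_. borel) \<Otimes>\<^sub>M PiM {k} (\<lambda>_. borel)) (borel \<Otimes>\<^sub>M borel \<Otimes>\<^sub>M (borel :: real measure))"
      by measurable
    from measurable_compose[OF this \<Phi>] show ?thesis by (simp add: split_beta')
  qed
  have "(LINT s|distr M (PiM {k} (\<lambda>_. borel)) ?B. ?\<Phi> (?A \<omega>, s)) = (LINT z|distr M borel (Z k). \<Phi> (Z i \<omega>) (Z j \<omega>) z)" for \<omega>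
  proof -
    have m: "(\<lambda>z. \<Phi> (Z i \<omega>) (Z j \<omega>) z) \<in> borel_measurable borel"
    proof -
      have "(\<lambda>z. (Z i \<omega>, Z j \<omega>, z)) \<in> measurable borel (borel \<Otimes>\<^sub>M borel \<Otimes>\<^sub>M (borel :: real measure))" by measurable
      from measurable_compose[OF this \<Phi>] show ?thesis by simp
    qed
    have B: "?B \<in> measurable M (PiM {k} (\<lambda>_. borel))" by (intro measurable_restrict) auto
    have "(LINT s|distr M (PiM {k} (\<lambda>_. borel)) ?B. \<Phi> (Z i \<omega>) (Z j \<omega>) (s k)) = (LINT \<omega>'|M. \<Phi> (Z i \<omega>) (Z j \<omega>) (?B \<omega>' k))"
      using measurable_compose[OF _ m, of "\<lambda>s. s k" "PiM {k} (\<lambda>_. borel)"]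
      by (intro integral_distr B) auto
    also have "\<dots> = (LINT z|distr M borel (Z k). \<Phi> (Z i \<omega>) (Z j \<omega>) z)"
      using m by (subst integral_distr) auto
    finally show ?thesis by simp
  qed
  then have "AE \<omega> in M. (LINT s|distr M (PiM {k} (\<lambda>_. borel)) ?B. ?\<Phi> (?A \<omega>, s)) = 0"
    using zero by simp
  from expectation_eq_0_if_conditional_eq_0[OF iv \<Phi>' _ this] int show ?thesis by simp
qed

section \<open>The quadratic gamma channel\<close>

lemma factor_through_vimage_algebra_ennreal:
  fixes h :: "'a \<Rightarrow> ennreal"
  assumes W: "W \<in> \<Omega> \<rightarrow> space N" and h: "h \<in> borel_measurable (vimage_algebra \<Omega> W N)"
  shows "\<exists>g \<in> borel_measurable N. \<forall>\<omega>\<in>\<Omega>. h \<omega> = g (W \<omega>)"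
  using h
proof (induction rule: borel_measurable_induct)
  case (cong f g)
  then show ?case by (simp add: space_vimage_algebra)
next
  case (set A)
  then obtain B where "B \<in> sets N" "A = W -` B \<inter> \<Omega>" using sets_vimage_algebra2[OF W] by auto
  then show ?case by (intro bexI[of _ "indicator B"]) (auto simp: indicator_def)
next
  case (mult u c)
  then obtain g where "g \<in> borel_measurable N" "\<forall>\<omega>\<in>\<Omega>. u \<omega> = g (W \<omega>)" by blast
  then show ?case by (intro bexI[of _ "\<lambda>x. c * g x"]) auto
next
  case (add u v)
  then obtain g g' where "g \<in> borel_measurable N" "\<forall>\<omega>\<in>\<Omega>. u \<omega> = g (W \<omega>)"
    "g' \<in> borel_measurable N" "\<forall>\<omega>\<in>\<Omega>. v \<omega> = g' (W \<omega>)" by blast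
  then show ?case by (intro bexI[of _ "\<lambda>x. g' x + g x"]) auto
next
  case (seq U)
  then obtain g where g: "\<And>i. g i \<in> borel_measurable N" "\<And>i \<omega>. \<omega> \<in> \<Omega> \<Longrightarrow> U i \<omega> = g i (W \<omega>)" by metis
  then show ?case by (intro bexI[of _ "\<lambda>x. SUP i. g i x"]) (auto simp: SUP_apply image_comp)
qed

text \<open>The positive and the negative part factor through \<open>W\<close> separately, which leaves nonnegative functions;
  for these the factor is built up by induction over measurable functions.\<close>

lemma factor_through_vimage_algebra:
  fixes h :: "'a \<Rightarrow> real"
  assumes W: "W \<in> \<Omega> \<rightarrow> space N" and h: "h \<in> borel_measurable (vimage_algebra \<Omega> W N)"
  obtains g where "g \<in> borel_measurable N" "\<And>\<omega>. \<omega> \<in> \<Omega> \<Longrightarrow> h \<omega> = g (W \<omega>)"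
proof -
  have "(\<lambda>\<omega>. ennreal (h \<omega>)) \<in> borel_measurable (vimage_algebra \<Omega> W N)"
    "(\<lambda>\<omega>. ennreal (- h \<omega>)) \<in> borel_measurable (vimage_algebra \<Omega> W N)"
    using h by measurable
  from this[THEN factor_through_vimage_algebra_ennreal[OF W]] obtain p n where
    "p \<in> borel_measurable N" "\<forall>\<omega>\<in>\<Omega>. ennreal (h \<omega>) = p (W \<omega>)"
    "n \<in> borel_measurable N" "\<forall>\<omega>\<in>\<Omega>. ennreal (- h \<omega>) = n (W \<omega>)" by blast
  moreover have "h \<omega> = enn2real (ennreal (h \<omega>)) - enn2real (ennreal (- h \<omega>))" for \<omega>
    by (cases "0 \<le> h \<omega>") (auto simp: ennreal_neg)
  ultimately have "(\<lambda>x. enn2real (p x) - enn2real (n x)) \<in> borel_measurable N"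
    "\<And>\<omega>. \<omega> \<in> \<Omega> \<Longrightarrow> h \<omega> = enn2real (p (W \<omega>)) - enn2real (n (W \<omega>))"
    by (measurable, metis)
  then show ?thesis by (rule that)
qed

lemma gamma_law_AE_nonneg: "AE x in gamma_law a b. 0 \<le> x"
proof (cases "a = 0")
  case True
  then show ?thesis unfolding gamma_law_def by (simp, subst AE_return) auto
next
  case False
  have "AE x in density lborel (\<lambda>x. ennreal (gamma_density a b x)). 0 \<le> x"
    by (subst AE_density) (auto simp: gamma_density_def)
  moreover have "gamma_law a b = density lborel (\<lambda>x. ennreal (gamma_density a b x))"
    using False by (simp add: gamma_law_def)
  ultimately show ?thesis by (simp only:)
qed

locale quadratic_gamma_channel = prob_space M for M :: "'a measure" +
  fixes X G N :: "'a \<Rightarrow> real" and \<alpha> lam r :: real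
  assumes alpha: "\<alpha> \<ge> 1/2" and lam: "lam > 0" and r: "r > 0"
    and indep: "indep_vars (\<lambda>_. borel) (\<lambda>i. [X, G, N] ! i) {0, 1, 2::nat}"
    and X_pos: "AE \<omega> in M. X \<omega> > 0" and X_int: "integrable M X"
    and G_law: "distr M borel G = gamma_law (\<alpha> - 1/2) lam"
    and N_law: "distributed M lborel N std_normal_density"
begin

abbreviation Y where "Y \<equiv> channel_Y r lam X N"
abbreviation W where "W \<equiv> channel_X r lam X G N"
abbreviation V where "V \<equiv> channel_V r lam X G N"

lemma nth_XGN: "[X, G, N] ! 0 = X" "[X, G, N] ! 1 = G" "[X, G, N] ! 2 = N"
  by simp_all

lemma X_meas [measurable]: "X \<in> borel_measurable M"
  and G_meas [measurable]: "G \<in> borel_measurable M"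
  and N_meas [measurable]: "N \<in> borel_measurable M"
proof -
  have "\<forall>i\<in>{0, 1, 2::nat}. ([X, G, N] ! i) \<in> borel_measurable M"
    using indep by (simp add: indep_vars_def)
  then show "X \<in> borel_measurable M" "G \<in> borel_measurable M" "N \<in> borel_measurable M" by auto
qed

lemma Y_meas [measurable]: "Y \<in> borel_measurable M"
  unfolding channel_Y_def[abs_def] by measurable

lemma W_meas [measurable]: "W \<in> borel_measurable M"
  unfolding channel_X_def[abs_def] by measurable

lemma V_meas [measurable]: "V \<in> borel_measurable M"
  unfolding channel_V_def[abs_def] by measurable

lemma G_nonneg: "AE \<omega> in M. 0 \<le> G \<omega>"
  using gamma_law_AE_nonneg[of "\<alpha> - 1/2" lam] unfolding G_law[symmetric]
  by (rule AE_distrD[rotated]) simp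

lemma N_distr: "distr M borel N = density lborel (\<lambda>x. ennreal (std_normal_density x))"
  using N_law unfolding distributed_def by (metis distr_cong sets_lborel)

lemma G_eq_0: "\<alpha> = 1/2 \<Longrightarrow> AE \<omega> in M. G \<omega> = 0"
proof -
  assume "\<alpha> = 1/2"
  then have "AE x in distr M borel G. x = 0"
    unfolding G_law gamma_law_def by (simp, subst AE_return) auto
  then show ?thesis by (rule AE_distrD[rotated]) simp
qed

lemma G_distr: "\<alpha> > 1/2 \<Longrightarrow> distr M borel G = density lborel (\<lambda>x. ennreal (gamma_density (\<alpha> - 1/2) lam x))"
  by (simp add: G_law gamma_law_def)

lemma G_int: "integrable M G"
proof (cases "\<alpha> = 1/2")
  case True
  show ?thesis by (rule integrable_cong_AE_imp[of M "\<lambda>_. 0"]) (use G_eq_0[OF True] in auto)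
next
  case False
  then have a: "0 < \<alpha> - 1/2" using alpha by simp
  have "integrable (density lborel (\<lambda>x. ennreal (gamma_density (\<alpha> - 1/2) lam x))) (\<lambda>x. x)"
    using integrable_gamma_density(2)[OF a lam] gamma_density_nonneg[OF a lam]
    by (subst integrable_density) auto
  then have "integrable (distr M borel G) (\<lambda>x. x)" using a G_distr by simp
  then show ?thesis by (subst (asm) integrable_distr_eq) auto
qed

lemma N_sq_int: "integrable M (\<lambda>\<omega>. (N \<omega>)\<^sup>2)"
  using distributed_integrable[OF N_law, of "\<lambda>x. x\<^sup>2"] integrable_std_normal_moment[of 2] by simp

lemma rX_int: "integrable M (\<lambda>\<omega>. \<bar>r * X \<omega>\<bar>)"
  using X_int by (intro integrable_abs integrable_mult_right)

lemma sqrt_rX_sq: "(sqrt (r * X \<omega>))\<^sup>2 = \<bar>r * X \<omega>\<bar>"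
  by (cases "0 \<le> r * X \<omega>") (simp_all add: real_sqrt_minus[symmetric] abs_if power2_eq_square flip: real_sqrt_mult)

lemma Y_sq_int: "integrable M (\<lambda>\<omega>. (Y \<omega>)\<^sup>2)"
proof (rule Bochner_Integration.integrable_bound)
  show "integrable M (\<lambda>\<omega>. 2 * \<bar>r * X \<omega>\<bar> + 2 * ((N \<omega>)\<^sup>2 / (2 * lam)))"
    using rX_int N_sq_int by (intro Bochner_Integration.integrable_add integrable_mult_right integrable_divide)
  show "AE \<omega> in M. norm ((Y \<omega>)\<^sup>2) \<le> norm (2 * \<bar>r * X \<omega>\<bar> + 2 * ((N \<omega>)\<^sup>2 / (2 * lam)))"
  proof (rule AE_I2)
    fix \<omega>
    have "(a + b)\<^sup>2 \<le> 2 * a\<^sup>2 + 2 * b\<^sup>2" for a b :: real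
      using zero_le_power2[of "a - b"] by (simp add: power2_eq_square algebra_simps)
    from this[of "sqrt (r * X \<omega>)" "N \<omega> / sqrt (2 * lam)"]
    have "(Y \<omega>)\<^sup>2 \<le> 2 * \<bar>r * X \<omega>\<bar> + 2 * ((N \<omega>)\<^sup>2 / (2 * lam))"
      using lam by (simp add: channel_Y_def sqrt_rX_sq power_divide)
    then show "norm ((Y \<omega>)\<^sup>2) \<le> norm (2 * \<bar>r * X \<omega>\<bar> + 2 * ((N \<omega>)\<^sup>2 / (2 * lam)))" by simp
  qed
qed measurable

lemma W_int: "integrable M W"
  unfolding channel_X_def[abs_def] by (intro Bochner_Integration.integrable_add G_int Y_sq_int)

lemma mult_int_of_sq_int:
  fixes A B :: "'a \<Rightarrow> real"
  assumes "integrable M (\<lambda>\<omega>. (A \<omega>)\<^sup>2)" "integrable M (\<lambda>\<omega>. (B \<omega>)\<^sup>2)"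
    and [measurable]: "A \<in> borel_measurable M" "B \<in> borel_measurable M"
  shows "integrable M (\<lambda>\<omega>. A \<omega> * B \<omega>)"
proof (rule Bochner_Integration.integrable_bound)
  show "integrable M (\<lambda>\<omega>. (A \<omega>)\<^sup>2 + (B \<omega>)\<^sup>2)" by (intro Bochner_Integration.integrable_add assms)
  show "AE \<omega> in M. norm (A \<omega> * B \<omega>) \<le> norm ((A \<omega>)\<^sup>2 + (B \<omega>)\<^sup>2)"
  proof (rule AE_I2)
    fix \<omega>
    have "\<bar>a * b\<bar> \<le> a\<^sup>2 + b\<^sup>2" for a b :: real
      using zero_le_power2[of "a - b"] zero_le_power2[of "a + b"]
      by (simp add: power2_eq_square algebra_simps abs_le_iff)
    then show "norm (A \<omega> * B \<omega>) \<le> norm ((A \<omega>)\<^sup>2 + (B \<omega>)\<^sup>2)" by simp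
  qed
qed measurable

lemma sqrt_rX_sq_int: "integrable M (\<lambda>\<omega>. (sqrt (r * X \<omega>))\<^sup>2)"
  using rX_int by (simp add: sqrt_rX_sq)

text \<open>\<open>Y\<^sup>2 \<le> W\<close> because \<open>G\<close> is nonnegative.  In particular \<open>Y = 0\<close> where \<open>W = 0\<close>, so that the last identity
  survives the division by \<open>0\<close> in the definition of \<open>V\<close>.\<close>

lemma W_bounds: "AE \<omega> in M. 0 \<le> W \<omega> \<and> \<bar>V \<omega>\<bar> \<le> 1 \<and> sqrt (W \<omega>) * V \<omega> = Y \<omega>"
  using G_nonneg
proof eventually_elim
  case (elim \<omega>)
  have le: "(Y \<omega>)\<^sup>2 \<le> W \<omega>" using elim by (simp add: channel_X_def)
  then have 0: "0 \<le> W \<omega>" using zero_le_power2[of "Y \<omega>"] by linarith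
  have Yle: "\<bar>Y \<omega>\<bar> \<le> sqrt (W \<omega>)" using real_sqrt_le_mono[OF le] by simp
  have "\<bar>V \<omega>\<bar> \<le> 1"
    using Yle 0 by (cases "W \<omega> = 0") (auto simp: channel_V_def abs_divide divide_le_eq_1)
  moreover have "sqrt (W \<omega>) * V \<omega> = Y \<omega>"
    using Yle by (cases "W \<omega> = 0") (auto simp: channel_V_def)
  ultimately show ?case using 0 by blast
qed

lemma test_bounded_int:
  fixes f :: "real \<Rightarrow> real" and A :: "'a \<Rightarrow> real"
  assumes f: "f \<in> borel_measurable borel" "\<And>x. \<bar>f x\<bar> \<le> K" and A: "integrable M A"
  shows "integrable M (\<lambda>\<omega>. A \<omega> * f (W \<omega>))"
  using f(1) by (intro integrable_mult_bounded[OF A, where K = K]) (auto simp: f(2))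

lemma test_deriv_int:
  fixes f' :: "real \<Rightarrow> real" and A :: "'a \<Rightarrow> real"
  assumes f': "f' \<in> borel_measurable borel" "\<And>x. \<bar>x * f' x\<bar> \<le> K"
    and A [measurable]: "A \<in> borel_measurable M" "AE \<omega> in M. \<bar>A \<omega>\<bar> \<le> \<bar>W \<omega>\<bar>"
  shows "integrable M (\<lambda>\<omega>. A \<omega> * f' (W \<omega>))"
proof (rule integrable_const_bound[where B = K])
  show "(\<lambda>\<omega>. A \<omega> * f' (W \<omega>)) \<in> borel_measurable M" using f'(1) by measurable
  show "AE \<omega> in M. norm (A \<omega> * f' (W \<omega>)) \<le> K"
    using A(2)
  proof eventually_elim
    case (elim \<omega>)
    then have "\<bar>A \<omega>\<bar> * \<bar>f' (W \<omega>)\<bar> \<le> \<bar>W \<omega>\<bar> * \<bar>f' (W \<omega>)\<bar>" by (intro mult_right_mono) auto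
    then show ?case using f'(2)[of "W \<omega>"] by (simp add: abs_mult)
  qed
qed

lemma Y_sq_le_W: "AE \<omega> in M. \<bar>(Y \<omega>)\<^sup>2\<bar> \<le> \<bar>W \<omega>\<bar>"
  using G_nonneg by eventually_elim (simp add: channel_X_def)

lemma G_le_W: "AE \<omega> in M. \<bar>G \<omega>\<bar> \<le> \<bar>W \<omega>\<bar>"
  using G_nonneg by eventually_elim (simp add: channel_X_def)

lemma YN_eq: "(sqrt (2 * lam) / 2) * (N \<omega> * Y \<omega>) = lam * (Y \<omega> - sqrt (r * X \<omega>)) * Y \<omega>"
proof -
  have "k / 2 * (n * y) = l * d * y" if "k \<noteq> 0" "l = k * k / 2" "d = n / k" for k l d n y :: real
    unfolding that(2,3) using that(1) by simp
  from this[of "sqrt (2 * lam)" lam "Y \<omega> - sqrt (r * X \<omega>)" "N \<omega>" "Y \<omega>"] show ?thesis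
    using lam by (simp add: channel_Y_def)
qed

lemma NY_int: "integrable M (\<lambda>\<omega>. N \<omega> * Y \<omega>)"
  by (intro mult_int_of_sq_int N_sq_int Y_sq_int) measurable

text \<open>\<open>normal_stein_identity\<close> in the variable \<open>N\<close>, for fixed \<open>X\<close> and \<open>G\<close>; the factor \<open>sqrt (2 * lam) / 2\<close>
  expresses \<open>N\<close> by \<open>Y\<close>.\<close>

lemma normal_part:
  assumes test: "stein_test f f'"
  shows "(LINT \<omega>|M. f (W \<omega>) / 2 + (Y \<omega>)\<^sup>2 * f' (W \<omega>) - lam * (Y \<omega> - sqrt (r * X \<omega>)) * Y \<omega> * f (W \<omega>)) = 0"
proof -
  obtain S K where [measurable]: "f \<in> borel_measurable borel" "f' \<in> borel_measurable borel"
    and K: "\<And>x. \<bar>f x\<bar> \<le> K" "\<And>x. \<bar>x * f' x\<bar> \<le> K"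
    by (rule stein_testE[OF test]) (rule that)
  let ?k = "sqrt (2 * lam)"
  have k: "0 < ?k" using lam by simp
  define y where "y = (\<lambda>x n. sqrt (r * x) + n / ?k)"
  define \<Phi> where "\<Phi> = (\<lambda>x g n. (f (g + (y x n)\<^sup>2) + 2 * (y x n)\<^sup>2 * f' (g + (y x n)\<^sup>2)) / ?k - n * y x n * f (g + (y x n)\<^sup>2))"
  have \<Phi>_eq: "\<Phi> (X \<omega>) (G \<omega>) (N \<omega>) = (1 * f (W \<omega>) + 2 * ((Y \<omega>)\<^sup>2 * f' (W \<omega>))) / ?k - (N \<omega> * Y \<omega>) * f (W \<omega>)" for \<omega>
    by (simp add: \<Phi>_def y_def channel_X_def channel_Y_def mult_ac)
  have "(LINT \<omega>|M. \<Phi> (([X, G, N] ! 0) \<omega>) (([X, G, N] ! 1) \<omega>) (([X, G, N] ! 2) \<omega>)) = 0"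
  proof (rule expectation_eq_0_by_third[OF indep])
    show "(\<lambda>(x, g, n). \<Phi> x g n) \<in> borel_measurable (borel \<Otimes>\<^sub>M borel \<Otimes>\<^sub>M borel)"
      unfolding \<Phi>_def y_def by measurable
    show "integrable M (\<lambda>\<omega>. \<Phi> (([X, G, N] ! 0) \<omega>) (([X, G, N] ! 1) \<omega>) (([X, G, N] ! 2) \<omega>))"
      unfolding nth_XGN \<Phi>_eq
      by (intro Bochner_Integration.integrable_diff integrable_divide Bochner_Integration.integrable_add
          integrable_mult_right test_bounded_int[OF _ K(1)] test_deriv_int[OF _ K(2)] NY_int Y_sq_le_W) auto
    show "AE \<omega> in M. (LINT z|distr M borel ([X, G, N] ! 2). \<Phi> (([X, G, N] ! 0) \<omega>) (([X, G, N] ! 1) \<omega>) z) = 0"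
      unfolding nth_XGN using G_nonneg
    proof eventually_elim
      case (elim \<omega>)
      have "(LINT z|distr M borel N. \<Phi> (X \<omega>) (G \<omega>) z) = (LBINT z. std_normal_density z * \<Phi> (X \<omega>) (G \<omega>) z)"
        unfolding N_distr by (subst integral_density) (auto simp: \<Phi>_def y_def)
      also have "\<dots> = 0"
        unfolding \<Phi>_def y_def by (rule normal_stein_identity[OF test k elim])
      finally show ?case .
    qed
  qed auto
  then have "(LINT \<omega>|M. (?k / 2) * \<Phi> (X \<omega>) (G \<omega>) (N \<omega>)) = ?k / 2 * 0"
    unfolding nth_XGN by (subst integral_mult_right_zero) simp
  moreover have "(?k / 2) * \<Phi> (X \<omega>) (G \<omega>) (N \<omega>)
      = f (W \<omega>) / 2 + (Y \<omega>)\<^sup>2 * f' (W \<omega>) - lam * (Y \<omega> - sqrt (r * X \<omega>)) * Y \<omega> * f (W \<omega>)" for \<omega>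
    unfolding \<Phi>_eq YN_eq[symmetric] using k by (simp add: field_simps)
  ultimately show ?thesis by (simp only: mult_zero_right)
qed

text \<open>\<open>gamma_stein_identity\<close> in the variable \<open>G\<close>, for fixed \<open>X\<close> and \<open>N\<close>; for shape \<open>0\<close> all terms vanish.\<close>

lemma gamma_part:
  assumes test: "stein_test f f'"
  shows "(LINT \<omega>|M. G \<omega> * f' (W \<omega>) + (\<alpha> - 1/2) * f (W \<omega>) - lam * G \<omega> * f (W \<omega>)) = 0"
proof (cases "\<alpha> = 1/2")
  case True
  obtain S K where [measurable]: "f \<in> borel_measurable borel" "f' \<in> borel_measurable borel"
    by (rule stein_testE[OF test]) (rule that)
  have "(LINT \<omega>|M. G \<omega> * f' (W \<omega>) + (\<alpha> - 1/2) * f (W \<omega>) - lam * G \<omega> * f (W \<omega>)) = (LINT \<omega>|M. 0)"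
  proof (rule integral_cong_AE)
    show "AE \<omega> in M. G \<omega> * f' (W \<omega>) + (\<alpha> - 1/2) * f (W \<omega>) - lam * G \<omega> * f (W \<omega>) = 0"
      using G_eq_0[OF True] by eventually_elim (simp add: True)
  qed measurable
  then show ?thesis by simp
next
  case False
  then have a: "0 < \<alpha> - 1/2" "1/2 < \<alpha>" using alpha by auto
  obtain S K where [measurable]: "f \<in> borel_measurable borel" "f' \<in> borel_measurable borel"
    and K: "\<And>x. \<bar>f x\<bar> \<le> K" "\<And>x. \<bar>x * f' x\<bar> \<le> K"
    by (rule stein_testE[OF test]) (rule that)
  define c where "c = (\<lambda>x n. (sqrt (r * x) + n / sqrt (2 * lam))\<^sup>2)"
  define \<Phi> where "\<Phi> = (\<lambda>x n g. g * f' (g + c x n) + (\<alpha> - 1/2) * f (g + c x n) - lam * g * f (g + c x n))"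
  have \<Phi>_eq: "\<Phi> (X \<omega>) (N \<omega>) (G \<omega>) = G \<omega> * f' (W \<omega>) + (\<alpha> - 1/2) * f (W \<omega>) - lam * G \<omega> * f (W \<omega>)" for \<omega>
    by (simp add: \<Phi>_def c_def channel_X_def channel_Y_def)
  have "(LINT \<omega>|M. \<Phi> (([X, G, N] ! 0) \<omega>) (([X, G, N] ! 2) \<omega>) (([X, G, N] ! 1) \<omega>)) = 0"
  proof (rule expectation_eq_0_by_third[OF indep])
    show "(\<lambda>(x, n, g). \<Phi> x n g) \<in> borel_measurable (borel \<Otimes>\<^sub>M borel \<Otimes>\<^sub>M borel)"
      unfolding \<Phi>_def c_def by measurable
    show "integrable M (\<lambda>\<omega>. \<Phi> (([X, G, N] ! 0) \<omega>) (([X, G, N] ! 2) \<omega>) (([X, G, N] ! 1) \<omega>))"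
      unfolding nth_XGN \<Phi>_eq
      by (intro Bochner_Integration.integrable_diff Bochner_Integration.integrable_add
          test_bounded_int[OF _ K(1)] test_deriv_int[OF _ K(2)] G_int G_le_W integrable_mult_right) auto
    show "AE \<omega> in M. (LINT z|distr M borel ([X, G, N] ! 1). \<Phi> (([X, G, N] ! 0) \<omega>) (([X, G, N] ! 2) \<omega>) z) = 0"
      unfolding nth_XGN
    proof (rule AE_I2)
      fix \<omega>
      have "(LINT z|distr M borel G. \<Phi> (X \<omega>) (N \<omega>) z) = (LBINT z. gamma_density (\<alpha> - 1/2) lam z * \<Phi> (X \<omega>) (N \<omega>) z)"
        unfolding G_distr[OF a(2)]
        by (subst integral_density) (auto simp: \<Phi>_def c_def gamma_density_nonneg[OF a(1) lam])
      also have "\<dots> = 0"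
        unfolding \<Phi>_def by (rule gamma_stein_identity[OF test a(1) lam]) (simp add: c_def)
      finally show "(LINT z|distr M borel G. \<Phi> (X \<omega>) (N \<omega>) z) = 0" .
    qed
  qed auto
  then show ?thesis unfolding nth_XGN \<Phi>_eq .
qed

text \<open>The sum of the two preceding identities, since \<open>W = G + Y\<^sup>2\<close>.\<close>

lemma channel_stein_identity:
  assumes test: "stein_test f f'"
  shows "(LINT \<omega>|M. W \<omega> * f' (W \<omega>) + f (W \<omega>) / 2) =
     (LINT \<omega>|M. (lam * W \<omega> - (\<alpha> - 1/2) - lam * sqrt (r * X \<omega>) * Y \<omega>) * f (W \<omega>))"
proof -
  obtain S K where [measurable]: "f \<in> borel_measurable borel" "f' \<in> borel_measurable borel"
    and K: "\<And>x. \<bar>f x\<bar> \<le> K" "\<And>x. \<bar>x * f' x\<bar> \<le> K"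
    by (rule stein_testE[OF test]) (rule that)
  let ?n = "\<lambda>\<omega>. f (W \<omega>) / 2 + (Y \<omega>)\<^sup>2 * f' (W \<omega>) - lam * (Y \<omega> - sqrt (r * X \<omega>)) * Y \<omega> * f (W \<omega>)"
  let ?g = "\<lambda>\<omega>. G \<omega> * f' (W \<omega>) + (\<alpha> - 1/2) * f (W \<omega>) - lam * G \<omega> * f (W \<omega>)"
  have f_int: "integrable M (\<lambda>\<omega>. f (W \<omega>))"
    using test_bounded_int[of f K "\<lambda>_. 1", OF _ K(1)] by simp
  have n_int: "integrable M ?n"
    unfolding YN_eq[symmetric]
    by (intro Bochner_Integration.integrable_diff Bochner_Integration.integrable_add integrable_divide f_int
          test_bounded_int[OF _ K(1)] test_deriv_int[OF _ K(2)] Y_sq_le_W integrable_mult_right NY_int) auto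
  have g_int: "integrable M ?g"
    by (intro Bochner_Integration.integrable_diff Bochner_Integration.integrable_add f_int
          test_bounded_int[OF _ K(1)] test_deriv_int[OF _ K(2)] G_le_W integrable_mult_right G_int) auto
  have Wf_int: "integrable M (\<lambda>\<omega>. W \<omega> * f' (W \<omega>) + f (W \<omega>) / 2)"
    by (intro Bochner_Integration.integrable_add integrable_divide f_int test_deriv_int[OF _ K(2)]) auto
  have split: "(lam * W \<omega> - (\<alpha> - 1/2) - lam * sqrt (r * X \<omega>) * Y \<omega>) * f (W \<omega>) =
      W \<omega> * f' (W \<omega>) + f (W \<omega>) / 2 - (?n \<omega> + ?g \<omega>)" for \<omega>
  proof -
    have "W \<omega> = G \<omega> + (Y \<omega>)\<^sup>2" by (simp add: channel_X_def)
    then show ?thesis by (simp add: algebra_simps power2_eq_square)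
  qed
  show ?thesis
    unfolding split Bochner_Integration.integral_diff[OF Wf_int Bochner_Integration.integrable_add[OF n_int g_int]]
      Bochner_Integration.integral_add[OF n_int g_int] normal_part[OF test] gamma_part[OF test]
    by simp
qed

definition Z where "Z \<omega> = lam * sqrt (r * X \<omega>) * V \<omega>"

lemma sqrt_rX_V_sq_int: "integrable M (\<lambda>\<omega>. (sqrt (r * X \<omega>) * V \<omega>)\<^sup>2)"
proof (rule Bochner_Integration.integrable_bound[OF rX_int])
  show "AE \<omega> in M. norm ((sqrt (r * X \<omega>) * V \<omega>)\<^sup>2) \<le> norm \<bar>r * X \<omega>\<bar>"
    using W_bounds
  proof eventually_elim
    case (elim \<omega>)
    then have "(V \<omega>)\<^sup>2 \<le> 1" by (simp add: abs_square_le_1)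
    then have "\<bar>r * X \<omega>\<bar> * (V \<omega>)\<^sup>2 \<le> \<bar>r * X \<omega>\<bar> * 1" by (intro mult_left_mono) auto
    then show ?case by (simp add: power_mult_distrib sqrt_rX_sq abs_mult)
  qed
qed measurable

lemma sqrt_rX_V_int: "integrable M (\<lambda>\<omega>. sqrt (r * X \<omega>) * V \<omega>)"
  using mult_int_of_sq_int[OF sqrt_rX_V_sq_int, of "\<lambda>_. 1"] by simp

abbreviation F where "F \<equiv> vimage_algebra (space M) W borel"

sublocale cond: finite_measure_subalgebra M F
proof
  show "subalgebra M F"
    using W_meas unfolding subalgebra_def
    by (auto simp: sets_vimage_algebra2 intro: measurable_sets)
qed

lemma W_F_meas [measurable]: "W \<in> borel_measurable F"
  by (rule measurable_vimage_algebra1) simp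

text \<open>Replacing \<open>sqrt (r X) Y = sqrt W (sqrt (r X) V)\<close> in the Stein identity of the channel by its conditional
  expectation given \<open>W\<close> leaves an identity for the law of \<open>W\<close> alone.\<close>

lemma score_regression:
  obtains g where "g \<in> borel_measurable borel"
    "\<And>\<omega>. \<omega> \<in> space M \<Longrightarrow> cond_exp_given M W Z \<omega> = g (W \<omega>)"
    "stein_law (distr M borel W) (\<lambda>x. sqrt x * g x - lam * x + (\<alpha> - 1/2))"
proof -
  have "cond_exp_given M W Z \<in> borel_measurable F"
    unfolding cond_exp_given_def by (rule borel_measurable_cond_exp)
  then obtain g where g [measurable]: "g \<in> borel_measurable borel"
    and g_eq: "\<And>\<omega>. \<omega> \<in> space M \<Longrightarrow> cond_exp_given M W Z \<omega> = g (W \<omega>)"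
    using factor_through_vimage_algebra[of W "space M" borel] by (metis Pi_UNIV UNIV_I space_borel)
  have [measurable]: "Z \<in> borel_measurable M" unfolding Z_def[abs_def] by measurable
  have sqrtW_Z: "AE \<omega> in M. sqrt (W \<omega>) * Z \<omega> = lam * (sqrt (r * X \<omega>) * Y \<omega>)"
    using W_bounds by eventually_elim (simp add: Z_def mult_ac)
  have XY_int: "integrable M (\<lambda>\<omega>. sqrt (r * X \<omega>) * Y \<omega>)"
    by (intro mult_int_of_sq_int sqrt_rX_sq_int Y_sq_int) measurable
  have tower: "integrable M (\<lambda>\<omega>. sqrt (W \<omega>) * h (W \<omega>) * g (W \<omega>))"
    "(LINT \<omega>|M. sqrt (W \<omega>) * h (W \<omega>) * g (W \<omega>)) = (LINT \<omega>|M. lam * sqrt (r * X \<omega>) * Y \<omega> * h (W \<omega>))"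
    if h [measurable]: "h \<in> borel_measurable borel" "\<And>x. \<bar>h x\<bar> \<le> K" for h K
  proof -
    have int: "integrable M (\<lambda>\<omega>. lam * (sqrt (r * X \<omega>) * Y \<omega>) * h (W \<omega>))"
      by (intro test_bounded_int[OF h] integrable_mult_right XY_int)
    have ae: "AE \<omega> in M. sqrt (W \<omega>) * h (W \<omega>) * Z \<omega> = lam * (sqrt (r * X \<omega>) * Y \<omega>) * h (W \<omega>)"
      using sqrtW_Z by eventually_elim (metis mult.commute mult.left_commute)
    have int': "integrable M (\<lambda>\<omega>. sqrt (W \<omega>) * h (W \<omega>) * Z \<omega>)"
      by (rule integrable_cong_AE_imp[OF int]) (use ae in auto)
    note c = cond.real_cond_exp_intg[OF int']
    have e: "sqrt (W \<omega>) * h (W \<omega>) * real_cond_exp M F Z \<omega> = sqrt (W \<omega>) * h (W \<omega>) * g (W \<omega>)" if "\<omega> \<in> space M" for \<omega>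
      using g_eq[OF that] by (simp add: cond_exp_given_def)
    show "integrable M (\<lambda>\<omega>. sqrt (W \<omega>) * h (W \<omega>) * g (W \<omega>))"
      using c(1) by (subst Bochner_Integration.integrable_cong[OF refl e[symmetric]]) auto
    have "(LINT \<omega>|M. sqrt (W \<omega>) * h (W \<omega>) * g (W \<omega>)) = (LINT \<omega>|M. sqrt (W \<omega>) * h (W \<omega>) * Z \<omega>)"
      using c(2) by (subst Bochner_Integration.integral_cong[OF refl e[symmetric]]) auto
    also have "\<dots> = (LINT \<omega>|M. lam * (sqrt (r * X \<omega>) * Y \<omega>) * h (W \<omega>))"
      by (rule integral_cong_AE) (use ae in auto)
    finally show "(LINT \<omega>|M. sqrt (W \<omega>) * h (W \<omega>) * g (W \<omega>)) = (LINT \<omega>|M. lam * sqrt (r * X \<omega>) * Y \<omega> * h (W \<omega>))"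
      by (simp add: mult_ac)
  qed
  let ?R = "\<lambda>x. sqrt x * g x - lam * x + (\<alpha> - 1/2)"
  have "stein_law (distr M borel W) ?R"
  proof (unfold stein_law_def, intro conjI)
    show "finite_measure (distr M borel W)" by (rule finite_measure_distr) simp
    show "stein_law_axioms (distr M borel W) ?R"
    proof
      show "AE x in distr M borel W. 0 \<le> x"
        using W_bounds by (subst AE_distr_iff) auto
      have "integrable M (\<lambda>\<omega>. ?R (W \<omega>))"
        using tower(1)[of "\<lambda>_. 1" 1]
        by (intro Bochner_Integration.integrable_add Bochner_Integration.integrable_diff integrable_mult_right W_int) auto
      then show "integrable (distr M borel W) ?R" by (subst integrable_distr_eq) auto
      have "integrable M (\<lambda>\<omega>. sqrt (W \<omega>))"
      proof (rule Bochner_Integration.integrable_bound)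
        show "integrable M (\<lambda>\<omega>. 1 + W \<omega>)" using W_int by simp
        show "AE \<omega> in M. norm (sqrt (W \<omega>)) \<le> norm (1 + W \<omega>)"
          using W_bounds
        proof eventually_elim
          case (elim \<omega>)
          have "sqrt (W \<omega>) \<le> sqrt ((1 + W \<omega>)\<^sup>2)"
            using elim by (intro real_sqrt_le_mono) (simp add: power2_eq_square algebra_simps)
          then show ?case using elim by simp
        qed
      qed measurable
      then show "integrable (distr M borel W) sqrt" by (subst integrable_distr_eq) auto
      fix f f' :: "real \<Rightarrow> real" assume test: "stein_test f f'"
      obtain S K where [measurable]: "f \<in> borel_measurable borel" "f' \<in> borel_measurable borel"
        and K: "\<And>x. \<bar>f x\<bar> \<le> K"
        by (rule stein_testE[OF test]) (rule that)
      have i1: "integrable M (\<lambda>\<omega>. lam * sqrt (r * X \<omega>) * Y \<omega> * f (W \<omega>))"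
        using test_bounded_int[of f K, OF _ K integrable_mult_right[OF XY_int, of lam]] by (simp add: mult_ac)
      have i2: "integrable M (\<lambda>\<omega>. (lam * W \<omega> - (\<alpha> - 1/2)) * f (W \<omega>))"
        by (intro test_bounded_int[OF _ K] Bochner_Integration.integrable_diff integrable_mult_right W_int) auto
      have "(LINT x|distr M borel W. x * f' x + f x / 2) = (LINT \<omega>|M. W \<omega> * f' (W \<omega>) + f (W \<omega>) / 2)"
        by (subst integral_distr) auto
      also have "\<dots> = (LINT \<omega>|M. (lam * W \<omega> - (\<alpha> - 1/2)) * f (W \<omega>) - lam * sqrt (r * X \<omega>) * Y \<omega> * f (W \<omega>))"
        unfolding channel_stein_identity[OF test] by (simp add: left_diff_distrib)
      also have "\<dots> = (LINT \<omega>|M. (lam * W \<omega> - (\<alpha> - 1/2)) * f (W \<omega>)) - (LINT \<omega>|M. sqrt (W \<omega>) * f (W \<omega>) * g (W \<omega>))"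
        using i1 i2 tower(2)[of f K, OF _ K] by simp
      also have "\<dots> = (LINT \<omega>|M. (lam * W \<omega> - (\<alpha> - 1/2)) * f (W \<omega>) - sqrt (W \<omega>) * f (W \<omega>) * g (W \<omega>))"
        using i2 tower(1)[of f K, OF _ K] by simp
      also have "\<dots> = (LINT \<omega>|M. - (?R (W \<omega>) * f (W \<omega>)))"
        by (intro Bochner_Integration.integral_cong) (simp_all add: algebra_simps)
      also have "\<dots> = - (LINT x|distr M borel W. ?R x * f x)"
        by (subst integral_distr) auto
      finally show "(LINT x|distr M borel W. x * f' x + f x / 2) = - (LINT x|distr M borel W. ?R x * f x)" .
    qed simp
  qed
  then show ?thesis using that g g_eq by blast
qed

text \<open>The function found in \<open>score_regression\<close> is a score, so the chosen score agrees with it wherever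
  \<open>W > 0\<close>, that is almost surely.\<close>

lemma gamma_score_regression:
  "AE \<omega> in M. gamma_score M W (W \<omega>) + lam * sqrt (W \<omega>) - (\<alpha> - 1/2) / sqrt (W \<omega>) = cond_exp_given M W Z \<omega>"
proof -
  obtain g where g: "g \<in> borel_measurable borel"
    "\<And>\<omega>. \<omega> \<in> space M \<Longrightarrow> cond_exp_given M W Z \<omega> = g (W \<omega>)"
    "stein_law (distr M borel W) (\<lambda>x. sqrt x * g x - lam * x + (\<alpha> - 1/2))"
    by (rule score_regression) (rule that)
  let ?R = "\<lambda>x. sqrt x * g x - lam * x + (\<alpha> - 1/2)"
  have score: "is_gamma_score M W (\<lambda>x. ?R x / sqrt x)"
    by (rule stein_law_gamma_score[OF g(3)])
  have "is_gamma_score M W (gamma_score M W)"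
    unfolding gamma_score_def by (rule someI[of "is_gamma_score M W", OF score])
  then have "AE x in distr M borel W. 0 < x \<longrightarrow> gamma_score M W x = ?R x / sqrt x"
    using score by (intro is_gamma_score_unique finite_measure_axioms) auto
  then have 1: "AE \<omega> in M. 0 < W \<omega> \<longrightarrow> gamma_score M W (W \<omega>) = ?R (W \<omega>) / sqrt (W \<omega>)"
    by (rule AE_distrD[rotated]) simp
  have "AE x in distr M borel W. 0 < x"
    using stein_law.no_atom_at_0[OF g(3)] alpha by simp
  then have 2: "AE \<omega> in M. 0 < W \<omega>" by (rule AE_distrD[rotated]) simp
  show ?thesis
    using 1 2 AE_space
  proof eventually_elim
    case (elim \<omega>)
    have "?R (W \<omega>) / sqrt (W \<omega>) = g (W \<omega>) - lam * (W \<omega> / sqrt (W \<omega>)) + (\<alpha> - 1/2) / sqrt (W \<omega>)"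
      using elim by (simp add: add_divide_distrib diff_divide_distrib)
    moreover have "W \<omega> / sqrt (W \<omega>) = sqrt (W \<omega>)" using elim by (simp add: real_div_sqrt)
    ultimately show ?case using elim g(2)[of \<omega>] by simp
  qed
qed

text \<open>Jensen's inequality makes the square of the conditional expectation integrable, so that the extended
  integral is finite and equal to the Bochner integral.\<close>

lemma std_gamma_fisher_info_eq:
  "std_gamma_fisher_info M \<alpha> lam W =
     ennreal (lam * (LINT \<omega>|M. (cond_exp_given M W (\<lambda>\<omega>. sqrt (r * X \<omega>) * V \<omega>) \<omega>)\<^sup>2))"
proof -
  let ?Z = "\<lambda>\<omega>. sqrt (r * X \<omega>) * V \<omega>"
  let ?E = "real_cond_exp M F ?Z"
  have jensen: "AE \<omega> in M. (?E \<omega>)\<^sup>2 \<le> real_cond_exp M F (\<lambda>\<omega>. (?Z \<omega>)\<^sup>2) \<omega>"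
    using cond.real_cond_exp_jensens_inequality(2)[OF sqrt_rX_V_int, of UNIV 0 0 power2]
      sqrt_rX_V_sq_int convex_power2 by simp
  have E_int: "integrable M (\<lambda>\<omega>. (?E \<omega>)\<^sup>2)"
  proof (rule Bochner_Integration.integrable_bound)
    show "integrable M (real_cond_exp M F (\<lambda>\<omega>. (?Z \<omega>)\<^sup>2))"
      by (rule cond.real_cond_exp_int(1)[OF sqrt_rX_V_sq_int])
    show "AE \<omega> in M. norm ((?E \<omega>)\<^sup>2) \<le> norm (real_cond_exp M F (\<lambda>\<omega>. (?Z \<omega>)\<^sup>2) \<omega>)"
      using jensen by eventually_elim simp
  qed simp
  have "AE \<omega> in M. real_cond_exp M F (\<lambda>\<omega>. lam * ?Z \<omega>) \<omega> = lam * ?E \<omega>"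
    by (rule cond.real_cond_exp_cmult[OF sqrt_rX_V_int])
  then have scale: "AE \<omega> in M. cond_exp_given M W Z \<omega> = lam * ?E \<omega>"
    by (simp add: cond_exp_given_def Z_def[abs_def] mult.assoc)
  have "(\<integral>\<^sup>+\<omega>. ennreal ((gamma_score M W (W \<omega>) + lam * sqrt (W \<omega>) - (\<alpha> - 1/2) / sqrt (W \<omega>))\<^sup>2) \<partial>M)
      = (\<integral>\<^sup>+\<omega>. ennreal (lam\<^sup>2 * (?E \<omega>)\<^sup>2) \<partial>M)"
    using gamma_score_regression scale
    by (intro nn_integral_cong_AE, eventually_elim) (simp add: power_mult_distrib)
  also have "\<dots> = ennreal (LINT \<omega>|M. lam\<^sup>2 * (?E \<omega>)\<^sup>2)"
    using E_int by (intro nn_integral_eq_integral integrable_mult_right) auto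
  finally have "std_gamma_fisher_info M \<alpha> lam W = ennreal (1 / lam) * ennreal (lam\<^sup>2 * (LINT \<omega>|M. (?E \<omega>)\<^sup>2))"
    unfolding std_gamma_fisher_info_def by simp
  also have "\<dots> = ennreal (1 / lam * (lam\<^sup>2 * (LINT \<omega>|M. (?E \<omega>)\<^sup>2)))"
    using lam by (intro ennreal_mult[symmetric]) auto
  also have "1 / lam * (lam\<^sup>2 * (LINT \<omega>|M. (?E \<omega>)\<^sup>2)) = lam * (LINT \<omega>|M. (?E \<omega>)\<^sup>2)"
    using lam by (simp add: power2_eq_square)
  finally show ?thesis by (simp add: cond_exp_given_def)
qed

end

theorem proposition5:
  fixes M :: "'a measure" and X G N :: "'a \<Rightarrow> real" and \<alpha> lam r :: real
  assumes "prob_space M"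
    and "\<alpha> \<ge> 1/2" and "lam > 0" and "r > 0"
    and "prob_space.indep_vars M (\<lambda>_. borel) (\<lambda>i. [X, G, N] ! i) {0, 1, 2::nat}"
    and "AE \<omega> in M. X \<omega> > 0" and "integrable M X"
    and "distr M borel G = gamma_law (\<alpha> - 1/2) lam"
    and "distributed M lborel N std_normal_density"
  defines "Xr \<equiv> channel_X r lam X G N" and "V \<equiv> channel_V r lam X G N"
  shows "(AE \<omega> in M.
            gamma_score M Xr (Xr \<omega>) + lam * sqrt (Xr \<omega>) - (\<alpha> - 1/2) / sqrt (Xr \<omega>) =
              cond_exp_given M Xr (\<lambda>\<omega>. lam * sqrt (r * X \<omega>) * V \<omega>) \<omega>) \<and>
         std_gamma_fisher_info M \<alpha> lam Xr =
           ennreal (lam * (\<integral>\<omega>. (cond_exp_given M Xr (\<lambda>\<omega>. sqrt (r * X \<omega>) * V \<omega>) \<omega>)\<^sup>2 \<partial>M))"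
proof -
  interpret prob_space M by fact
  interpret quadratic_gamma_channel M X G N \<alpha> lam r
    using assms by unfold_locales
  show ?thesis
    using gamma_score_regression std_gamma_fisher_info_eq
    unfolding Xr_def V_def Z_def[abs_def] by blast
qed

end
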